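(* There exists a countable subfield $C$ of $\mathbb{C}_p$ such that for every $n\ge1$, if $z_1,\dots,z_n\in\mathbb{D}_p$ are $\mathbb{Q}$-linearly independent modulo $C$, then $$\operatorname{tr.deg.}_C C(z_1,\dots,z_n,\exp(z_1),\dots,\exp(z_n))>n.$$
   Context: $\mathbb{C}_p$ is the completion of an algebraic closure of $\mathbb{Q}_p$ with valuation $v$, $v(p)=1$; $\mathbb{D}_p=\{x\in\mathbb{C}_p:v(x)>1/(p-1)\}$ and $\exp(x)=\sum_{j\ge0}x^j/j!$ on $\mathbb{D}_p$. Elements $z_1,\dots,z_n$ are $\mathbb{Q}$-linearly independent modulo $C$ if $C$ contains no non-trivial $\mathbb{Q}$-linear combination of the $z_i$ (i.e. $\sum r_iz_i\in C$ with $r_i\in\mathbb{Q}$ implies all $r_i=0$). *)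

theory Defs
  imports "HOL-Analysis.Analysis" "HOL-Library.Poly_Mapping" "HOL-Computational_Algebra.Polynomial"
begin

definition is_subfield :: "'a::field set \<Rightarrow> bool" where
  "is_subfield F \<longleftrightarrow> 0 \<in> F \<and> 1 \<in> F \<and>
     (\<forall>x\<in>F. \<forall>y\<in>F. x + y \<in> F \<and> x * y \<in> F) \<and> (\<forall>x\<in>F. - x \<in> F \<and> inverse x \<in> F)"

definition adjoin :: "'a::field set \<Rightarrow> 'a set \<Rightarrow> 'a set" where
  "adjoin C S = is_subfield hull (C \<union> S)"

definition algebraic_over :: "'a::field set \<Rightarrow> 'a \<Rightarrow> bool" where
  "algebraic_over F x \<longleftrightarrow> (\<exists>q. q \<noteq> 0 \<and> (\<forall>k. coeff q k \<in> F) \<and> poly q x = 0)"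

definition is_algebraic_closure :: "'a::field set \<Rightarrow> 'a set \<Rightarrow> bool" where
  "is_algebraic_closure F L \<longleftrightarrow> is_subfield L \<and> F \<subseteq> L \<and> (\<forall>x\<in>L. algebraic_over F x) \<and>
     (\<forall>q. (\<forall>k. coeff q k \<in> L) \<and> degree q > 0 \<longrightarrow> (\<exists>x\<in>L. poly q x = 0))"

text \<open>A polynomial relation between elements of \<open>S\<close> is an element of
  \<open>('a \<Rightarrow>\<^sub>0 nat) \<Rightarrow>\<^sub>0 'a\<close> (finitely supported map from monomials to coefficients) whose
  variables are the elements of \<open>S\<close> themselves; the sum below is its value when every
  variable \<open>s\<close> is sent to \<open>s\<close>.\<close>

definition algebraically_independent :: "'a::field set \<Rightarrow> 'a set \<Rightarrow> bool" where
  "algebraically_independent C S \<longleftrightarrow>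
     (\<forall>P :: ('a \<Rightarrow>\<^sub>0 nat) \<Rightarrow>\<^sub>0 'a.
        (\<forall>m. Poly_Mapping.lookup P m \<in> C) \<and>
        (\<forall>m\<in>Poly_Mapping.keys P. Poly_Mapping.keys m \<subseteq> S) \<and>
        (\<Sum>m\<in>Poly_Mapping.keys P. Poly_Mapping.lookup P m *
           (\<Prod>s\<in>Poly_Mapping.keys m. s ^ Poly_Mapping.lookup m s)) = 0
        \<longrightarrow> P = 0)"

text \<open>The largest cardinality of an algebraically independent subset, with all infinite
  cardinals identified with \<open>\<infinity>\<close>.\<close>

definition trdeg :: "'a::field set \<Rightarrow> 'a set \<Rightarrow> enat" where
  "trdeg C F = (SUP B\<in>{B. finite B \<and> B \<subseteq> F \<and> algebraically_independent C B}. enat (card B))"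

text \<open>The type \<open>'a\<close> with valuation \<open>v\<close> is a completion of an algebraic closure of the
  \<open>p\<close>-adic numbers; this determines \<open>('a, v)\<close> up to isomorphism.  The metric of \<open>'a\<close> is the
  one induced by \<open>v\<close>, so that completeness is the class \<open>complete_space\<close>.  The axioms on \<open>v\<close>
  force it to be the \<open>p\<close>-adic valuation on the rationals (by primality of \<open>p\<close> and \<open>v p = 1\<close>),
  hence the closure of the rationals in the complete field \<open>'a\<close> is the field of
  \<open>p\<close>-adic numbers.\<close>

locale padic_complex_field =
  fixes p :: nat and v :: "'a::{field_char_0, complete_space} \<Rightarrow> ereal"
  assumes prime_p: "prime p"
    and v_eq_infinity_iff: "\<And>x. v x = \<infinity> \<longleftrightarrow> x = 0"
    and v_not_minus_infinity: "\<And>x. v x \<noteq> - \<infinity>"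
    and v_mult: "\<And>x y. v (x * y) = v x + v y"
    and v_add: "\<And>x y. v (x + y) \<ge> min (v x) (v y)"
    and v_p: "v (of_nat p) = 1"
    and dist_v: "\<And>x y. dist x y = (if x = y then 0 else real p powr (- real_of_ereal (v (x - y))))"
    and dense_algebraic_closure:
      "\<exists>L. is_algebraic_closure (closure (\<rat> :: 'a set)) L \<and> closure L = UNIV"

definition padic_disc :: "nat \<Rightarrow> ('a::field \<Rightarrow> ereal) \<Rightarrow> 'a set" where
  "padic_disc p v = {x. v x > ereal (1 / (real p - 1))}"

text \<open>The constant \<open>exp\<close> of the library needs a real normed algebra, hence is not available here.\<close>

definition padic_exp :: "'a::{field_char_0, metric_space} \<Rightarrow> 'a" where
  "padic_exp x = suminf (\<lambda>j. x ^ j / fact j)"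

definition rat_lin_indep_mod :: "'a::field_char_0 set \<Rightarrow> nat \<Rightarrow> (nat \<Rightarrow> 'a) \<Rightarrow> bool" where
  "rat_lin_indep_mod C n z \<longleftrightarrow>
     (\<forall>r :: nat \<Rightarrow> rat. (\<Sum>i=1..n. of_rat (r i) * z i) \<in> C \<longrightarrow> (\<forall>i\<in>{1..n}. r i = 0))"

end

theory Submission
  imports Defs "Jordan_Normal_Form.Determinant" "HOL-Computational_Algebra.Formal_Laurent_Series"
    "HOL-Computational_Algebra.Polynomial_FPS" "HOL-Library.Function_Algebras"
begin

text \<open>
  Let \<open>C\<close> be a countable subfield that contains every isolated solution of every polynomial-exponential
  system over \<open>C\<close>; it exists because \<open>\<complex>\<^sub>p\<close> is separable. If all derivations over \<open>C\<close> that respect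
  \<open>exp\<close> at \<open>z\<close> kill \<open>z\<close>, then the system that defines the locus of \<open>(z, exp z)\<close> has injective
  differential at \<open>z\<close>, so \<open>z\<close> is isolated and lies in \<open>C\<close>. Hence for \<open>z\<close> independent modulo \<open>C\<close>
  there is a derivation \<open>D\<close> over \<open>C\<close> with \<open>D (exp z\<^sub>i) = exp z\<^sub>i * D z\<^sub>i\<close> and some \<open>D z\<^sub>i \<noteq> 0\<close>.
  After an integral change of basis the \<open>z\<^sub>i\<close> that are not killed by \<open>D\<close> are independent modulo
  \<open>ker D\<close>. By Ax's argument their forms \<open>d (exp z\<^sub>i) / exp z\<^sub>i - d z\<^sub>i\<close> are linearly independent
  differentials over \<open>ker D\<close>; since \<open>D\<close> annihilates them, one more \<open>d z\<^sub>i\<close> is independent of them. The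
  \<open>z\<^sub>i\<close> killed by \<open>D\<close> are handled by induction on \<open>n\<close>, and the ranks add up because \<open>ker D\<close> contains
  these \<open>z\<^sub>i\<close> together with their exponentials.
\<close>

section \<open>Derivations\<close>

datatype 'a dual = Dual (dual_re: 'a) (dual_ep: 'a)

instantiation dual :: (comm_ring_1) comm_ring_1
begin
definition "0 = Dual 0 0"
definition "1 = Dual 1 0"
definition "x + y = Dual (dual_re x + dual_re y) (dual_ep x + dual_ep y)"
definition "x - y = Dual (dual_re x - dual_re y) (dual_ep x - dual_ep y)"
definition "- x = Dual (- dual_re x) (- dual_ep x)"
definition "x * y = Dual (dual_re x * dual_re y) (dual_re x * dual_ep y + dual_ep x * dual_re y)"
instance
  by standard (auto simp: zero_dual_def one_dual_def plus_dual_def minus_dual_def uminus_dual_def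
      times_dual_def algebra_simps)
end

lemma dual_sel [simp]:
  "dual_re 0 = 0" "dual_ep 0 = 0" "dual_re 1 = 1" "dual_ep 1 = 0"
  "dual_re (x + y) = dual_re x + dual_re y" "dual_ep (x + y) = dual_ep x + dual_ep y"
  "dual_re (x - y) = dual_re x - dual_re y" "dual_ep (x - y) = dual_ep x - dual_ep y"
  "dual_re (- x) = - dual_re x" "dual_ep (- x) = - dual_ep x"
  "dual_re (x * y) = dual_re x * dual_re y"
  "dual_ep (x * y) = dual_re x * dual_ep y + dual_ep x * dual_re y"
  by (simp_all add: zero_dual_def one_dual_def plus_dual_def minus_dual_def uminus_dual_def
      times_dual_def)

lemma dual_eq_iff: "x = y \<longleftrightarrow> dual_re x = dual_re y \<and> dual_ep x = dual_ep y"
  by (auto intro: dual.expand)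

lemma dual_unit_cancel:
  fixes a b :: "'a::field dual"
  assumes "a * b = 0" "dual_re a \<noteq> 0"
  shows "b = 0"
proof -
  have "dual_re a * dual_re b = 0" "dual_re a * dual_ep b + dual_ep a * dual_re b = 0"
    using assms(1) by (metis dual_sel(1) dual_sel(11), metis dual_sel(2) dual_sel(12))
  with assms(2) show ?thesis by (auto simp: dual_eq_iff)
qed

definition derivation :: "('a::field \<Rightarrow> 'a) \<Rightarrow> bool" where
  "derivation d \<longleftrightarrow> (\<forall>x y. d (x + y) = d x + d y) \<and> (\<forall>x y. d (x * y) = x * d y + d x * y)"

definition Der :: "'a::field set \<Rightarrow> ('a \<Rightarrow> 'a) set" where
  "Der C = {d. derivation d \<and> (\<forall>c\<in>C. d c = 0)}"

text \<open>The graph of a derivation of a subring is a subring of the dual numbers.\<close>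

definition functional_subring :: "'a::field dual set \<Rightarrow> bool" where
  "functional_subring G \<longleftrightarrow> 0 \<in> G \<and> 1 \<in> G \<and> (\<forall>x\<in>G. \<forall>y\<in>G. x + y \<in> G \<and> x * y \<in> G) \<and>
     (\<forall>x\<in>G. - x \<in> G) \<and> (\<forall>x\<in>G. dual_re x = 0 \<longrightarrow> x = 0)"

lemma functional_subringD:
  assumes "functional_subring G"
  shows "0 \<in> G" "1 \<in> G" "a \<in> G \<Longrightarrow> b \<in> G \<Longrightarrow> a + b \<in> G" "a \<in> G \<Longrightarrow> b \<in> G \<Longrightarrow> a * b \<in> G"
    "a \<in> G \<Longrightarrow> - a \<in> G" "a \<in> G \<Longrightarrow> dual_re a = 0 \<Longrightarrow> a = 0"
  using assms by (auto simp: functional_subring_def)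

lemma functional_subring_unique:
  assumes "functional_subring G" "x \<in> G" "y \<in> G" "dual_re x = dual_re y"
  shows "x = y"
proof -
  have "x + - y \<in> G" "dual_re (x + - y) = 0"
    using assms unfolding functional_subring_def by (blast, simp)
  then have "x + - y = 0" using assms(1) unfolding functional_subring_def by blast
  then show ?thesis by simp
qed

lemma functional_subring_sum:
  assumes "functional_subring G" "\<And>i. i \<in> I \<Longrightarrow> f i \<in> G"
  shows "(\<Sum>i\<in>I. f i) \<in> G"
  using assms(2)
proof (induction I rule: infinite_finite_induct)
qed (use assms(1) in \<open>auto simp: functional_subring_def\<close>)

lemma dual_re_poly: "dual_re (poly P x) = poly (map_poly dual_re P) (dual_re x)"
proof (induction P)
  case (pCons a P)
  then show ?case by (cases "P = 0 \<and> a = 0") (auto simp: map_poly_pCons)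
qed simp

definition adjoin_dual :: "'a::field dual set \<Rightarrow> 'a dual \<Rightarrow> 'a dual set" where
  "adjoin_dual G x = {poly P x |P. \<forall>k. coeff P k \<in> G}"

lemma functional_subring_adjoin:
  assumes G: "functional_subring G"
    and f: "\<And>P. \<forall>k. coeff P k \<in> G \<Longrightarrow> dual_re (poly P x) = 0 \<Longrightarrow> poly P x = 0"
  shows "functional_subring (adjoin_dual G x)"
  unfolding functional_subring_def
proof (intro conjI ballI impI)
  have G0: "0 \<in> G" "1 \<in> G" and Gc: "\<And>a b. a \<in> G \<Longrightarrow> b \<in> G \<Longrightarrow> a + b \<in> G \<and> a * b \<in> G"
    and Gm: "\<And>a. a \<in> G \<Longrightarrow> - a \<in> G"
    using G by (auto simp: functional_subring_def)
  show "0 \<in> adjoin_dual G x"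
    unfolding adjoin_dual_def by (rule CollectI, rule exI[of _ 0]) (use G0 in auto)
  show "1 \<in> adjoin_dual G x"
    unfolding adjoin_dual_def by (rule CollectI, rule exI[of _ 1]) (use G0 in \<open>auto simp: coeff_1\<close>)
  fix a assume "a \<in> adjoin_dual G x"
  then obtain P where P: "a = poly P x" "\<forall>k. coeff P k \<in> G" by (auto simp: adjoin_dual_def)
  show "- a \<in> adjoin_dual G x"
    unfolding adjoin_dual_def by (rule CollectI, rule exI[of _ "- P"]) (use P Gm in auto)
  show "a = 0" if "dual_re a = 0"
    using P f that by auto
  fix b assume "b \<in> adjoin_dual G x"
  then obtain Q where Q: "b = poly Q x" "\<forall>k. coeff Q k \<in> G" by (auto simp: adjoin_dual_def)
  show "a + b \<in> adjoin_dual G x"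
    unfolding adjoin_dual_def by (rule CollectI, rule exI[of _ "P + Q"]) (use P Q Gc in auto)
  have "\<forall>k. coeff (P * Q) k \<in> G"
    unfolding coeff_mult using P Q Gc by (auto intro!: functional_subring_sum[OF G])
  then show "a * b \<in> adjoin_dual G x"
    unfolding adjoin_dual_def using P Q by (intro CollectI exI[of _ "P * Q"]) auto
qed

lemma adjoin_dual_superset:
  assumes "functional_subring G"
  shows "G \<subseteq> adjoin_dual G x" "x \<in> adjoin_dual G x"
proof -
  show "G \<subseteq> adjoin_dual G x"
  proof
    fix a assume "a \<in> G"
    then show "a \<in> adjoin_dual G x"
      unfolding adjoin_dual_def using assms
      by (intro CollectI exI[of _ "[:a:]"]) (auto simp: functional_subring_def coeff_pCons split: nat.split)
  qed
  show "x \<in> adjoin_dual G x"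
    unfolding adjoin_dual_def using assms
    by (intro CollectI exI[of _ "[:0, 1:]"]) (auto simp: functional_subring_def coeff_pCons split: nat.split)
qed

lemma poly_Dual_shift:
  "poly P (Dual s u) = poly P (Dual s 0) + Dual 0 (u * poly (pderiv (map_poly dual_re P)) s)"
proof (induction P)
  case (pCons a P)
  have e: "map_poly dual_re (pCons a P) = pCons (dual_re a) (map_poly dual_re P)"
    by (rule map_poly_pCons) simp
  show ?case
    unfolding e by (simp add: dual_eq_iff pCons.IH pderiv_pCons dual_re_poly algebra_simps)
qed (simp add: dual_eq_iff)

lemma functional_subring_lead_coeff:
  assumes G: "functional_subring G" and P: "\<forall>k. coeff P k \<in> G"
  shows "degree (map_poly dual_re P) = degree P" "map_poly dual_re P = 0 \<longleftrightarrow> P = 0"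
    "P \<noteq> 0 \<Longrightarrow> dual_re (lead_coeff P) \<noteq> 0"
proof -
  have *: "dual_re (lead_coeff P) \<noteq> 0" if "P \<noteq> 0"
    using that G P by (metis functional_subring_def leading_coeff_0_iff)
  then show "P \<noteq> 0 \<Longrightarrow> dual_re (lead_coeff P) \<noteq> 0" .
  show "map_poly dual_re P = 0 \<longleftrightarrow> P = 0"
    using * by (metis coeff_map_poly dual_sel(1) coeff_0 map_poly_0)
  show "degree (map_poly dual_re P) = degree P"
  proof (cases "P = 0")
    case False
    with * show ?thesis by (intro map_poly_degree_eq) auto
  qed simp
qed

lemma functional_subring_extend:
  fixes s :: "'a::field_char_0"
  assumes G: "functional_subring G"
  shows "\<exists>u. functional_subring (adjoin_dual G (Dual s u))"
proof (cases "\<exists>P. P \<noteq> 0 \<and> (\<forall>k. coeff P k \<in> G) \<and> poly (map_poly dual_re P) s = 0")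
  case False
  have "functional_subring (adjoin_dual G (Dual s 0))"
  proof (rule functional_subring_adjoin[OF G])
    fix P assume "\<forall>k. coeff P k \<in> G" "dual_re (poly P (Dual s 0)) = 0"
    with False have "P = 0" by (simp add: dual_re_poly) blast
    then show "poly P (Dual s 0) = 0" by simp
  qed
  then show ?thesis ..
next
  case True
  define R where "R P \<longleftrightarrow> P \<noteq> 0 \<and> (\<forall>k. coeff P k \<in> G) \<and> poly (map_poly dual_re P) s = 0" for P
  have "\<exists>P. R P" using True by (simp add: R_def)
  then obtain M where "R M" and min': "\<And>P. R P \<Longrightarrow> degree M \<le> degree P"
    using ex_has_least_nat[of R _ degree] by blast
  then have M: "M \<noteq> 0" "\<forall>k. coeff M k \<in> G" "poly (map_poly dual_re M) s = 0"
    by (auto simp: R_def)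
  have min: "degree M \<le> degree P"
    if "P \<noteq> 0" "\<forall>k. coeff P k \<in> G" "poly (map_poly dual_re P) s = 0" for P
    using min' that by (simp add: R_def)
  note GM = functional_subring_lead_coeff[OF G]
  have Gc: "\<And>a b. a \<in> G \<Longrightarrow> b \<in> G \<Longrightarrow> a + b \<in> G \<and> a * b \<in> G" and Gm: "\<And>a. a \<in> G \<Longrightarrow> - a \<in> G"
    and G0: "0 \<in> G" "1 \<in> G"
    using G by (auto simp: functional_subring_def)
  have dM: "degree M > 0"
  proof (rule ccontr)
    assume "\<not> 0 < degree M"
    then obtain a where "M = [:a:]" by (metis degree_eq_zeroE not_gr_zero)
    with M GM(3)[of M] show False by (auto simp: map_poly_pCons)
  qed
  have M': "poly (pderiv (map_poly dual_re M)) s \<noteq> 0"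
  proof
    assume z: "poly (pderiv (map_poly dual_re M)) s = 0"
    define N where "N = (\<Sum>i<degree M. monom (of_nat (Suc i) * coeff M (Suc i)) i)"
    have cN: "coeff N k = of_nat (Suc k) * coeff M (Suc k)" for k
      by (cases "k < degree M") (auto simp: N_def coeff_sum coeff_eq_0)
    have ofn: "of_nat n \<in> G" for n by (induction n) (use G0 Gc in auto)
    have c: "\<forall>k. coeff N k \<in> G"
      unfolding cN by (metis Gc M(2) ofn)
    have e: "map_poly dual_re N = pderiv (map_poly dual_re M)"
    proof (rule poly_eqI)
      fix n
      have "dual_re (of_nat m * x) = of_nat m * dual_re x" for m and x :: "'a dual"
        by (induction m) (auto simp: algebra_simps)
      then show "coeff (map_poly dual_re N) n = coeff (pderiv (map_poly dual_re M)) n"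
        unfolding coeff_pderiv by (simp add: coeff_map_poly cN del: of_nat_Suc)
    qed
    have "pderiv (map_poly dual_re M) \<noteq> 0"
      using dM GM(1)[OF M(2)] by (simp add: pderiv_eq_0_iff)
    then have "N \<noteq> 0" using e by auto
    then have "degree M \<le> degree N" using min c e z by metis
    also have "\<dots> = degree (pderiv (map_poly dual_re M))" using e GM(1)[OF c] by simp
    also have "\<dots> < degree M" using GM(1)[OF M(2)] dM by (simp add: degree_pderiv)
    finally show False by simp
  qed
  define u where "u = - dual_ep (poly M (Dual s 0)) / poly (pderiv (map_poly dual_re M)) s"
  define x where "x = Dual s u"
  have Mx: "poly M x = 0"
    unfolding x_def by (subst poly_Dual_shift)
      (use M M' in \<open>auto simp: u_def dual_re_poly dual_eq_iff\<close>)
  have "poly P x = 0" if "\<forall>k. coeff P k \<in> G" "poly (map_poly dual_re P) s = 0" for P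
    using that
  proof (induction "degree P" arbitrary: P rule: less_induct)
    case less
    show ?case
    proof (cases "P = 0")
      case False
      define k where "k = degree P - degree M"
      have k: "degree P = k + degree M" using min[OF False less.prems] by (simp add: k_def)
      define Q where "Q = Polynomial.smult (lead_coeff M) P - monom (lead_coeff P) k * M"
      have cQ: "\<forall>j. coeff Q j \<in> G"
      proof
        fix j
        have "coeff Q j = lead_coeff M * coeff P j + - (if j < k then 0 else lead_coeff P * coeff M (j - k))"
          by (auto simp: Q_def coeff_monom_mult)
        also have "\<dots> \<in> G" using Gc Gm G0 M(2) less.prems(1) by (auto simp del: add_uminus_conv_diff)
        finally show "coeff Q j \<in> G" .
      qed
      have px: "poly Q x = lead_coeff M * poly P x"
        by (simp add: Q_def Mx)
      have rx: "dual_re x = s" by (simp add: x_def)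
      have "dual_re (poly Q x) = 0"
        unfolding px using less.prems(2) by (simp add: dual_re_poly rx)
      then have rQ: "poly (map_poly dual_re Q) s = 0" by (simp add: dual_re_poly rx)
      have "coeff Q (degree P) = 0"
        unfolding Q_def k by (simp add: coeff_monom_mult)
      moreover have "coeff Q j = 0" if "j > degree P" for j
      proof -
        have "coeff P j = 0" "j \<ge> k" "coeff M (j - k) = 0"
          using that k by (auto intro!: coeff_eq_0)
        then show ?thesis by (simp add: Q_def coeff_monom_mult)
      qed
      ultimately have "degree Q < degree P \<or> Q = 0"
        by (metis eq_zero_or_degree_less degree_le linorder_not_less order_le_less)
      then have "poly Q x = 0" using less.hyps[OF _ cQ rQ] by auto
      then show ?thesis using px dual_unit_cancel GM(3)[OF M(2) M(1)] by metis
    qed simp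
  qed
  then have "functional_subring (adjoin_dual G x)"
    by (intro functional_subring_adjoin[OF G]) (auto simp: dual_re_poly x_def)
  then show ?thesis unfolding x_def by blast
qed

theorem derivation_extension:
  fixes G :: "'a::field_char_0 dual set"
  assumes G: "functional_subring G"
  shows "\<exists>d. derivation d \<and> (\<forall>x\<in>G. d (dual_re x) = dual_ep x)"
proof -
  have "\<exists>M\<in>{H. functional_subring H \<and> G \<subseteq> H}. \<forall>X\<in>{H. functional_subring H \<and> G \<subseteq> H}. M \<subseteq> X \<longrightarrow> X = M"
  proof (rule subset_Zorn_nonempty)
    show "{H. functional_subring H \<and> G \<subseteq> H} \<noteq> {}" using G by blast
    fix \<C> :: "'a dual set set"
    assume ne: "\<C> \<noteq> {}" and ch: "subset.chain {H. functional_subring H \<and> G \<subseteq> H} \<C>"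
    then have fs: "\<And>H. H \<in> \<C> \<Longrightarrow> functional_subring H \<and> G \<subseteq> H" by (auto simp: subset.chain_def)
    have two: "\<exists>H\<in>\<C>. a \<in> H \<and> b \<in> H" if "a \<in> \<Union>\<C>" "b \<in> \<Union>\<C>" for a b
      using that ch unfolding subset.chain_def by blast
    have "functional_subring (\<Union>\<C>)"
      unfolding functional_subring_def
    proof (intro conjI ballI impI)
      show "0 \<in> \<Union>\<C>" "1 \<in> \<Union>\<C>" using ne fs functional_subringD(1,2) by blast+
      fix a assume a: "a \<in> \<Union>\<C>"
      then show "- a \<in> \<Union>\<C>" using fs functional_subringD(5) by blast
      show "dual_re a = 0 \<Longrightarrow> a = 0" using a fs functional_subringD(6) by blast
      fix b assume "b \<in> \<Union>\<C>"
      with two[OF a] obtain H where "H \<in> \<C>" "a \<in> H" "b \<in> H" by blast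
      then show "a + b \<in> \<Union>\<C>" "a * b \<in> \<Union>\<C>" using fs functional_subringD(3,4) by blast+
    qed
    then show "\<Union>\<C> \<in> {H. functional_subring H \<and> G \<subseteq> H}" using ne fs by blast
  qed
  then obtain M where M: "functional_subring M" "G \<subseteq> M"
    and max': "\<forall>X\<in>{H. functional_subring H \<and> G \<subseteq> H}. M \<subseteq> X \<longrightarrow> X = M"
    by blast
  have max: "X = M" if "functional_subring X" "M \<subseteq> X" for X
    using bspec[OF max', of X] that M(2) by auto
  have "\<exists>u. Dual s u \<in> M" for s
  proof -
    obtain u where "functional_subring (adjoin_dual M (Dual s u))"
      using functional_subring_extend[OF M(1)] by blast
    then show ?thesis using max adjoin_dual_superset[OF M(1)] by blast
  qed
  then obtain d where d: "\<And>s. Dual s (d s) \<in> M" by metis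
  note un = functional_subring_unique[OF M(1)]
  have Mc: "\<And>a b. a \<in> M \<Longrightarrow> b \<in> M \<Longrightarrow> a + b \<in> M \<and> a * b \<in> M"
    using M(1) by (auto simp: functional_subring_def)
  have "derivation d"
    unfolding derivation_def
  proof (intro conjI allI)
    fix x y
    have "Dual (x + y) (d (x + y)) = Dual x (d x) + Dual y (d y)"
      by (rule un) (use d Mc in auto)
    then show "d (x + y) = d x + d y" by (metis dual.sel(2) dual_sel(6))
    have "Dual (x * y) (d (x * y)) = Dual x (d x) * Dual y (d y)"
      by (rule un) (use d Mc in auto)
    then show "d (x * y) = x * d y + d x * y" by (metis dual.sel dual_sel(12))
  qed
  moreover have "d (dual_re x) = dual_ep x" if "x \<in> G" for x
    using un[of "Dual (dual_re x) (d (dual_re x))" x] d that M(2) by (metis dual.sel subsetD)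
  ultimately show ?thesis by blast
qed

lemma derivation_0: "derivation d \<Longrightarrow> d 0 = 0"
  unfolding derivation_def by (metis add_cancel_right_right)

lemma derivation_add: "derivation d \<Longrightarrow> d (x + y) = d x + d y"
  and derivation_mult: "derivation d \<Longrightarrow> d (x * y) = x * d y + d x * y"
  by (auto simp: derivation_def)

lemma derivation_1: "derivation d \<Longrightarrow> d 1 = 0"
  using derivation_mult[of d 1 1] by (metis add_cancel_right_right mult_1 mult_1_right)

lemma derivation_minus: "derivation d \<Longrightarrow> d (- x) = - d x"
  using derivation_add[of d x "- x"] derivation_0[of d] by (metis add.right_inverse neg_eq_iff_add_eq_0)

lemma derivation_diff: "derivation d \<Longrightarrow> d (x - y) = d x - d y"
  using derivation_add[of d x "- y"] by (simp add: derivation_minus)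

lemma derivation_inverse:
  assumes "derivation d" "x \<noteq> 0"
  shows "d (inverse x) = - d x / x\<^sup>2"
proof -
  have "x * d (inverse x) + d x * inverse x = 0"
    using derivation_mult[of d x "inverse x"] assms by (simp add: derivation_1[OF assms(1)])
  then have "x * d (inverse x) = - (d x * inverse x)" by (rule iffD2[OF eq_neg_iff_add_eq_0])
  moreover have "d (inverse x) = inverse x * (x * d (inverse x))" using assms(2) by simp
  ultimately show ?thesis by (simp add: divide_inverse power2_eq_square)
qed

lemma derivation_divide:
  assumes "derivation d" "y \<noteq> 0"
  shows "d (x / y) = d x / y - x * d y / y\<^sup>2"
  using assms by (simp add: divide_inverse derivation_mult derivation_inverse)

lemma derivation_sum: "derivation d \<Longrightarrow> d (\<Sum>i\<in>I. f i) = (\<Sum>i\<in>I. d (f i))"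
  by (induction I rule: infinite_finite_induct) (auto simp: derivation_add derivation_0)

lemma derivation_prod:
  assumes "derivation d" "finite I"
  shows "d (\<Prod>i\<in>I. f i) = (\<Sum>i\<in>I. d (f i) * (\<Prod>j\<in>I - {i}. f j))"
  using assms(2)
proof (induction I rule: finite_induct)
  case (insert a I)
  have "(\<Prod>j\<in>insert a I - {i}. f j) = f a * (\<Prod>j\<in>I - {i}. f j)" if "i \<in> I" for i
  proof -
    have "insert a I - {i} = insert a (I - {i})" using that insert by auto
    then show ?thesis using insert by simp
  qed
  then have "(\<Sum>i\<in>I. d (f i) * (\<Prod>j\<in>insert a I - {i}. f j)) =
      f a * (\<Sum>i\<in>I. d (f i) * (\<Prod>j\<in>I - {i}. f j))"
    by (simp add: sum_distrib_left mult_ac)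
  with insert assms(1) show ?case
    by (simp add: derivation_mult insert_Diff_if)
qed (use assms in \<open>simp add: derivation_1\<close>)

lemma derivation_power: "derivation d \<Longrightarrow> d (x ^ n) = of_nat n * x ^ (n - 1) * d x"
proof (induction n)
  case (Suc n)
  then show ?case
    by (cases n) (auto simp: derivation_mult algebra_simps)
qed (simp add: derivation_1)

lemma derivation_of_nat: "derivation d \<Longrightarrow> d (of_nat n) = 0"
  by (induction n) (auto simp: derivation_add derivation_0 derivation_1)

lemma derivation_of_int: "derivation d \<Longrightarrow> d (of_int n) = 0"
  by (cases n) (auto simp: derivation_minus derivation_diff derivation_of_nat derivation_1)

lemma derivation_cmult: "derivation d \<Longrightarrow> derivation (\<lambda>x. c * d x)"
  and derivation_minus_cmult: "derivation d \<Longrightarrow> derivation e \<Longrightarrow> derivation (\<lambda>x. d x - c * e x)"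
  by (auto simp: derivation_def algebra_simps)

lemma derivation_commutator:
  "derivation d \<Longrightarrow> derivation e \<Longrightarrow> derivation (\<lambda>x. d (e x) - e (d x))"
  unfolding derivation_def by (auto simp: algebra_simps)

lemma is_subfieldD:
  assumes "is_subfield F"
  shows "0 \<in> F" "1 \<in> F" "x \<in> F \<Longrightarrow> y \<in> F \<Longrightarrow> x + y \<in> F" "x \<in> F \<Longrightarrow> y \<in> F \<Longrightarrow> x * y \<in> F"
    "x \<in> F \<Longrightarrow> - x \<in> F" "x \<in> F \<Longrightarrow> inverse x \<in> F" "x \<in> F \<Longrightarrow> y \<in> F \<Longrightarrow> x - y \<in> F"
    "x \<in> F \<Longrightarrow> y \<in> F \<Longrightarrow> x / y \<in> F" "of_nat n \<in> F" "of_int i \<in> F"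
proof -
  show *: "0 \<in> F" "1 \<in> F" "x \<in> F \<Longrightarrow> y \<in> F \<Longrightarrow> x + y \<in> F" "x \<in> F \<Longrightarrow> y \<in> F \<Longrightarrow> x * y \<in> F"
    "x \<in> F \<Longrightarrow> - x \<in> F" "x \<in> F \<Longrightarrow> inverse x \<in> F" for x y
    using assms by (auto simp: is_subfield_def)
  show d: "x - y \<in> F" if "x \<in> F" "y \<in> F" for x y
    using *(3)[OF that(1) *(5)[OF that(2)]] by simp
  show "x \<in> F \<Longrightarrow> y \<in> F \<Longrightarrow> x / y \<in> F"
    unfolding divide_inverse by (rule *(4)[OF _ *(6)])
  show n: "of_nat n \<in> F" for n by (induction n) (simp_all add: *)
  show "of_int i \<in> F"
    by (cases i rule: int_diff_cases) (simp add: d n)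
qed

lemma subfield_sum: "is_subfield F \<Longrightarrow> (\<And>i. i \<in> I \<Longrightarrow> f i \<in> F) \<Longrightarrow> (\<Sum>i\<in>I. f i) \<in> F"
  by (induction I rule: infinite_finite_induct) (auto simp: is_subfieldD)

lemma subfield_prod: "is_subfield F \<Longrightarrow> (\<And>i. i \<in> I \<Longrightarrow> f i \<in> F) \<Longrightarrow> (\<Prod>i\<in>I. f i) \<in> F"
  by (induction I rule: infinite_finite_induct) (auto simp: is_subfieldD)

lemma subfield_power: "is_subfield F \<Longrightarrow> x \<in> F \<Longrightarrow> x ^ n \<in> F"
  by (induction n) (auto simp: is_subfieldD)

lemma is_subfield_adjoin: "is_subfield (adjoin C S)"
  unfolding adjoin_def
proof (rule hull_in)
  fix T :: "'a set set" assume "\<forall>s\<in>T. is_subfield s"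
  then show "is_subfield (\<Inter>T)" unfolding is_subfield_def by blast
qed

lemma adjoin_superset: "C \<subseteq> adjoin C S" "S \<subseteq> adjoin C S"
  using hull_subset[of "C \<union> S" is_subfield] by (auto simp: adjoin_def)

lemma adjoin_minimal: "is_subfield F \<Longrightarrow> C \<subseteq> F \<Longrightarrow> S \<subseteq> F \<Longrightarrow> adjoin C S \<subseteq> F"
  unfolding adjoin_def by (rule hull_minimal) auto

lemma is_subfield_kernel:
  assumes "derivation d"
  shows "is_subfield {x. d x = 0}"
  unfolding is_subfield_def
proof (intro conjI ballI)
  fix x assume "x \<in> {x. d x = 0}"
  with assms show "inverse x \<in> {x. d x = 0}"
    by (cases "x = 0") (auto simp: derivation_inverse)
qed (use assms in \<open>auto simp: derivation_0 derivation_1 derivation_add derivation_mult derivation_minus\<close>)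

lemma Der_adjoin: "Der (adjoin C S) = Der (C \<union> S)"
proof
  show "Der (adjoin C S) \<subseteq> Der (C \<union> S)"
    using adjoin_superset[where C = C and S = S] unfolding Der_def by blast
  show "Der (C \<union> S) \<subseteq> Der (adjoin C S)"
  proof
    fix d assume d: "d \<in> Der (C \<union> S)"
    then have "adjoin C S \<subseteq> {x. d x = 0}"
      by (intro adjoin_minimal is_subfield_kernel) (auto simp: Der_def)
    with d show "d \<in> Der (adjoin C S)" by (auto simp: Der_def)
  qed
qed

lemma Der_derivation: "d \<in> Der C \<Longrightarrow> derivation d"
  by (simp add: Der_def)

lemma exists_derivation_transcendental:
  fixes s :: "'a::field_char_0"
  assumes F: "is_subfield F" and s: "\<not> algebraic_over F s"
  shows "\<exists>d\<in>Der F. d s = 1"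
proof -
  define K where "K = {P::'a poly. \<forall>k. coeff P k \<in> F}"
  define e where "e P = Dual (poly P s) (poly (pderiv P) s)" for P
  note F' = is_subfieldD[OF F]
  have K: "0 \<in> K" "1 \<in> K" "P \<in> K \<Longrightarrow> Q \<in> K \<Longrightarrow> P + Q \<in> K" "P \<in> K \<Longrightarrow> Q \<in> K \<Longrightarrow> P * Q \<in> K"
    "P \<in> K \<Longrightarrow> - P \<in> K" "c \<in> F \<Longrightarrow> [:c:] \<in> K" "[:0, 1:] \<in> K" for P Q c
    by (auto simp: K_def coeff_1 coeff_mult coeff_pCons F' intro!: subfield_sum[OF F] split: nat.split)
  have e: "e 0 = 0" "e 1 = 1" "e (P + Q) = e P + e Q" "e (P * Q) = e P * e Q" "e (- P) = - e P" for P Q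
    by (auto simp: e_def dual_eq_iff pderiv_add pderiv_mult pderiv_minus)
  have "functional_subring (e ` K)"
    unfolding functional_subring_def
  proof (intro conjI ballI impI)
    show "0 \<in> e ` K" "1 \<in> e ` K" using K(1,2) e(1,2) by (metis image_eqI)+
    fix a assume "a \<in> e ` K"
    then obtain P where P: "a = e P" "P \<in> K" by blast
    show "- a \<in> e ` K" using P K(5) e(5) by (metis image_eqI)
    show "a = 0" if "dual_re a = 0"
    proof -
      have "poly P s = 0" using that P by (simp add: e_def)
      then have "P = 0" using s P(2) unfolding algebraic_over_def K_def by blast
      then show ?thesis using P e(1) by simp
    qed
    fix b assume "b \<in> e ` K"
    then obtain Q where Q: "b = e Q" "Q \<in> K" by blast
    show "a + b \<in> e ` K" "a * b \<in> e ` K" using P Q K(3,4) e(3,4) by (metis image_eqI)+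
  qed
  then obtain d where d: "derivation d" "\<forall>x\<in>e ` K. d (dual_re x) = dual_ep x"
    using derivation_extension by blast
  have "d c = 0" if "c \<in> F" for c
  proof -
    have "d (dual_re (e [:c:])) = dual_ep (e [:c:])" using d(2) K(6)[OF that] by blast
    then show ?thesis by (simp add: e_def)
  qed
  moreover have "d s = 1"
  proof -
    have "d (dual_re (e [:0, 1:])) = dual_ep (e [:0, 1:])" using d(2) K(7) by blast
    then show ?thesis by (simp add: e_def pderiv_pCons)
  qed
  ultimately show ?thesis using d(1) by (auto simp: Der_def)
qed

lemma derivation_poly:
  fixes d :: "'a::field \<Rightarrow> 'a"
  assumes d: "derivation d"
  shows "d (poly q s) = poly (map_poly d q) s + poly (pderiv q) s * d s"
proof (induction q)
  case (pCons a q)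
  have "map_poly d (pCons a q) = pCons (d a) (map_poly d q)"
    by (rule map_poly_pCons) (simp add: derivation_0[OF d])
  then show ?case
    by (simp add: derivation_add[OF d] derivation_mult[OF d] pCons.IH pderiv_pCons algebra_simps)
qed (simp add: derivation_0[OF d])

lemma minimal_polynomial:
  fixes s :: "'a::field_char_0"
  assumes F: "is_subfield F" and s: "algebraic_over F s"
  obtains q where "q \<noteq> 0" "\<forall>k. coeff q k \<in> F" "poly q s = 0" "degree q > 0"
    "poly (pderiv q) s \<noteq> 0"
    "\<And>P. P \<noteq> 0 \<Longrightarrow> \<forall>k. coeff P k \<in> F \<Longrightarrow> poly P s = 0 \<Longrightarrow> degree q \<le> degree P"
proof -
  define R where "R q \<longleftrightarrow> q \<noteq> 0 \<and> (\<forall>k. coeff q k \<in> F) \<and> poly q s = 0" for q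
  have "\<exists>q. R q" using s by (simp add: R_def algebraic_over_def)
  then obtain q where q: "R q" "\<And>P. R P \<Longrightarrow> degree q \<le> degree P"
    using ex_has_least_nat[of R _ degree] by blast
  have dq: "degree q > 0"
  proof (rule ccontr)
    assume "\<not> degree q > 0"
    then obtain a where "q = [:a:]" by (metis degree_eq_zeroE not_gr_zero)
    with q(1) show False by (auto simp: R_def)
  qed
  have "\<forall>k. coeff (pderiv q) k \<in> F"
    using q(1) by (auto simp: coeff_pderiv R_def is_subfieldD[OF F] simp del: of_nat_Suc)
  moreover have "pderiv q \<noteq> 0" using dq by (simp add: pderiv_eq_0_iff)
  moreover have "\<not> R (pderiv q)"
    using q(2)[of "pderiv q"] dq by (auto simp: degree_pderiv)
  ultimately have "poly (pderiv q) s \<noteq> 0" by (simp add: R_def)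
  then show ?thesis using q dq by (intro that[of q]) (auto simp: R_def)
qed

lemma Der_algebraic_zero:
  fixes s :: "'a::field_char_0"
  assumes "is_subfield F" "algebraic_over F s" "d \<in> Der F"
  shows "d s = 0"
proof (rule minimal_polynomial[OF assms(1,2)])
  fix q assume q: "\<forall>k. coeff q k \<in> F" "poly q s = 0" "poly (pderiv q) s \<noteq> 0"
  have d: "derivation d" using assms(3) by (simp add: Der_def)
  have "d (coeff q n) = 0" for n using assms(3) q(1) by (simp add: Der_def)
  then have "map_poly d q = 0"
    by (intro poly_eqI) (simp add: coeff_map_poly derivation_0[OF d])
  then show ?thesis
    using derivation_poly[OF d, of q s] q by (simp add: derivation_0[OF d])
qed

text \<open>A Kaehler differential \<open>d b\<close> is represented by the functional \<open>d \<mapsto> d b\<close> on derivations.\<close>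

definition diff_independent :: "'a::field set \<Rightarrow> 'a set \<Rightarrow> bool" where
  "diff_independent C B \<longleftrightarrow> finite B \<and>
     (\<forall>f. (\<forall>d\<in>Der C. (\<Sum>b\<in>B. f b * d b) = 0) \<longrightarrow> (\<forall>b\<in>B. f b = 0))"

lemma diff_independent_monomials:
  fixes B :: "'a::field_char_0 set" and g :: "('a \<Rightarrow> nat) \<Rightarrow> 'a"
  assumes B: "diff_independent C B"
    and "finite M" "\<And>e. e \<in> M \<Longrightarrow> sum e B \<le> N" "\<And>e b. e \<in> M \<Longrightarrow> b \<notin> B \<Longrightarrow> e b = 0"
    and "\<And>e d. e \<in> M \<Longrightarrow> d \<in> Der C \<Longrightarrow> d (g e) = 0"
    and "(\<Sum>e\<in>M. g e * (\<Prod>b\<in>B. b ^ e b)) = 0" and "e \<in> M"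
  shows "g e = 0"
  using assms(2-)
proof (induction N arbitrary: M g e)
  have fB: "finite B" using B by (simp add: diff_independent_def)
  case 0
  have z: "e' = (\<lambda>_. 0)" if "e' \<in> M" for e'
  proof
    fix b show "e' b = 0"
      using 0(2,3)[OF that] fB by (cases "b \<in> B") auto
  qed
  have M: "M = {e}" using z 0(6) by blast
  have "(\<Prod>b\<in>B. b ^ e b) = 1"
    unfolding z[OF 0(6)] by simp
  with 0(5) show ?case unfolding M by simp
next
  have fB: "finite B" using B by (simp add: diff_independent_def)
  case (Suc N)
  define M' where "M' b = {e\<in>M. e b > 0}" for b
  define dec where "dec b e = e(b := e b - 1)" for b and e :: "'a \<Rightarrow> nat"
  define h where "h b = (\<Sum>e\<in>M' b. g e * of_nat (e b) * (\<Prod>x\<in>B. x ^ dec b e x))" for b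
  have mono: "(\<Prod>x\<in>B. x ^ dec b e x) = b ^ (e b - 1) * (\<Prod>x\<in>B - {b}. x ^ e x)" if "b \<in> B" for b e
    using that fB by (subst prod.remove[of _ b]) (auto simp: dec_def intro!: arg_cong2[of _ _ _ _ "(*)"] prod.cong)
  have "(\<Sum>b\<in>B. h b * d b) = 0" if d: "d \<in> Der C" for d
  proof -
    have dd: "derivation d" using d by (simp add: Der_def)
    have "0 = d (\<Sum>e\<in>M. g e * (\<Prod>b\<in>B. b ^ e b))" using Suc.prems(5) by (simp add: derivation_0[OF dd])
    also have "\<dots> = (\<Sum>e\<in>M. g e * d (\<Prod>b\<in>B. b ^ e b))"
      unfolding derivation_sum[OF dd]
      by (intro sum.cong refl) (simp add: derivation_mult[OF dd] Suc.prems(4) d)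
    also have "\<dots> = (\<Sum>e\<in>M. \<Sum>b\<in>B. g e * of_nat (e b) * (\<Prod>x\<in>B. x ^ dec b e x) * d b)"
      by (intro sum.cong refl)
        (simp add: derivation_prod[OF dd fB] derivation_power[OF dd] sum_distrib_left mono mult_ac)
    also have "\<dots> = (\<Sum>b\<in>B. \<Sum>e\<in>M. g e * of_nat (e b) * (\<Prod>x\<in>B. x ^ dec b e x) * d b)"
      by (rule sum.swap)
    also have "\<dots> = (\<Sum>b\<in>B. h b * d b)"
    proof (intro sum.cong refl)
      fix b
      have "(\<Sum>e\<in>M. g e * of_nat (e b) * (\<Prod>x\<in>B. x ^ dec b e x) * d b) =
          (\<Sum>e\<in>M' b. g e * of_nat (e b) * (\<Prod>x\<in>B. x ^ dec b e x) * d b)"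
        by (rule sum.mono_neutral_right) (auto simp: M'_def Suc.prems(1))
      then show "(\<Sum>e\<in>M. g e * of_nat (e b) * (\<Prod>x\<in>B. x ^ dec b e x) * d b) = h b * d b"
        by (simp add: h_def sum_distrib_right)
    qed
    finally show ?thesis ..
  qed
  then have h0: "h b = 0" if "b \<in> B" for b
    using B that unfolding diff_independent_def by blast
  have pos: "g e = 0" if e: "e \<in> M" and b: "b \<in> B" "e b > 0" for e b
  proof -
    have inj: "inj_on (dec b) (M' b)"
    proof (rule inj_onI)
      fix e1 e2 assume a: "e1 \<in> M' b" "e2 \<in> M' b" "dec b e1 = dec b e2"
      show "e1 = e2"
      proof
        fix x show "e1 x = e2 x"
          using a(1,2) fun_cong[OF a(3), of x] by (auto simp: dec_def M'_def split: if_splits simp del: fun_upd_apply simp: fun_upd_def)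
      qed
    qed
    define g' where "g' = (\<lambda>e. let e0 = the_inv_into (M' b) (dec b) e in g e0 * of_nat (e0 b))"
    have g': "g' (dec b e) = g e * of_nat (e b)" if "e \<in> M' b" for e
      using that inj by (simp add: g'_def the_inv_into_f_f)
    have "g' (dec b e) = 0"
    proof (rule Suc.IH[of "dec b ` M' b"])
      show "finite (dec b ` M' b)" using Suc.prems(1) by (simp add: M'_def)
      show "(\<Sum>e\<in>dec b ` M' b. g' e * (\<Prod>x\<in>B. x ^ e x)) = 0"
        using h0[OF b(1)] by (simp add: sum.reindex[OF inj] g' h_def)
      show "dec b e \<in> dec b ` M' b" using e b by (auto simp: M'_def)
      fix e' assume "e' \<in> dec b ` M' b"
      then obtain e0 where e0: "e0 \<in> M' b" "e' = dec b e0" by blast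
      have "sum e0 B = e0 b + sum e0 (B - {b})" "sum e' B = e' b + sum e' (B - {b})"
        using fB b(1) by (simp_all add: sum.remove)
      moreover have "sum e' (B - {b}) = sum e0 (B - {b})"
        by (intro sum.cong) (auto simp: e0 dec_def)
      ultimately show "sum e' B \<le> N"
        using Suc.prems(2)[of e0] e0 by (auto simp: M'_def dec_def)
      show "e' x = 0" if "x \<notin> B" for x
        using Suc.prems(3)[of e0 x] e0 that b by (auto simp: M'_def dec_def)
      show "d (g' e') = 0" if "d \<in> Der C" for d
        using Suc.prems(4)[of e0 d] e0 that by (auto simp: M'_def g' derivation_mult derivation_of_nat Der_derivation)
    qed
    then show ?thesis using g'[of e] e b by (auto simp: M'_def)
  qed
  show ?case
  proof (cases "\<exists>b\<in>B. e b > 0")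
    case True
    then show ?thesis using pos Suc.prems(6) by blast
  next
    case False
    have "g e' * (\<Prod>b\<in>B. b ^ e' b) = 0" if "e' \<in> M - {e}" for e'
    proof -
      have "\<exists>b\<in>B. e' b > 0"
      proof (rule ccontr)
        assume "\<not> (\<exists>b\<in>B. e' b > 0)"
        then have "e' b = e b" for b
          using False Suc.prems(3)[of e' b] Suc.prems(3)[of e b] Suc.prems(6) that
          by (cases "b \<in> B") auto
        then have "e' = e" by auto
        with that show False by blast
      qed
      then show ?thesis using pos that by auto
    qed
    then have "(\<Sum>e'\<in>M - {e}. g e' * (\<Prod>b\<in>B. b ^ e' b)) = 0"
      by (rule sum.neutral[OF ballI])
    then have "(\<Sum>e\<in>M. g e * (\<Prod>b\<in>B. b ^ e b)) = g e * (\<Prod>b\<in>B. b ^ e b)"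
      using Suc.prems(1,6) by (subst sum.remove[of _ e]) auto
    moreover have "(\<Prod>b\<in>B. b ^ e b) = 1" using False by (intro prod.neutral) auto
    ultimately show ?thesis using Suc.prems(5) by simp
  qed
qed

lemma diff_independent_imp_algebraically_independent:
  fixes B :: "'a::field_char_0 set"
  assumes B: "diff_independent C B"
  shows "algebraically_independent C B"
  unfolding algebraically_independent_def
proof (intro allI impI, elim conjE)
  fix P :: "('a \<Rightarrow>\<^sub>0 nat) \<Rightarrow>\<^sub>0 'a"
  assume co: "\<forall>m. Poly_Mapping.lookup P m \<in> C"
    and ke: "\<forall>m\<in>Poly_Mapping.keys P. Poly_Mapping.keys m \<subseteq> B"
    and s0: "(\<Sum>m\<in>Poly_Mapping.keys P. Poly_Mapping.lookup P m *
           (\<Prod>s\<in>Poly_Mapping.keys m. s ^ Poly_Mapping.lookup m s)) = 0"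
  have fB: "finite B" using B by (simp add: diff_independent_def)
  define M where "M = Poly_Mapping.lookup ` Poly_Mapping.keys P"
  define g where "g e = Poly_Mapping.lookup P (Abs_poly_mapping e)" for e
  have inj: "inj_on Poly_Mapping.lookup (Poly_Mapping.keys P)"
    by (rule inj_onI) (simp add: lookup_inject)
  have mono: "(\<Prod>s\<in>Poly_Mapping.keys m. s ^ Poly_Mapping.lookup m s) = (\<Prod>b\<in>B. b ^ Poly_Mapping.lookup m b)"
    if "m \<in> Poly_Mapping.keys P" for m
    using that ke fB by (intro prod.mono_neutral_left) (auto simp: in_keys_iff)
  have g0: "g e = 0" if "e \<in> M" for e
  proof (rule diff_independent_monomials[OF B])
    show "finite M" by (simp add: M_def)
    show "e \<in> M" by fact
    show "sum e B \<le> Max ((\<lambda>e. sum e B) ` M)" if "e \<in> M" for e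
      using that by (intro Max_ge) (auto simp: M_def)
    show "e b = 0" if "e \<in> M" "b \<notin> B" for e b
      using that ke by (auto simp: M_def in_keys_iff subset_iff)
    show "d (g e) = 0" if "d \<in> Der C" for e d
      using that co by (auto simp: g_def Der_def)
    show "(\<Sum>e\<in>M. g e * (\<Prod>b\<in>B. b ^ e b)) = 0"
      unfolding M_def sum.reindex[OF inj] using s0 mono
      by (simp add: g_def lookup_inverse)
  qed
  show "P = 0"
  proof (rule poly_mapping_eqI)
    fix m
    show "Poly_Mapping.lookup P m = Poly_Mapping.lookup 0 m"
      using g0[of "Poly_Mapping.lookup m"] by (cases "m \<in> Poly_Mapping.keys P")
        (auto simp: M_def g_def lookup_inverse in_keys_iff)
  qed
qed

section \<open>Logarithmic differentials\<close>

text \<open>Jacobi's formula, by expanding the determinant along the differentiated row.\<close>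

lemma derivation_det:
  fixes A :: "'a::field Matrix.mat"
  assumes d: "derivation d" and A: "A \<in> carrier_mat n n"
  shows "d (Determinant.det A) = (\<Sum>i<n. \<Sum>j<n. d (A $$ (i, j)) * cofactor A i j)"
proof -
  define B where "B i = Matrix.mat n n (\<lambda>(r, c). if r = i then d (A $$ (r, c)) else A $$ (r, c))" for i
  have cB: "B i \<in> carrier_mat n n" for i by (simp add: B_def)
  have cof: "cofactor (B i) i j = cofactor A i j" if "i < n" "j < n" for i j
  proof -
    have "mat_delete (B i) i j = mat_delete A i j"
      unfolding mat_delete_def using A that by (intro eq_matI) (auto simp: B_def)
    then show ?thesis by (simp add: cofactor_def)
  qed
  have row: "Determinant.det (B i) = (\<Sum>j<n. d (A $$ (i, j)) * cofactor A i j)" if "i < n" for i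
    unfolding laplace_expansion_row[OF cB that] using that cof by (intro sum.cong) (auto simp: B_def)
  have "d (Determinant.det A) =
      (\<Sum>p\<in>{p. p permutes {0..<n}}. signof p * (\<Sum>i<n. d (A $$ (i, p i)) * (\<Prod>j\<in>{0..<n} - {i}. A $$ (j, p j))))"
    unfolding det_def'[OF A]
    by (simp add: derivation_sum[OF d] derivation_mult[OF d] derivation_of_int[OF d]
        derivation_prod[OF d] atLeast0LessThan)
  also have "\<dots> = (\<Sum>i<n. \<Sum>p\<in>{p. p permutes {0..<n}}.
      signof p * (d (A $$ (i, p i)) * (\<Prod>j\<in>{0..<n} - {i}. A $$ (j, p j))))"
    by (simp add: sum_distrib_left) (rule sum.swap)
  also have "\<dots> = (\<Sum>i<n. Determinant.det (B i))"
  proof (intro sum.cong refl)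
    fix i assume i: "i \<in> {..<n}"
    show "(\<Sum>p\<in>{p. p permutes {0..<n}}.
      signof p * (d (A $$ (i, p i)) * (\<Prod>j\<in>{0..<n} - {i}. A $$ (j, p j)))) = Determinant.det (B i)"
      unfolding det_def'[OF cB]
    proof (intro sum.cong refl arg_cong2[of _ _ _ _ "(*)"])
      fix p assume "p \<in> {p. p permutes {0..<n}}"
      then have p: "j < n \<Longrightarrow> p j < n" for j by (auto dest: permutes_in_image)
      have "(\<Prod>j = 0..<n. B i $$ (j, p j)) = B i $$ (i, p i) * (\<Prod>j\<in>{0..<n} - {i}. B i $$ (j, p j))"
        using i by (intro prod.remove) auto
      also have "(\<Prod>j\<in>{0..<n} - {i}. B i $$ (j, p j)) = (\<Prod>j\<in>{0..<n} - {i}. A $$ (j, p j))"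
        using p by (intro prod.cong) (auto simp: B_def)
      finally show "d (A $$ (i, p i)) * (\<Prod>j\<in>{0..<n} - {i}. A $$ (j, p j)) = (\<Prod>j = 0..<n. B i $$ (j, p j))"
        using i p by (simp add: B_def)
    qed
  qed
  also have "\<dots> = (\<Sum>i<n. \<Sum>j<n. d (A $$ (i, j)) * cofactor A i j)"
    using row by (intro sum.cong) auto
  finally show ?thesis .
qed

locale differential_extension =
  fixes k M :: "'a::field set" and n :: nat and e :: "nat \<Rightarrow> 'a" and d :: "'a \<Rightarrow> 'a"
  assumes k: "is_subfield k" and M: "is_subfield M" and kM: "k \<subseteq> M"
    and eM: "j < n \<Longrightarrow> e j \<in> M"
    and span: "x \<in> M \<Longrightarrow> \<exists>c. (\<forall>j<n. c j \<in> k) \<and> x = (\<Sum>j<n. c j * e j)"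
    and indep: "(\<forall>j<n. c j \<in> k) \<Longrightarrow> (\<Sum>j<n. c j * e j) = 0 \<Longrightarrow> j < n \<Longrightarrow> c j = 0"
    and d: "derivation d" and dk: "x \<in> k \<Longrightarrow> d x \<in> k" and dM: "x \<in> M \<Longrightarrow> d x \<in> M"
begin

definition co :: "'a \<Rightarrow> nat \<Rightarrow> 'a" where
  "co x = (SOME c. (\<forall>j<n. c j \<in> k) \<and> x = (\<Sum>j<n. c j * e j))"

lemma co: "x \<in> M \<Longrightarrow> j < n \<Longrightarrow> co x j \<in> k" "x \<in> M \<Longrightarrow> (\<Sum>j<n. co x j * e j) = x"
  using someI_ex[OF span, of x] by (auto simp: co_def)

lemma co_eqI:
  assumes "\<And>j. j < n \<Longrightarrow> c j \<in> k" "x = (\<Sum>j<n. c j * e j)" "j < n"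
  shows "co x j = c j"
proof -
  have "x \<in> M" unfolding assms(2)
    using assms(1) eM kM by (auto intro!: subfield_sum[OF M] is_subfieldD(4)[OF M])
  then have "co x j - c j = 0"
    using co[of x] assms is_subfieldD(7)[OF k]
    by (intro indep[of "\<lambda>j. co x j - c j"]) (auto simp: left_diff_distrib sum_subtractf)
  then show ?thesis by simp
qed

definition a :: "'a \<Rightarrow> nat \<Rightarrow> nat \<Rightarrow> 'a" where
  "a x i j = co (x * e j) i"

definition T :: "'a \<Rightarrow> 'a" where
  "T x = (\<Sum>i<n. a x i i)"

lemma a_k: "x \<in> M \<Longrightarrow> i < n \<Longrightarrow> j < n \<Longrightarrow> a x i j \<in> k"
  unfolding a_def by (rule co) (auto intro!: is_subfieldD(4)[OF M] eM)

lemma a_sum: "x \<in> M \<Longrightarrow> j < n \<Longrightarrow> (\<Sum>i<n. a x i j * e i) = x * e j"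
  unfolding a_def by (rule co) (auto intro!: is_subfieldD(4)[OF M] eM)

lemma a_eqI:
  assumes "\<And>i. i < n \<Longrightarrow> c i \<in> k" "x * e j = (\<Sum>i<n. c i * e i)" "i < n"
  shows "a x i j = c i"
  unfolding a_def using assms by (rule co_eqI)

lemma a_add: "x \<in> M \<Longrightarrow> y \<in> M \<Longrightarrow> i < n \<Longrightarrow> j < n \<Longrightarrow> a (x + y) i j = a x i j + a y i j"
  by (rule a_eqI) (simp_all add: a_k is_subfieldD[OF k] distrib_right sum.distrib a_sum)

lemma a_cmult: "x \<in> M \<Longrightarrow> c \<in> k \<Longrightarrow> i < n \<Longrightarrow> j < n \<Longrightarrow> a (c * x) i j = c * a x i j"
  by (rule a_eqI) (simp_all add: a_k is_subfieldD[OF k] mult.assoc a_sum flip: sum_distrib_left)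

lemma a_1: "i < n \<Longrightarrow> j < n \<Longrightarrow> a 1 i j = (if i = j then 1 else 0)"
  by (rule a_eqI) (auto simp: is_subfieldD[OF k] if_distrib[of "\<lambda>x. x * _"] cong: if_cong)

lemma a_mult:
  assumes "x \<in> M" "y \<in> M" "i < n" "j < n"
  shows "a (x * y) i j = (\<Sum>l<n. a x i l * a y l j)"
proof (rule a_eqI)
  show "(\<Sum>l<n. a x i l * a y l j) \<in> k" if "i < n" for i
    using that assms by (auto intro!: subfield_sum[OF k] is_subfieldD(4)[OF k] a_k)
  have "x * y * e j = x * (\<Sum>l<n. a y l j * e l)"
    using assms by (simp add: a_sum mult.assoc)
  also have "\<dots> = (\<Sum>l<n. a y l j * (x * e l))"
    by (simp add: sum_distrib_left mult.left_commute)
  also have "\<dots> = (\<Sum>l<n. \<Sum>i<n. a y l j * (a x i l * e i))"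
    using assms by (simp add: sum_distrib_left flip: a_sum)
  also have "\<dots> = (\<Sum>i<n. (\<Sum>l<n. a x i l * a y l j) * e i)"
    unfolding sum_distrib_right by (rule trans[OF sum.swap]) (simp add: mult_ac)
  finally show "x * y * e j = (\<Sum>i<n. (\<Sum>l<n. a x i l * a y l j) * e i)" .
qed fact

definition \<Gamma> :: "nat \<Rightarrow> nat \<Rightarrow> 'a" where
  "\<Gamma> i j = co (d (e j)) i"

lemma \<Gamma>: "i < n \<Longrightarrow> j < n \<Longrightarrow> \<Gamma> i j \<in> k" "j < n \<Longrightarrow> (\<Sum>i<n. \<Gamma> i j * e i) = d (e j)"
  unfolding \<Gamma>_def by (intro co dM eM; assumption)+

lemma a_d:
  assumes x: "x \<in> M" and ij: "i < n" "j < n"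
  shows "a (d x) i j = d (a x i j) + (\<Sum>l<n. \<Gamma> i l * a x l j) - (\<Sum>l<n. a x i l * \<Gamma> l j)"
proof (rule a_eqI)
  show "d (a x i j) + (\<Sum>l<n. \<Gamma> i l * a x l j) - (\<Sum>l<n. a x i l * \<Gamma> l j) \<in> k" if "i < n" for i
    using that assms
    by (intro is_subfieldD(3)[OF k] is_subfieldD(7)[OF k] subfield_sum[OF k] is_subfieldD(4)[OF k] dk a_k \<Gamma>) auto
  have "d (x * e j) = (\<Sum>i<n. d (a x i j) * e i) + (\<Sum>l<n. a x l j * d (e l))"
    using a_sum[OF x ij(2), symmetric]
    by (simp add: derivation_sum[OF d] derivation_mult[OF d] sum.distrib add.commute)
  also have "(\<Sum>l<n. a x l j * d (e l)) = (\<Sum>l<n. \<Sum>i<n. \<Gamma> i l * a x l j * e i)"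
    by (simp add: sum_distrib_left mult_ac flip: \<Gamma>(2))
  also have "\<dots> = (\<Sum>i<n. (\<Sum>l<n. \<Gamma> i l * a x l j) * e i)"
    by (subst sum.swap) (simp add: sum_distrib_right)
  finally have 1: "d (x * e j) = (\<Sum>i<n. d (a x i j) * e i) + (\<Sum>i<n. (\<Sum>l<n. \<Gamma> i l * a x l j) * e i)" .
  have "x * d (e j) = (\<Sum>l<n. \<Gamma> l j * (x * e l))"
    using ij by (simp add: sum_distrib_left mult_ac flip: \<Gamma>(2))
  also have "\<dots> = (\<Sum>l<n. \<Sum>i<n. a x i l * \<Gamma> l j * e i)"
    using x by (simp add: sum_distrib_left mult_ac flip: a_sum)
  also have "\<dots> = (\<Sum>i<n. (\<Sum>l<n. a x i l * \<Gamma> l j) * e i)"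
    by (subst sum.swap) (simp add: sum_distrib_right)
  finally have 2: "x * d (e j) = (\<Sum>i<n. (\<Sum>l<n. a x i l * \<Gamma> l j) * e i)" .
  have "d x * e j = d (x * e j) - x * d (e j)" by (simp add: derivation_mult[OF d])
  then show "d x * e j = (\<Sum>i<n. (d (a x i j) + (\<Sum>l<n. \<Gamma> i l * a x l j) - (\<Sum>l<n. a x i l * \<Gamma> l j)) * e i)"
    unfolding 1 2 by (simp add: sum.distrib sum_subtractf algebra_simps)
qed fact

lemma T_k: "x \<in> M \<Longrightarrow> T x \<in> k"
  unfolding T_def by (auto intro!: subfield_sum[OF k] a_k)

lemma T_add: "x \<in> M \<Longrightarrow> y \<in> M \<Longrightarrow> T (x + y) = T x + T y"
  unfolding T_def by (simp add: a_add sum.distrib)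

lemma T_cmult: "x \<in> M \<Longrightarrow> c \<in> k \<Longrightarrow> T (c * x) = c * T x"
  unfolding T_def by (simp add: a_cmult sum_distrib_left)

lemma T_const: "c \<in> k \<Longrightarrow> T c = of_nat n * c"
  using T_cmult[of 1 c] by (simp add: T_def a_1 is_subfieldD[OF M])

lemma T_d:
  assumes "x \<in> M"
  shows "T (d x) = d (T x)"
proof -
  have "(\<Sum>i<n. \<Sum>l<n. \<Gamma> i l * a x l i) = (\<Sum>i<n. \<Sum>l<n. a x i l * \<Gamma> l i)"
    by (subst sum.swap) (simp add: mult.commute)
  then show ?thesis
    by (simp add: T_def a_d[OF assms] sum.distrib sum_subtractf derivation_sum[OF d])
qed

lemma T_log_derivative:
  assumes y: "y \<in> M" "y \<noteq> 0"
  shows "\<exists>N\<in>k. N \<noteq> 0 \<and> T (d y / y) = d N / N"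
proof -
  define A where "A = Matrix.mat n n (\<lambda>(i, j). a y i j)"
  define B where "B = Matrix.mat n n (\<lambda>(i, j). a (1 / y) i j)"
  define N where "N = Determinant.det A"
  have cA: "A \<in> carrier_mat n n" "B \<in> carrier_mat n n" by (auto simp: A_def B_def)
  have y': "1 / y \<in> M" "y * (1 / y) = 1" "1 / y * y = 1"
    using y is_subfieldD(2,8)[OF M] by auto
  have inv: "(\<Sum>l<n. a y i l * a (1 / y) l j) = (if i = j then 1 else 0)"
    "(\<Sum>l<n. a (1 / y) i l * a y l j) = (if i = j then 1 else 0)" if "i < n" "j < n" for i j
    using that y y' by (simp_all add: a_1 flip: a_mult)
  have AB: "A * B = 1\<^sub>m n" "B * A = 1\<^sub>m n"
    by (rule eq_matI; simp add: A_def B_def scalar_prod_def inv atLeast0LessThan)+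
  have "Determinant.det A * Determinant.det B = 1"
    using det_mult[OF cA] AB by simp
  then have N0: "N \<noteq> 0" by (auto simp: N_def)
  have "adj_mat A = B * A * adj_mat A" using adj_mat(1)[OF cA(1)] AB by simp
  also have "\<dots> = B * (A * adj_mat A)" using adj_mat(1)[OF cA(1)] cA by (intro assoc_mult_mat)
  also have "\<dots> = N \<cdot>\<^sub>m B" using adj_mat(2)[OF cA(1)] cA by (simp add: N_def mult_smult_distrib[OF cA(2) one_carrier_mat])
  finally have adj: "cofactor A i j = N * a (1 / y) j i" if "i < n" "j < n" for i j
    using that cA unfolding adj_mat_def mat_eq_iff by (auto simp: B_def)
  have "d N = N * (\<Sum>i<n. \<Sum>j<n. d (a y i j) * a (1 / y) j i)"
    unfolding N_def derivation_det[OF d cA(1)] sum_distrib_left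
  proof (intro sum.cong refl)
    fix i j assume "i \<in> {..<n}" "j \<in> {..<n}"
    then show "d (A $$ (i, j)) * cofactor A i j = Determinant.det A * (d (a y i j) * a (1 / y) j i)"
      by (simp add: adj flip: N_def) (simp add: A_def)
  qed
  then have dN: "d N / N = (\<Sum>i<n. \<Sum>j<n. d (a y i j) * a (1 / y) j i)"
    using N0 by simp
  have "T (d y / y) = T (d y * (1 / y))" by simp
  also have "\<dots> = (\<Sum>i<n. \<Sum>l<n. a (d y) i l * a (1 / y) l i)"
    using dM y y' by (simp only: T_def) (intro sum.cong refl a_mult; simp)
  also have "\<dots> = (\<Sum>i<n. \<Sum>l<n. d (a y i l) * a (1 / y) l i)
      + (\<Sum>i<n. \<Sum>l<n. (\<Sum>m<n. \<Gamma> i m * a y m l) * a (1 / y) l i)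
      - (\<Sum>i<n. \<Sum>l<n. (\<Sum>m<n. a y i m * \<Gamma> m l) * a (1 / y) l i)"
    using y by (simp add: a_d algebra_simps sum.distrib sum_subtractf)
  also have "(\<Sum>i<n. \<Sum>l<n. (\<Sum>m<n. \<Gamma> i m * a y m l) * a (1 / y) l i) = (\<Sum>i<n. \<Gamma> i i)"
  proof (intro sum.cong refl)
    fix i assume i: "i \<in> {..<n}"
    have "(\<Sum>l<n. (\<Sum>m<n. \<Gamma> i m * a y m l) * a (1 / y) l i) = (\<Sum>m<n. \<Gamma> i m * (\<Sum>l<n. a y m l * a (1 / y) l i))"
      by (simp add: sum_distrib_right sum_distrib_left mult.assoc) (rule sum.swap)
    also have "\<dots> = (\<Sum>m<n. \<Gamma> i m * (if m = i then 1 else 0))"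
      using i inv by (intro sum.cong) auto
    also have "\<dots> = \<Gamma> i i" using i by (simp add: if_distrib[of "\<lambda>x. _ * x"] cong: if_cong)
    finally show "(\<Sum>l<n. (\<Sum>m<n. \<Gamma> i m * a y m l) * a (1 / y) l i) = \<Gamma> i i" .
  qed
  also have "(\<Sum>i<n. \<Sum>l<n. (\<Sum>m<n. a y i m * \<Gamma> m l) * a (1 / y) l i) = (\<Sum>i<n. \<Gamma> i i)"
  proof -
    have "(\<Sum>i<n. \<Sum>l<n. (\<Sum>m<n. a y i m * \<Gamma> m l) * a (1 / y) l i)
        = (\<Sum>l<n. \<Sum>i<n. \<Sum>m<n. \<Gamma> m l * (a (1 / y) l i * a y i m))"
      by (rule trans[OF sum.swap]) (simp add: sum_distrib_right sum_distrib_left mult_ac)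
    also have "\<dots> = (\<Sum>l<n. \<Sum>m<n. \<Gamma> m l * (\<Sum>i<n. a (1 / y) l i * a y i m))"
      unfolding sum_distrib_left by (intro sum.cong refl sum.swap)
    also have "\<dots> = (\<Sum>l<n. \<Sum>m<n. \<Gamma> m l * (if l = m then 1 else 0))"
      using inv by (intro sum.cong refl) auto
    also have "\<dots> = (\<Sum>l<n. \<Gamma> l l)" by (simp add: if_distrib[of "\<lambda>x. _ * x"] cong: if_cong)
    finally show ?thesis .
  qed
  finally have "T (d y / y) = d N / N" by (simp add: dN)
  moreover have "N \<in> k"
    unfolding N_def det_def'[OF cA(1)]
  proof (intro subfield_sum[OF k] is_subfieldD(4)[OF k] subfield_prod[OF k])
    fix p i assume "p \<in> {p. p permutes {0..<n}}" "i \<in> {0..<n}"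
    then have "p i < n" by (auto dest: permutes_in_image)
    then show "A $$ (i, p i) \<in> k" using y \<open>i \<in> _\<close> by (auto simp: A_def a_k)
  qed (rule is_subfieldD(10)[OF k])
  ultimately show ?thesis using N0 by blast
qed

end

definition polys_over :: "'a::field set \<Rightarrow> 'a poly set" where
  "polys_over k = {P. \<forall>i. coeff P i \<in> k}"

lemma polys_over_closed:
  assumes k: "is_subfield k"
  shows "0 \<in> polys_over k" "1 \<in> polys_over k" "c \<in> k \<Longrightarrow> [:c:] \<in> polys_over k" "[:0, 1:] \<in> polys_over k"
    "P \<in> polys_over k \<Longrightarrow> Q \<in> polys_over k \<Longrightarrow> P + Q \<in> polys_over k"
    "P \<in> polys_over k \<Longrightarrow> Q \<in> polys_over k \<Longrightarrow> P - Q \<in> polys_over k"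
    "P \<in> polys_over k \<Longrightarrow> Q \<in> polys_over k \<Longrightarrow> P * Q \<in> polys_over k"
    "P \<in> polys_over k \<Longrightarrow> - P \<in> polys_over k" "c \<in> k \<Longrightarrow> monom c n \<in> polys_over k"
    "P \<in> polys_over k \<Longrightarrow> pderiv P \<in> polys_over k"
proof -
  note [simp] = polys_over_def is_subfieldD[OF k]
  show "0 \<in> polys_over k" "1 \<in> polys_over k" "c \<in> k \<Longrightarrow> [:c:] \<in> polys_over k" "[:0, 1:] \<in> polys_over k"
    "c \<in> k \<Longrightarrow> monom c n \<in> polys_over k"
    by (auto simp: coeff_1 coeff_pCons split: nat.split)
  show "P \<in> polys_over k \<Longrightarrow> Q \<in> polys_over k \<Longrightarrow> P + Q \<in> polys_over k"
    "P \<in> polys_over k \<Longrightarrow> Q \<in> polys_over k \<Longrightarrow> P - Q \<in> polys_over k"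
    "P \<in> polys_over k \<Longrightarrow> - P \<in> polys_over k"
    by simp_all
  show "P \<in> polys_over k \<Longrightarrow> Q \<in> polys_over k \<Longrightarrow> P * Q \<in> polys_over k"
    by (auto simp: coeff_mult intro!: subfield_sum[OF k])
  show "P \<in> polys_over k \<Longrightarrow> pderiv P \<in> polys_over k"
    by (simp add: coeff_pderiv del: of_nat_Suc)
qed

lemma polys_over_division:
  assumes k: "is_subfield k" and h: "h \<in> polys_over k" "h \<noteq> 0" and "P \<in> polys_over k"
  shows "\<exists>q r. q \<in> polys_over k \<and> r \<in> polys_over k \<and> P = q * h + r \<and> (r = 0 \<or> degree r < degree h)"
  using assms(4)
proof (induction "degree P" arbitrary: P rule: less_induct)
  case less
  note K = polys_over_closed[OF k]
  show ?case
  proof (cases "P = 0 \<or> degree P < degree h")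
    case True
    then show ?thesis using less.prems K(1) by (intro exI[of _ 0] exI[of _ P]) auto
  next
    case False
    define c where "c = lead_coeff P / lead_coeff h"
    define m where "m = monom c (degree P - degree h)"
    have c: "c \<noteq> 0" "c \<in> k"
      using False h less.prems by (auto simp: c_def polys_over_def intro!: is_subfieldD(8)[OF k])
    have m: "m \<in> polys_over k" using K(9) c by (simp add: m_def)
    have dm: "degree (m * h) = degree P"
      using False c h by (simp add: m_def degree_mult_eq degree_monom_eq)
    have "lead_coeff (m * h) = lead_coeff P"
      using h c by (simp add: lead_coeff_mult m_def c_def degree_monom_eq)
    then have "coeff (P - m * h) (degree P) = 0" by (simp add: dm)
    moreover have "degree (P - m * h) \<le> degree P" using dm by (metis degree_diff_le order_refl)
    ultimately have "P - m * h = 0 \<or> degree (P - m * h) < degree P"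
      by (metis eq_zero_or_degree_less)
    then have "\<exists>q r. q \<in> polys_over k \<and> r \<in> polys_over k \<and> P - m * h = q * h + r \<and> (r = 0 \<or> degree r < degree h)"
    proof
      assume "P - m * h = 0"
      then show ?thesis using K(1) by (intro exI[of _ 0]) auto
    next
      assume "degree (P - m * h) < degree P"
      then show ?thesis using less.hyps[of "P - m * h"] less.prems m h K(6,7) by blast
    qed
    then obtain q r where "q \<in> polys_over k" "r \<in> polys_over k" "P - m * h = q * h + r" "r = 0 \<or> degree r < degree h"
      by blast
    then show ?thesis
      using m K(5)[of q m] by (intro exI[of _ "q + m"] exI[of _ r]) (auto simp: algebra_simps)
  qed
qed

locale simple_extension =
  fixes k :: "'a::field_char_0 set" and \<alpha> :: 'a and q :: "'a poly"
  assumes k: "is_subfield k" and q: "q \<noteq> 0" "q \<in> polys_over k" "poly q \<alpha> = 0" "degree q > 0"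
    "poly (pderiv q) \<alpha> \<noteq> 0"
    and q_min: "P \<noteq> 0 \<Longrightarrow> P \<in> polys_over k \<Longrightarrow> poly P \<alpha> = 0 \<Longrightarrow> degree q \<le> degree P"
begin

definition M :: "'a set" where
  "M = (\<lambda>h. poly h \<alpha>) ` polys_over k"

lemma M_reduce:
  assumes "x \<in> M"
  obtains r where "r \<in> polys_over k" "degree r < degree q" "x = poly r \<alpha>"
proof -
  obtain P where P: "P \<in> polys_over k" "x = poly P \<alpha>" using assms by (auto simp: M_def)
  obtain u r where "r \<in> polys_over k" "P = u * q + r" "r = 0 \<or> degree r < degree q"
    using polys_over_division[OF k q(2,1) P(1)] by blast
  then show ?thesis using P q by (intro that[of r]) auto
qed

lemma M_ring: "0 \<in> M" "1 \<in> M" "x \<in> M \<Longrightarrow> y \<in> M \<Longrightarrow> x + y \<in> M" "x \<in> M \<Longrightarrow> y \<in> M \<Longrightarrow> x * y \<in> M"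
  "x \<in> M \<Longrightarrow> - x \<in> M" "k \<subseteq> M" "\<alpha> \<in> M"
proof -
  note K = polys_over_closed[OF k]
  have i: "poly P \<alpha> = x \<Longrightarrow> P \<in> polys_over k \<Longrightarrow> x \<in> M" for P x by (auto simp: M_def)
  show "0 \<in> M" "1 \<in> M" "\<alpha> \<in> M"
    using i[of 0 0] i[of 1 1] i[of "[:0, 1:]" \<alpha>] K(1,2,4) by simp_all
  show "k \<subseteq> M" using i[of "[:_:]"] K(3) by auto
  show "x \<in> M \<Longrightarrow> y \<in> M \<Longrightarrow> x + y \<in> M" "x \<in> M \<Longrightarrow> y \<in> M \<Longrightarrow> x * y \<in> M" "x \<in> M \<Longrightarrow> - x \<in> M"
    using K(5,7,8) unfolding M_def by (auto simp flip: poly_add poly_mult poly_minus)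
qed

lemma M_inverse:
  assumes "h \<in> polys_over k" "degree h < degree q" "poly h \<alpha> \<noteq> 0"
  shows "inverse (poly h \<alpha>) \<in> M"
  using assms
proof (induction "degree h" arbitrary: h rule: less_induct)
  case less
  show ?case
  proof (cases "degree h = 0")
    case True
    then obtain c where "h = [:c:]" by (rule degree_eq_zeroE)
    moreover have "c \<in> k" using less.prems(1) calculation by (auto simp: polys_over_def dest!: spec[of _ 0])
    ultimately show ?thesis using is_subfieldD(6)[OF k, of c] M_ring(6) by auto
  next
    case False
    obtain u r where ur: "u \<in> polys_over k" "r \<in> polys_over k" "q = u * h + r" "r = 0 \<or> degree r < degree h"
      using polys_over_division[OF k less.prems(1) _ q(2)] False by fastforce
    have e: "poly r \<alpha> = - (poly u \<alpha> * poly h \<alpha>)"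
      using q(3) unfolding ur(3) by (simp add: eq_neg_iff_add_eq_0 add.commute)
    have r0: "poly r \<alpha> \<noteq> 0"
    proof
      assume z: "poly r \<alpha> = 0"
      have "r = 0"
        using q_min[of r] ur(2,4) z less.prems(2) by fastforce
      then have "u \<noteq> 0" "degree u < degree q" "poly u \<alpha> = 0"
        using ur(3) q(1) False e less.prems(3) by (auto simp: degree_mult_eq)
      then show False using q_min[of u] ur(1) by simp
    qed
    then have "inverse (poly r \<alpha>) \<in> M"
      using less.hyps[of r] ur(2,4) less.prems(2) by force
    then have "- (poly u \<alpha>) * inverse (poly r \<alpha>) \<in> M"
      using ur(1) by (intro M_ring(4,5)) (auto simp: M_def)
    moreover have "- (poly u \<alpha>) * inverse (poly r \<alpha>) = inverse (poly h \<alpha>)"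
      using r0 less.prems(3) unfolding e by (simp add: field_simps)
    ultimately show ?thesis by simp
  qed
qed

lemma is_subfield_M: "is_subfield M"
proof -
  have "inverse x \<in> M" if x: "x \<in> M" for x
  proof -
    obtain r where "r \<in> polys_over k" "degree r < degree q" "x = poly r \<alpha>" using M_reduce[OF x] .
    then show ?thesis using M_inverse[of r] M_ring(1) by (cases "x = 0") auto
  qed
  then show ?thesis using M_ring by (auto simp: is_subfield_def)
qed

lemma differential_extension_M:
  assumes d: "derivation d" and dk: "\<And>x. x \<in> k \<Longrightarrow> d x \<in> k"
  shows "differential_extension k M (degree q) (\<lambda>j. \<alpha> ^ j) d"
proof
  show "is_subfield k" "is_subfield M" "k \<subseteq> M" "derivation d" "\<And>x. x \<in> k \<Longrightarrow> d x \<in> k"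
    using k is_subfield_M M_ring(6) d dk by auto
  show "\<alpha> ^ j \<in> M" for j using is_subfield_M M_ring(7) by (rule subfield_power)
  show "\<exists>c. (\<forall>j<degree q. c j \<in> k) \<and> x = (\<Sum>j<degree q. c j * \<alpha> ^ j)" if x: "x \<in> M" for x
  proof -
    obtain r where r: "r \<in> polys_over k" "degree r < degree q" "x = poly r \<alpha>" using M_reduce[OF x] .
    have "poly r \<alpha> = (\<Sum>j<degree q. coeff r j * \<alpha> ^ j)"
      unfolding poly_altdef using r(2) by (intro sum.mono_neutral_left) (auto simp: coeff_eq_0)
    then show ?thesis using r by (intro exI[of _ "coeff r"]) (auto simp: polys_over_def)
  qed
  show "c j = 0" if "\<forall>j<degree q. c j \<in> k" "(\<Sum>j<degree q. c j * \<alpha> ^ j) = 0" "j < degree q" for c j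
  proof -
    define P where "P = (\<Sum>j<degree q. monom (c j) j)"
    have cP: "coeff P i = (if i < degree q then c i else 0)" for i
      by (auto simp: P_def coeff_sum)
    have "P \<in> polys_over k" using that(1) is_subfieldD(1)[OF k] by (auto simp: polys_over_def cP)
    moreover have "poly P \<alpha> = 0" using that(2) by (simp add: P_def poly_sum poly_monom)
    moreover have "degree P < degree q" if "P \<noteq> 0"
      using that cP by (metis leading_coeff_0_iff)
    ultimately have "P = 0" using q_min[of P] by fastforce
    then show ?thesis using cP[of j] that(3) by simp
  qed
  have mp: "map_poly d P \<in> polys_over k" if "P \<in> polys_over k" for P
    using that dk by (auto simp: polys_over_def coeff_map_poly derivation_0[OF d])
  have pM: "poly P \<alpha> \<in> M" if "P \<in> polys_over k" for P using that by (auto simp: M_def)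
  have "poly (map_poly d q) \<alpha> + poly (pderiv q) \<alpha> * d \<alpha> = 0"
    using derivation_poly[OF d, of q \<alpha>] q(3) by (simp add: derivation_0[OF d])
  then have "d \<alpha> = - poly (map_poly d q) \<alpha> / poly (pderiv q) \<alpha>"
    using q(5) by (simp add: field_simps add_eq_0_iff)
  also have "\<dots> \<in> M"
    using q(2) by (intro is_subfieldD(8)[OF is_subfield_M] is_subfieldD(5)[OF is_subfield_M] pM mp polys_over_closed(10)[OF k])
  finally have da: "d \<alpha> \<in> M" .
  show "d x \<in> M" if x: "x \<in> M" for x
  proof -
    obtain P where P: "P \<in> polys_over k" "x = poly P \<alpha>" using x by (auto simp: M_def)
    then show ?thesis
      unfolding P(2) derivation_poly[OF d]
      by (intro M_ring(3,4) pM mp da polys_over_closed(10)[OF k])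
  qed
qed

end

lemma exists_simple_extension:
  fixes \<alpha> :: "'a::field_char_0"
  assumes "is_subfield k" "algebraic_over k \<alpha>"
  shows "\<exists>q. simple_extension k \<alpha> q"
proof (rule minimal_polynomial[OF assms])
  fix q
  assume q: "q \<noteq> 0" "\<forall>i. coeff q i \<in> k" "poly q \<alpha> = 0" "degree q > 0" "poly (pderiv q) \<alpha> \<noteq> 0"
    "\<And>P. P \<noteq> 0 \<Longrightarrow> \<forall>i. coeff P i \<in> k \<Longrightarrow> poly P \<alpha> = 0 \<Longrightarrow> degree q \<le> degree P"
  have "simple_extension k \<alpha> q"
    by unfold_locales (use q assms(1) in \<open>auto simp: polys_over_def\<close>)
  then show ?thesis ..
qed

text \<open>The coefficient \<open>m\<close> of \<open>d t / t\<close> is needed because the trace to a subfield multiplies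
  constants by the degree.\<close>

definition log_relation ::
  "('a::field \<Rightarrow> 'a) \<Rightarrow> 'a \<Rightarrow> 'a \<Rightarrow> 'i set \<Rightarrow> ('i \<Rightarrow> 'a) \<Rightarrow> 'a set \<Rightarrow> bool" where
  "log_relation d t c0 J c k \<longleftrightarrow> (\<exists>m>0. \<exists>y. \<exists>g\<in>k. (\<forall>i\<in>J. y i \<in> k \<and> y i \<noteq> 0) \<and>
     of_nat m * c0 * (d t / t) + (\<Sum>i\<in>J. c i * (d (y i) / y i)) = d g)"

lemma log_relation_mono: "log_relation d t c0 J c k \<Longrightarrow> k \<subseteq> k' \<Longrightarrow> log_relation d t c0 J c k'"
  unfolding log_relation_def by blast

lemma log_relation_simple_extension:
  fixes \<alpha> :: "'a::field_char_0"
  assumes k: "is_subfield k" and d: "derivation d" and dk: "\<And>x. x \<in> k \<Longrightarrow> d x \<in> k"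
    and \<alpha>: "algebraic_over k \<alpha>" and t: "t \<in> k" and c: "c0 \<in> k" "\<And>i. i \<in> J \<Longrightarrow> c i \<in> k"
    and rel: "log_relation d t c0 J c (adjoin k {\<alpha>})"
  shows "log_relation d t c0 J c k"
proof -
  obtain q where "simple_extension k \<alpha> q" using exists_simple_extension[OF k \<alpha>] by blast
  then interpret simple_extension k \<alpha> q .
  interpret E: differential_extension k M "degree q" "\<lambda>j. \<alpha> ^ j" d
    by (rule differential_extension_M[OF d dk])
  have "adjoin k {\<alpha>} \<subseteq> M" using is_subfield_M M_ring(6,7) by (intro adjoin_minimal) auto
  with rel have "log_relation d t c0 J c M" by (rule log_relation_mono)
  then obtain m y g where m: "m > 0" and g: "g \<in> M" and y: "\<And>i. i \<in> J \<Longrightarrow> y i \<in> M \<and> y i \<noteq> 0"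
    and eq: "of_nat m * c0 * (d t / t) + (\<Sum>i\<in>J. c i * (d (y i) / y i)) = d g"
    unfolding log_relation_def by blast
  have "\<forall>i\<in>J. \<exists>N. N \<in> k \<and> N \<noteq> 0 \<and> E.T (d (y i) / y i) = d N / N"
    using E.T_log_derivative y by blast
  then obtain N where N: "\<And>i. i \<in> J \<Longrightarrow> N i \<in> k \<and> N i \<noteq> 0 \<and> E.T (d (y i) / y i) = d (N i) / N i"
    by metis
  have inM: "c i * (d (y i) / y i) \<in> M" "d (y i) / y i \<in> M" if "i \<in> J" for i
    using that y c M_ring(6) E.dM is_subfieldD(4,8)[OF is_subfield_M] by blast+
  have sum: "E.T (\<Sum>i\<in>J'. c i * (d (y i) / y i)) = (\<Sum>i\<in>J'. c i * (d (N i) / N i))" if "J' \<subseteq> J" for J'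
    using that
  proof (induction J' rule: infinite_finite_induct)
    case (insert i J')
    then have "E.T (c i * (d (y i) / y i)) = c i * (d (N i) / N i)"
      using N[of i] E.T_cmult[OF inM(2)[of i] c(2)[of i]] by simp
    moreover have "(\<Sum>i\<in>J'. c i * (d (y i) / y i)) \<in> M"
      using insert inM by (intro subfield_sum[OF is_subfield_M]) auto
    ultimately show ?case
      using insert inM by (simp add: E.T_add)
  qed (use E.T_const[of 0] is_subfieldD(1)[OF k] in auto)
  have tk: "of_nat m * c0 * (d t / t) \<in> k"
    using c t dk by (intro is_subfieldD(4,8,9)[OF k])
  have "of_nat (degree q) * (of_nat m * c0 * (d t / t)) + (\<Sum>i\<in>J. c i * (d (N i) / N i))
      = E.T (of_nat m * c0 * (d t / t) + (\<Sum>i\<in>J. c i * (d (y i) / y i)))"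
  proof -
    have "(\<Sum>i\<in>J. c i * (d (y i) / y i)) \<in> M"
      using inM(1) by (rule subfield_sum[OF is_subfield_M])
    then show ?thesis
      using tk M_ring(6) by (simp only: E.T_add E.T_const[OF tk] sum[OF order_refl] subsetD)
  qed
  also have "\<dots> = d (E.T g)" using eq E.T_d[OF g] by simp
  finally have "of_nat (degree q * m) * c0 * (d t / t) + (\<Sum>i\<in>J. c i * (d (N i) / N i)) = d (E.T g)"
    by (simp add: mult_ac)
  then show ?thesis
    unfolding log_relation_def using m q(4) N E.T_k[OF g]
    by (intro exI[of _ "degree q * m"] conjI exI[of _ N] bexI[of _ "E.T g"]) auto
qed

lemma derivation_adjoin_algebraic:
  fixes \<alpha> :: "'a::field_char_0"
  assumes k: "is_subfield k" and d: "derivation d" and dk: "\<And>x. x \<in> k \<Longrightarrow> d x \<in> k"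
    and \<alpha>: "algebraic_over k \<alpha>" and x: "x \<in> adjoin k {\<alpha>}"
  shows "d x \<in> adjoin k {\<alpha>}"
proof -
  obtain q where "simple_extension k \<alpha> q" using exists_simple_extension[OF k \<alpha>] by blast
  then interpret simple_extension k \<alpha> q .
  interpret E: differential_extension k M "degree q" "\<lambda>j. \<alpha> ^ j" d
    by (rule differential_extension_M[OF d dk])
  have "M \<subseteq> adjoin k {\<alpha>}"
  proof
    fix x assume "x \<in> M"
    then obtain h where h: "h \<in> polys_over k" "x = poly h \<alpha>" by (auto simp: M_def)
    have "coeff h i \<in> adjoin k {\<alpha>}" for i using h adjoin_superset(1) by (auto simp: polys_over_def)
    moreover have "\<alpha> \<in> adjoin k {\<alpha>}" using adjoin_superset(2) by blast
    ultimately show "x \<in> adjoin k {\<alpha>}"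
      unfolding h(2) poly_altdef
      by (intro subfield_sum is_subfieldD(4) subfield_power is_subfield_adjoin)
  qed
  moreover have "adjoin k {\<alpha>} \<subseteq> M" using is_subfield_M M_ring(6,7) by (intro adjoin_minimal) auto
  ultimately show ?thesis using E.dM x by blast
qed

lemma algebraic_over_mono: "algebraic_over k s \<Longrightarrow> k \<subseteq> k' \<Longrightarrow> algebraic_over k' s"
  unfolding algebraic_over_def by blast

lemma adjoin_insert: "adjoin k (insert s S) = adjoin (adjoin k S) {s}"
proof
  show "adjoin k (insert s S) \<subseteq> adjoin (adjoin k S) {s}"
  proof (rule adjoin_minimal[OF is_subfield_adjoin])
    have "k \<subseteq> adjoin k S" "S \<subseteq> adjoin k S" "adjoin k S \<subseteq> adjoin (adjoin k S) {s}"
      "{s} \<subseteq> adjoin (adjoin k S) {s}"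
      by (intro adjoin_superset)+
    then show "k \<subseteq> adjoin (adjoin k S) {s}" "insert s S \<subseteq> adjoin (adjoin k S) {s}" by auto
  qed
  have "k \<subseteq> adjoin k (insert s S)" "insert s S \<subseteq> adjoin k (insert s S)" by (intro adjoin_superset)+
  then show "adjoin (adjoin k S) {s} \<subseteq> adjoin k (insert s S)"
    by (intro adjoin_minimal[OF is_subfield_adjoin]) auto
qed

lemma log_relation_descend:
  fixes S :: "'a::field_char_0 set"
  assumes k: "is_subfield k" and d: "derivation d" and dk: "\<And>x. x \<in> k \<Longrightarrow> d x \<in> k"
    and S: "finite S" "\<And>s. s \<in> S \<Longrightarrow> algebraic_over k s"
    and t: "t \<in> k" and c: "c0 \<in> k" "\<And>i. i \<in> J \<Longrightarrow> c i \<in> k"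
    and rel: "log_relation d t c0 J c (adjoin k S)"
  shows "log_relation d t c0 J c k"
proof -
  have "(\<forall>x\<in>adjoin k S. d x \<in> adjoin k S) \<and> (log_relation d t c0 J c (adjoin k S) \<longrightarrow> log_relation d t c0 J c k)"
    using S
  proof (induction S rule: finite_induct)
    case empty
    have "adjoin k {} = k" using adjoin_minimal[OF k, of k "{}"] adjoin_superset(1)[of k "{}"] by auto
    then show ?case using dk by simp
  next
    case (insert s S)
    define k' where "k' = adjoin k S"
    have k': "is_subfield k'" "k \<subseteq> k'" by (auto simp: k'_def is_subfield_adjoin adjoin_superset)
    have IH: "\<And>x. x \<in> k' \<Longrightarrow> d x \<in> k'" "log_relation d t c0 J c k' \<Longrightarrow> log_relation d t c0 J c k"
      using insert by (auto simp: k'_def)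
    have s: "algebraic_over k' s" using insert.prems k'(2) by (auto intro: algebraic_over_mono)
    have "log_relation d t c0 J c k" if rel: "log_relation d t c0 J c (adjoin k' {s})"
    proof (rule IH(2))
      have "t \<in> k'" "c0 \<in> k'" "\<And>i. i \<in> J \<Longrightarrow> c i \<in> k'"
        using subsetD[OF k'(2)] t c by simp_all
      from log_relation_simple_extension[OF k'(1) d IH(1) s this rel]
      show "log_relation d t c0 J c k'" .
    qed
    then show ?case
      unfolding adjoin_insert[of k s S] k'_def[symmetric]
      using derivation_adjoin_algebraic[OF k'(1) d IH(1) s] by blast
  qed
  from mp[OF conjunct2[OF this] rel] show ?thesis .
qed

lemma log_relation_rational_function:
  fixes t :: "'a::field_char_0"
  assumes E: "is_subfield E" and d: "d \<in> Der E" and t: "d t = 1" "\<not> algebraic_over E t"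
    and J: "finite J" "i0 \<notin> J" and cE: "\<And>i. i \<in> insert i0 J \<Longrightarrow> c i \<in> E"
    and indep: "\<And>n :: 'i \<Rightarrow> int. (\<Sum>i\<in>insert i0 J. of_int (n i) * c i) = 0 \<Longrightarrow> n i0 = 0"
    and rel: "log_relation d t (c i0) J c (adjoin E {t})"
  shows False
proof -
  have dd: "derivation d" using d by (simp add: Der_def)
  note K = polys_over_closed[OF E]
  define F where "F P = fps_to_fls (fps_of_poly P)" for P :: "'a poly"
  have F: "F (P + Q) = F P + F Q" "F (P * Q) = F P * F Q" "F (P - Q) = F P - F Q" "F P = 0 \<longleftrightarrow> P = 0"
    "F (pderiv P) = fls_deriv (F P)" for P Q
    by (simp_all add: F_def fps_of_poly_add fps_of_poly_mult fps_of_poly_diff fls_times_fps_to_fls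
        fls_deriv_fps_to_fls fps_of_poly_pderiv fps_of_poly_eq_iff[of P 0, simplified])
  have dF: "derivation (fls_deriv :: 'a fls \<Rightarrow> 'a fls)"
    by (simp add: derivation_def)
  have inj: "P = 0" if "P \<in> polys_over E" "poly P t = 0" for P
    using that t(2) unfolding algebraic_over_def polys_over_def by blast
  define R where "R x P Q \<longleftrightarrow> P \<in> polys_over E \<and> Q \<in> polys_over E \<and> Q \<noteq> 0 \<and> poly P t = x * poly Q t"
    for x P Q
  have R0: "poly Q t \<noteq> 0" if "R x P Q" for x P Q
    using that inj by (auto simp: R_def)
  have R: "R x P Q \<Longrightarrow> R y A B \<Longrightarrow> R (x + y) (P * B + A * Q) (Q * B)"
    "R x P Q \<Longrightarrow> R y A B \<Longrightarrow> R (x * y) (P * A) (Q * B)" "R x P Q \<Longrightarrow> R (- x) (- P) Q"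
    for x y P Q A B
    by (auto simp: R_def K algebra_simps)
  have R_inv: "R (inverse x) Q P" if "R x P Q" "x \<noteq> 0" for x P Q
    using that R0[OF that(1)] by (auto simp: R_def)
  have sf: "is_subfield {x. \<exists>P Q. R x P Q}"
    unfolding is_subfield_def
  proof (intro conjI ballI)
    have 0: "R 0 0 1" "R 1 1 1" using K(1,2) by (simp_all add: R_def)
    then show 01: "0 \<in> {x. \<exists>P Q. R x P Q}" "1 \<in> {x. \<exists>P Q. R x P Q}" by blast+
    fix x assume x: "x \<in> {x. \<exists>P Q. R x P Q}"
    then show "- x \<in> {x. \<exists>P Q. R x P Q}" using R(3) by blast
    show "inverse x \<in> {x. \<exists>P Q. R x P Q}"
    proof (cases "x = 0")
      case True
      then show ?thesis using 01 by simp
    next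
      case False
      then show ?thesis using x R_inv[of x] by blast
    qed
    fix y assume "y \<in> {x. \<exists>P Q. R x P Q}"
    then show "x + y \<in> {x. \<exists>P Q. R x P Q}" "x * y \<in> {x. \<exists>P Q. R x P Q}" using x R(1,2) by blast+
  qed
  have RE: "R x [:x:] 1" if "x \<in> E" for x using K(2,3) that by (simp add: R_def)
  have Rt: "R t [:0, 1:] 1" using K(2,4) by (simp add: R_def)
  define k where "k = {x. \<exists>P Q. R x P Q}"
  have sub: "adjoin E {t} \<subseteq> k"
    unfolding k_def by (rule adjoin_minimal[OF sf]) (use RE Rt in blast)+
  define \<phi> where "\<phi> x = (SOME f. \<exists>P Q. R x P Q \<and> f = F P / F Q)" for x
  have \<phi>: "\<phi> x = F P / F Q" if "R x P Q" for x P Q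
  proof -
    have "\<exists>f. \<exists>P Q. R x P Q \<and> f = F P / F Q" using that by blast
    from someI_ex[OF this] obtain A B where AB: "R x A B" "\<phi> x = F A / F B"
      unfolding \<phi>_def by blast
    have "poly (P * B - A * Q) t = 0"
      using that AB by (auto simp: R_def)
    then have "P * B - A * Q = 0" using that AB by (intro inj K) (auto simp: R_def)
    then have "F P * F B = F A * F Q" using F(2) by (metis eq_iff_diff_eq_0)
    then show ?thesis using that AB by (auto simp: R_def frac_eq_eq F)
  qed
  have kr: "\<phi> (x + y) = \<phi> x + \<phi> y" "\<phi> (x * y) = \<phi> x * \<phi> y" if xy: "x \<in> k" "y \<in> k" for x y
  proof -
    obtain P Q A B where PQ: "R x P Q" "R y A B" using xy by (auto simp: k_def)
    then have "F Q \<noteq> 0" "F B \<noteq> 0" by (auto simp: R_def F)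
    then show "\<phi> (x + y) = \<phi> x + \<phi> y" "\<phi> (x * y) = \<phi> x * \<phi> y"
      using \<phi>[OF PQ(1)] \<phi>[OF PQ(2)] \<phi>[OF R(1)[OF PQ]] \<phi>[OF R(2)[OF PQ]]
      by (simp_all add: F add_frac_eq)
  qed
  have kd: "d x \<in> k \<and> \<phi> (d x) = fls_deriv (\<phi> x)" if x: "x \<in> k" for x
  proof -
    obtain P Q where PQ: "R x P Q" using x by (auto simp: k_def)
    have dP: "d (poly P t) = poly (pderiv P) t" if "P \<in> polys_over E" for P
    proof -
      have "map_poly d P = 0"
        using that d by (intro poly_eqI) (simp add: coeff_map_poly derivation_0[OF dd] polys_over_def Der_def)
      then show ?thesis using derivation_poly[OF dd, of P t] t(1) by simp
    qed
    have "R (d x) (pderiv P * Q - P * pderiv Q) (Q * Q)"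
      unfolding R_def
    proof (intro conjI)
      have P: "P \<in> polys_over E" "Q \<in> polys_over E" "poly P t = x * poly Q t" using PQ by (auto simp: R_def)
      have "poly (pderiv P) t = x * poly (pderiv Q) t + d x * poly Q t"
        using arg_cong[OF P(3), of d] by (simp add: derivation_mult[OF dd] dP P(1,2))
      then show "poly (pderiv P * Q - P * pderiv Q) t = d x * poly (Q * Q) t"
        using P(3) by (simp add: algebra_simps)
    qed (use PQ K in \<open>auto simp: R_def\<close>)
    moreover have "F (pderiv P * Q - P * pderiv Q) / F (Q * Q) = fls_deriv (F P / F Q)"
      using PQ F(4)[of Q] by (simp add: R_def derivation_divide[OF dF] F field_simps power2_eq_square)
    ultimately show ?thesis using \<phi>[OF PQ] \<phi> by (auto simp: k_def)
  qed
  have \<phi>E: "\<phi> x = fls_const x" if "x \<in> E" for x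
    using \<phi>[OF RE[OF that]] by (simp add: F_def fps_of_poly_const)
  have \<phi>t: "\<phi> t = fls_X" using \<phi>[OF Rt] by (simp add: F_def)
  have k: "is_subfield k" using sf by (simp add: k_def)
  have \<phi>0: "\<phi> x \<noteq> 0" if "x \<in> k" "x \<noteq> 0" for x
    using that kr(2)[of x "inverse x"] \<phi>E[OF is_subfieldD(2)[OF E]] is_subfieldD(6)[OF k] by auto
  have \<phi>div: "\<phi> (x / y) = \<phi> x / \<phi> y" if "x \<in> k" "y \<in> k" "y \<noteq> 0" for x y
    using kr(2)[of "x / y" y] that \<phi>0[of y] is_subfieldD(8)[OF k] by (simp add: field_simps)
  have Ek: "E \<subseteq> k" "t \<in> k"
    using sub adjoin_superset(1)[of E "{t}"] adjoin_superset(2)[of "{t}" E] by auto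
  obtain m y g where m: "m > 0" and g: "g \<in> k" and y: "\<And>i. i \<in> J \<Longrightarrow> y i \<in> k \<and> y i \<noteq> 0"
    and eq: "of_nat m * c i0 * (d t / t) + (\<Sum>i\<in>J. c i * (d (y i) / y i)) = d g"
    using log_relation_mono[OF rel sub] unfolding log_relation_def by blast
  define ord where "ord i = fls_subdegree (\<phi> (y i))" for i
  have res: "fls_residue (\<phi> (c i * (d (y i) / y i))) = c i * of_int (ord i)" if i: "i \<in> J" for i
  proof -
    have "d (y i) / y i \<in> k" using y[OF i] kd is_subfieldD(8)[OF k] by blast
    then have "\<phi> (c i * (d (y i) / y i)) = fls_const (c i) * \<phi> (d (y i) / y i)"
      using cE[of i] i Ek by (simp only: kr(2) \<phi>E insertI2 subsetD)
    also have "\<phi> (d (y i) / y i) = fls_deriv (\<phi> (y i)) * inverse (\<phi> (y i))"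
      using \<phi>div[of "d (y i)" "y i"] y[OF i] kd[of "y i"] by (metis divide_inverse)
    finally show ?thesis
      by (simp only: fls_residue_fls_const_times fls_residue_deriv_times_inverse_eq_subdegree ord_def)
  qed
  have inJ: "c i * (d (y i) / y i) \<in> k" if "i \<in> J" for i
    using y[OF that] kd Ek cE[of i] that is_subfieldD(4,8)[OF k] by blast
  have sum: "fls_residue (\<phi> (\<Sum>i\<in>J'. c i * (d (y i) / y i))) = (\<Sum>i\<in>J'. c i * of_int (ord i))"
    if "J' \<subseteq> J" "finite J'" for J'
    using that(2,1)
  proof (induction J' rule: finite_induct)
    case empty
    show ?case using \<phi>E[OF is_subfieldD(1)[OF E]] by simp
  next
    case (insert i J')
    have "(\<Sum>i\<in>J'. c i * (d (y i) / y i)) \<in> k"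
      using insert.prems inJ by (intro subfield_sum[OF k]) auto
    then show ?case
      using insert inJ[of i] res[of i] by (simp add: kr fls_residue_add)
  qed
  have "of_nat m * c i0 * (d t / t) \<in> k"
    using Ek cE[of i0] t(1) is_subfieldD[OF k] by (intro is_subfieldD(4,8,9)[OF k]) auto
  moreover have "(\<Sum>i\<in>J. c i * (d (y i) / y i)) \<in> k" using inJ by (rule subfield_sum[OF k])
  ultimately have "fls_residue (\<phi> (d g)) = fls_residue (\<phi> (of_nat m * c i0 * (d t / t))) + (\<Sum>i\<in>J. c i * of_int (ord i))"
    by (simp only: eq[symmetric] kr fls_residue_add sum[OF order_refl J(1)])
  moreover have "fls_residue (\<phi> (d g)) = 0" using kd[OF g] by (simp add: fls_residue_deriv)
  moreover have "fls_residue (\<phi> (of_nat m * c i0 * (d t / t))) = of_nat m * c i0"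
  proof -
    have t0: "t \<noteq> 0" using t(1) derivation_0[OF dd] by auto
    have "of_nat m * c i0 \<in> E" using cE[of i0] is_subfieldD(4,9)[OF E] by auto
    moreover have "\<phi> (d t / t) = inverse fls_X"
      using \<phi>div[of "d t" t] Ek kd[OF Ek(2)] t0 t(1) \<phi>t by (simp add: divide_inverse)
    moreover have "d t / t \<in> k" using Ek(2) kd is_subfieldD(8)[OF k] by blast
    moreover have "fls_residue (inverse fls_X :: 'a fls) = 1"
      using fls_residue_deriv_times_inverse_eq_subdegree(1)[of "fls_X :: 'a fls"] by simp
    ultimately show ?thesis
      using Ek by (simp only: kr(2) \<phi>E subsetD fls_residue_fls_const_times) simp
  qed
  ultimately have "of_nat m * c i0 + (\<Sum>i\<in>J. c i * of_int (ord i)) = 0" by simp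
  moreover have "(\<Sum>i\<in>insert i0 J. of_int ((if i = i0 then int m else ord i)) * c i) = of_nat m * c i0 + (\<Sum>i\<in>J. c i * of_int (ord i))"
    using J by (auto intro!: sum.cong simp: mult.commute)
  ultimately have "int m = 0"
    using indep[of "\<lambda>i. if i = i0 then int m else ord i"] by simp
  with m show False by simp
qed

lemma is_subfield_derivation_closed:
  assumes F: "is_subfield F" and d: "derivation d"
  shows "is_subfield {x\<in>F. d x \<in> F}"
  unfolding is_subfield_def
proof (intro conjI ballI)
  note [simp] = is_subfieldD[OF F] derivation_0[OF d] derivation_1[OF d] derivation_add[OF d]
    derivation_mult[OF d] derivation_minus[OF d]
  show "0 \<in> {x\<in>F. d x \<in> F}" "1 \<in> {x\<in>F. d x \<in> F}" by simp_all
  fix x assume x: "x \<in> {x\<in>F. d x \<in> F}"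
  then show "- x \<in> {x\<in>F. d x \<in> F}" by simp
  show "inverse x \<in> {x\<in>F. d x \<in> F}"
    using x by (cases "x = 0") (auto simp: derivation_inverse[OF d] power2_eq_square)
  fix y assume "y \<in> {x\<in>F. d x \<in> F}"
  with x show "x + y \<in> {x\<in>F. d x \<in> F}" "x * y \<in> {x\<in>F. d x \<in> F}" by simp_all
qed

lemma log_derivative_powi:
  assumes d: "derivation d" and y: "y \<noteq> 0"
  shows "d (y powi n) / y powi n = of_int n * (d y / y)"
proof -
  have nat: "d (y ^ m) / y ^ m = of_nat m * (d y / y)" for m
    unfolding derivation_power[OF d] using y by (cases m) (simp_all add: field_simps)
  show ?thesis
  proof (cases "n \<ge> 0")
    case True
    then obtain m where "n = int m" by (metis nonneg_int_cases)
    then show ?thesis using nat by simp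
  next
    case False
    then obtain m where n: "n = - int m" by (metis linear neg_0_le_iff_le nonneg_int_cases minus_minus)
    have "d (inverse (y ^ m)) / inverse (y ^ m) = - (d (y ^ m) / y ^ m)"
      using y by (subst derivation_inverse[OF d]) (simp_all add: power2_eq_square)
    then show ?thesis using nat n by (simp add: power_int_minus)
  qed
qed

lemma log_derivative_mult:
  assumes d: "derivation d" and "x \<noteq> 0" "y \<noteq> 0"
  shows "d (x * y) / (x * y) = d x / x + d y / y"
  using assms(2,3) by (simp add: derivation_mult[OF d] field_simps)

text \<open>A transcendental \<open>t = y i0\<close> is made a coordinate over a field \<open>E\<close> over which the remaining data are
  algebraic in \<open>t\<close>; norms and traces bring the relation down to \<open>E(t)\<close>, where residues at \<open>t = 0\<close> are
  integers.\<close>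

lemma log_relation_imp_zero:
  fixes y :: "'i \<Rightarrow> 'a::field_char_0"
  assumes K: "is_subfield K" and J: "finite J" and cK: "\<And>i. i \<in> J \<Longrightarrow> c i \<in> K"
    and y: "\<And>i. i \<in> J \<Longrightarrow> y i \<noteq> 0"
    and indep: "\<And>n :: 'i \<Rightarrow> int. (\<Sum>i\<in>J. of_int (n i) * c i) = 0 \<Longrightarrow> \<forall>i\<in>J. n i = 0"
    and rel: "\<And>d. d \<in> Der K \<Longrightarrow> (\<Sum>i\<in>J. c i * (d (y i) / y i)) = d g"
    and i0: "i0 \<in> J" and "\<delta> \<in> Der K"
  shows "\<delta> (y i0) = 0"
proof (rule ccontr)
  assume nz: "\<delta> (y i0) \<noteq> 0"
  define t where "t = y i0"
  define J' where "J' = J - {i0}"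
  define Y where "Y = insert g (y ` J')"
  define \<B> where "\<B> = {B. B \<subseteq> Y \<and> (\<exists>d\<in>Der (K \<union> B). d t \<noteq> 0)}"
  have fY: "finite Y" using J by (simp add: Y_def J'_def)
  have "finite \<B>" by (rule finite_subset[of _ "Pow Y"]) (use fY in \<open>auto simp: \<B>_def\<close>)
  moreover have "{} \<in> \<B>" using nz assms(8) by (auto simp: \<B>_def t_def)
  ultimately obtain B where B: "B \<in> \<B>" and max: "\<And>B'. B' \<in> \<B> \<Longrightarrow> B \<subseteq> B' \<Longrightarrow> B = B'"
    using finite_has_maximal[of \<B>] by blast
  obtain d0 where d0: "d0 \<in> Der (K \<union> B)" "d0 t \<noteq> 0" using B by (auto simp: \<B>_def)
  define E where "E = adjoin K B"
  define d where "d x = (1 / d0 t) * d0 x" for x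
  have E: "is_subfield E" "K \<subseteq> E" by (simp_all add: E_def is_subfield_adjoin adjoin_superset)
  have dt: "d t = 1" using d0 by (simp add: d_def)
  have "d \<in> Der (K \<union> B)"
    using d0 derivation_cmult[of d0 "1 / d0 t"] by (auto simp: Der_def d_def[abs_def])
  then have dE: "d \<in> Der E" by (simp add: E_def Der_adjoin)
  have dd: "derivation d" using dE by (rule Der_derivation)
  have t_tr: "\<not> algebraic_over E t" using Der_algebraic_zero[OF E(1) _ dE] dt by auto
  define k where "k = adjoin E {t}"
  have "{t} \<subseteq> k" unfolding k_def by (rule adjoin_superset)
  then have "t \<in> k" by blast
  moreover have "is_subfield k" "E \<subseteq> k" by (simp_all add: k_def is_subfield_adjoin adjoin_superset)
  ultimately have k: "is_subfield k" "E \<subseteq> k" "t \<in> k" by blast+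
  have alg: "algebraic_over k s" if s: "s \<in> Y" for s
  proof (rule ccontr)
    assume "\<not> algebraic_over k s"
    then obtain d1 where d1: "d1 \<in> Der k" "d1 s = 1"
      using exists_derivation_transcendental[OF k(1)] by blast
    define d2 where "d2 x = d x - d s * d1 x" for x
    have "derivation d2"
      unfolding d2_def using dE d1(1) by (intro derivation_minus_cmult Der_derivation)
    moreover have "d1 x = 0" "d x = 0" if "x \<in> E" for x
      using that d1(1) dE k(2) by (auto simp: Der_def)
    moreover have "K \<subseteq> E" "B \<subseteq> E" by (auto simp: E_def adjoin_superset)
    moreover have "d2 s = 0" using d1(2) by (simp add: d2_def)
    ultimately have "d2 \<in> Der (K \<union> insert s B)" by (auto simp: Der_def d2_def)
    moreover have "d1 t = 0" using d1(1) k(3) by (simp add: Der_def)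
    then have "d2 t \<noteq> 0" by (simp add: d2_def dt)
    ultimately have "insert s B \<in> \<B>" using B s by (auto simp: \<B>_def)
    then have "s \<in> B" using max[of "insert s B"] by blast
    then have "s \<in> k" using \<open>B \<subseteq> E\<close> k(2) by blast
    then show False using d1 by (simp add: Der_def)
  qed
  have dk: "d x \<in> k" if "x \<in> k" for x
  proof -
    have "\<And>x. x \<in> E \<Longrightarrow> d x = 0" using dE by (simp add: Der_def)
    then have "k \<subseteq> {x\<in>k. d x \<in> k}"
      unfolding k_def using k is_subfieldD(1,2)[OF k(1)] dt
      by (intro adjoin_minimal[OF is_subfield_derivation_closed[OF _ dd]]) (auto simp: k_def is_subfield_adjoin)
    then show ?thesis using that by blast
  qed
  have "log_relation d t (c i0) J' c (adjoin k Y)"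
    unfolding log_relation_def
  proof (intro exI[of _ "1 :: nat"] exI[of _ y] bexI[of _ g] conjI ballI)
    have "d \<in> Der K" using dE E(2) by (auto simp: Der_def)
    from rel[OF this] show "of_nat 1 * c i0 * (d t / t) + (\<Sum>i\<in>J'. c i * (d (y i) / y i)) = d g"
      using J i0 by (simp add: sum.remove J'_def t_def)
    have "Y \<subseteq> adjoin k Y" by (rule adjoin_superset)
    then show "g \<in> adjoin k Y" "\<And>i. i \<in> J' \<Longrightarrow> y i \<in> adjoin k Y" by (auto simp: Y_def)
  qed (use y in \<open>auto simp: J'_def\<close>)
  moreover have "c i0 \<in> k" "\<And>i. i \<in> J' \<Longrightarrow> c i \<in> k"
    using cK i0 E(2) k(2) by (auto simp: J'_def)
  ultimately have rel_k: "log_relation d t (c i0) J' c k"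
    using log_relation_descend[OF k(1) dd dk fY alg k(3)] by blast
  show False
  proof (rule log_relation_rational_function[OF E(1) dE dt t_tr])
    show "log_relation d t (c i0) J' c (adjoin E {t})" using rel_k by (simp add: k_def)
    show "finite J'" "i0 \<notin> J'" using J by (auto simp: J'_def)
    have JJ: "insert i0 J' = J" using i0 by (auto simp: J'_def)
    show "c i \<in> E" if "i \<in> insert i0 J'" for i using that cK E(2) by (auto simp: JJ)
    show "n i0 = 0" if "(\<Sum>i\<in>insert i0 J'. of_int (n i) * c i) = 0" for n :: "'i \<Rightarrow> int"
      using indep[of n] that i0 by (simp only: JJ)
  qed
qed

lemma log_relation_imp_integer_relation:
  fixes y :: "'i \<Rightarrow> 'a::field_char_0"
  assumes K: "is_subfield K" and "finite J" "\<And>i. i \<in> J \<Longrightarrow> c i \<in> K" "\<And>i. i \<in> J \<Longrightarrow> y i \<noteq> 0"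
    and "\<exists>i\<in>J. c i \<noteq> 0" "\<And>d. d \<in> Der K \<Longrightarrow> (\<Sum>i\<in>J. c i * (d (y i) / y i)) = d g"
  shows "\<exists>n :: 'i \<Rightarrow> int. (\<exists>i\<in>J. n i \<noteq> 0) \<and> (\<forall>d\<in>Der K. (\<Sum>i\<in>J. of_int (n i) * (d (y i) / y i)) = 0)"
  using assms(2-)
proof (induction "card J" arbitrary: J y g)
  case 0
  then show ?case by simp
next
  case (Suc N)
  show ?case
  proof (cases "\<forall>n :: 'i \<Rightarrow> int. (\<Sum>i\<in>J. of_int (n i) * c i) = 0 \<longrightarrow> (\<forall>i\<in>J. n i = 0)")
    case True
    obtain i0 where i0: "i0 \<in> J" using Suc.prems(4) by blast
    have "d (y i0) = 0" if "d \<in> Der K" for d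
      by (rule log_relation_imp_zero[OF K Suc.prems(1-3) _ Suc.prems(5) i0 that]) (use True in auto)
    then have "(\<Sum>i\<in>J. of_int (if i = i0 then 1 else 0) * (d (y i) / y i)) = 0" if "d \<in> Der K" for d
      using that by (intro sum.neutral) auto
    then show ?thesis using i0 by (intro exI[of _ "\<lambda>i. if i = i0 then 1 else 0"]) auto
  next
    case False
    then obtain n :: "'i \<Rightarrow> int" and i1 where n: "(\<Sum>i\<in>J. of_int (n i) * c i) = 0" and i1: "i1 \<in> J" "n i1 \<noteq> 0"
      by blast
    define J' where "J' = J - {i1}"
    have fJ: "finite J'" using Suc.prems(1) by (simp add: J'_def)
    have remove: "(\<Sum>i\<in>J. f i) = f i1 + (\<Sum>i\<in>J'. f i)" for f :: "'i \<Rightarrow> 'a"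
      unfolding J'_def using Suc.prems(1) i1(1) by (rule sum.remove)
    have c1: "of_int (n i1) * c i1 = - (\<Sum>i\<in>J'. of_int (n i) * c i)"
      using n unfolding remove by (simp add: eq_neg_iff_add_eq_0)
    define y' where "y' i = y i powi n i1 * y i1 powi (- n i)" for i
    define l where "l d i = d (y i) / y i" for d i
    have y': "y' i \<noteq> 0" "d \<in> Der K \<Longrightarrow> d (y' i) / y' i = of_int (n i1) * l d i - of_int (n i) * l d i1"
      if "i \<in> J'" for i d
    proof -
      have nz: "y i \<noteq> 0" "y i1 \<noteq> 0" using Suc.prems(3) that i1 by (auto simp: J'_def)
      then show "y' i \<noteq> 0" by (simp add: y'_def)
      assume "d \<in> Der K"
      then have d: "derivation d" by (rule Der_derivation)
      show "d (y' i) / y' i = of_int (n i1) * l d i - of_int (n i) * l d i1"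
        unfolding y'_def l_def using nz by (simp add: log_derivative_mult[OF d] log_derivative_powi[OF d])
    qed
    have "\<exists>m :: 'i \<Rightarrow> int. (\<exists>i\<in>J'. m i \<noteq> 0) \<and> (\<forall>d\<in>Der K. (\<Sum>i\<in>J'. of_int (m i) * (d (y' i) / y' i)) = 0)"
    proof (rule Suc.hyps(1)[of _ _ "of_int (n i1) * g"])
      show "N = card J'" using Suc.hyps(2) Suc.prems(1) i1(1) by (simp add: J'_def)
      show "finite J'" by (rule fJ)
      show "c i \<in> K" "y' i \<noteq> 0" if "i \<in> J'" for i using Suc.prems(2) y' that by (auto simp: J'_def)
      show "\<exists>i\<in>J'. c i \<noteq> 0"
      proof (rule ccontr)
        assume a: "\<not> (\<exists>i\<in>J'. c i \<noteq> 0)"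
        then have "of_int (n i1) * c i1 = 0" using c1 by simp
        then have "c i1 = 0" using i1 by simp
        then show False using a Suc.prems(4) by (auto simp: J'_def)
      qed
      fix d assume d: "d \<in> Der K"
      then have dd: "derivation d" by (rule Der_derivation)
      have "(\<Sum>i\<in>J'. c i * (d (y' i) / y' i)) = of_int (n i1) * (\<Sum>i\<in>J'. c i * l d i) - (\<Sum>i\<in>J'. of_int (n i) * c i) * l d i1"
        using d by (simp add: y' algebra_simps sum_subtractf sum_distrib_left sum_distrib_right)
      also have "\<dots> = of_int (n i1) * (\<Sum>i\<in>J. c i * l d i)"
        unfolding remove distrib_left mult.assoc[symmetric] c1 by simp
      also have "\<dots> = of_int (n i1) * d g" using Suc.prems(5)[OF d] by (simp add: l_def)
      also have "\<dots> = d (of_int (n i1) * g)" by (simp add: derivation_mult[OF dd] derivation_of_int[OF dd])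
      finally show "(\<Sum>i\<in>J'. c i * (d (y' i) / y' i)) = d (of_int (n i1) * g)" .
    qed
    then obtain m :: "'i \<Rightarrow> int" where m: "\<exists>i\<in>J'. m i \<noteq> 0"
      "\<And>d. d \<in> Der K \<Longrightarrow> (\<Sum>i\<in>J'. of_int (m i) * (d (y' i) / y' i)) = 0" by blast
    define r where "r i = (if i = i1 then - (\<Sum>i\<in>J'. m i * n i) else n i1 * m i)" for i
    have ri: "r i = n i1 * m i" if "i \<in> J'" for i using that by (auto simp: r_def J'_def)
    have "\<exists>i\<in>J. r i \<noteq> 0" using m(1) i1 ri by (force simp: J'_def)
    moreover have "(\<Sum>i\<in>J. of_int (r i) * (d (y i) / y i)) = 0" if d: "d \<in> Der K" for d
    proof -
      have "(\<Sum>i\<in>J. of_int (r i) * l d i) = (\<Sum>i\<in>J'. of_int (m i) * (d (y' i) / y' i))"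
        unfolding remove using d
        by (simp add: ri y' r_def[of i1] algebra_simps sum_subtractf sum_distrib_left sum_distrib_right)
      then show ?thesis using m(2)[OF d] by (simp add: l_def)
    qed
    ultimately show ?thesis by blast
  qed
qed

text \<open>Ax's argument: the Lie derivative along \<open>D\<close> annihilates each form \<open>d e / e - d w\<close>, so a
  minimal linear relation among these forms has coefficients in the kernel of \<open>D\<close>.\<close>

lemma exponential_forms_independent:
  fixes w e :: "'i \<Rightarrow> 'a::field_char_0"
  assumes D: "derivation D" and J: "finite J" and e: "\<And>i. i \<in> J \<Longrightarrow> e i \<noteq> 0"
    and De: "\<And>i. i \<in> J \<Longrightarrow> D (e i) = e i * D (w i)"
    and indep: "\<And>n :: 'i \<Rightarrow> int. D (\<Sum>i\<in>J. of_int (n i) * w i) = 0 \<Longrightarrow> \<forall>i\<in>J. n i = 0"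
    and rel: "\<And>d. d \<in> Der {x. D x = 0} \<Longrightarrow> (\<Sum>i\<in>J. f i * (d (e i) / e i - d (w i))) = 0"
    and i: "i \<in> J"
  shows "f i = 0"
proof (rule ccontr)
  assume fi: "f i \<noteq> 0"
  define K where "K = {x. D x = 0}"
  have K: "is_subfield K" unfolding K_def by (rule is_subfield_kernel[OF D])
  have DK: "D \<in> Der K" using D by (auto simp: Der_def K_def)
  define \<omega> where "\<omega> d i = d (e i) / e i - d (w i)" for d i
  define R where "R f \<longleftrightarrow> (\<exists>i\<in>J. f i \<noteq> 0) \<and> (\<forall>d\<in>Der K. (\<Sum>i\<in>J. f i * \<omega> d i) = 0)" for f
  have "R f" using fi i rel by (auto simp: R_def \<omega>_def K_def)
  from ex_has_least_nat[of R, OF this, of "\<lambda>h. card {i\<in>J. h i \<noteq> 0}"]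
  obtain h where h: "R h" and min: "\<forall>h'. R h' \<longrightarrow> card {i\<in>J. h i \<noteq> 0} \<le> card {i\<in>J. h' i \<noteq> 0}"
    by (elim exE conjE)
  obtain i1 where i1: "i1 \<in> J" "h i1 \<noteq> 0" using h by (auto simp: R_def)
  define c where "c i = h i / h i1" for i
  have c1: "c i1 = 1" using i1 by (simp add: c_def)
  have crel: "(\<Sum>i\<in>J. c i * \<omega> d i) = 0" if "d \<in> Der K" for d
  proof -
    have "(\<Sum>i\<in>J. c i * \<omega> d i) = (\<Sum>i\<in>J. h i * \<omega> d i) / h i1"
      by (simp add: c_def sum_divide_distrib)
    then show ?thesis using h that by (simp add: R_def)
  qed
  have "D (c i) = 0" if iJ: "i \<in> J" for i
  proof (rule ccontr)
    assume nz: "D (c i) \<noteq> 0"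
    have "(\<Sum>i\<in>J. D (c i) * \<omega> d i) = 0" if d: "d \<in> Der K" for d
    proof -
      have dd: "derivation d" using d by (rule Der_derivation)
      define b where "b x = D (d x) - d (D x)" for x
      have "derivation b" unfolding b_def by (rule derivation_commutator[OF D dd])
      moreover have "b x = 0" if "x \<in> K" for x
        using that d by (simp add: b_def K_def Der_def derivation_0[OF D] derivation_0[OF dd])
      ultimately have b: "b \<in> Der K" by (simp add: Der_def)
      have lie: "D (\<omega> d i) = \<omega> b i" if "i \<in> J" for i
        using e[OF that] De[OF that]
        by (simp add: \<omega>_def b_def derivation_diff[OF D] derivation_divide[OF D] derivation_mult[OF dd] derivation_mult[OF D] field_simps power2_eq_square)
      have "0 = D (\<Sum>i\<in>J. c i * \<omega> d i)" using crel[OF d] by (simp add: derivation_0[OF D])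
      also have "\<dots> = (\<Sum>i\<in>J. c i * \<omega> b i) + (\<Sum>i\<in>J. D (c i) * \<omega> d i)"
        by (simp add: derivation_sum[OF D] derivation_mult[OF D] lie sum.distrib)
      finally show ?thesis using crel[OF b] by simp
    qed
    then have "R (\<lambda>i. D (c i))" using nz iJ by (auto simp: R_def)
    then have "card {i\<in>J. h i \<noteq> 0} \<le> card {i\<in>J. D (c i) \<noteq> 0}" using min by simp
    also have "\<dots> < card {i\<in>J. h i \<noteq> 0}"
    proof (rule psubset_card_mono)
      have "h i \<noteq> 0" if "D (c i) \<noteq> 0" for i using that by (auto simp: c_def derivation_0[OF D])
      moreover have "i1 \<notin> {i\<in>J. D (c i) \<noteq> 0}" "i1 \<in> {i\<in>J. h i \<noteq> 0}"
        using i1 c1 derivation_1[OF D] by simp_all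
      ultimately show "{i\<in>J. D (c i) \<noteq> 0} \<subset> {i\<in>J. h i \<noteq> 0}" by blast
    qed (use J in auto)
    finally show False by simp
  qed
  then have cK: "c i \<in> K" if "i \<in> J" for i using that by (simp add: K_def)
  have crel': "(\<Sum>i\<in>J. c i * (d (e i) / e i)) = d (\<Sum>i\<in>J. c i * w i)" if d: "d \<in> Der K" for d
  proof -
    have dd: "derivation d" using d by (rule Der_derivation)
    have "d (c i) = 0" if "i \<in> J" for i using d cK[OF that] by (simp add: Der_def)
    then have "d (\<Sum>i\<in>J. c i * w i) = (\<Sum>i\<in>J. c i * d (w i))"
      by (simp add: derivation_sum[OF dd] derivation_mult[OF dd])
    then show ?thesis using crel[OF d] by (simp add: \<omega>_def right_diff_distrib sum_subtractf)
  qed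
  have nz: "\<exists>i\<in>J. c i \<noteq> 0" using i1 c1 by force
  have "\<exists>n :: 'i \<Rightarrow> int. (\<exists>i\<in>J. n i \<noteq> 0) \<and>
      (\<forall>d\<in>Der K. (\<Sum>i\<in>J. of_int (n i) * (d (e i) / e i)) = 0)"
    by (rule log_relation_imp_integer_relation[OF K J cK e nz crel'])
  then obtain n :: "'i \<Rightarrow> int" where n: "\<exists>i\<in>J. n i \<noteq> 0"
    "\<forall>d\<in>Der K. (\<Sum>i\<in>J. of_int (n i) * (d (e i) / e i)) = 0"
    by (elim exE conjE)
  have "D (\<Sum>i\<in>J. of_int (n i) * w i) = (\<Sum>i\<in>J. of_int (n i) * (D (e i) / e i))"
    by (simp add: derivation_sum[OF D] derivation_mult[OF D] derivation_of_int[OF D] De e)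
  also have "\<dots> = 0" using n(2) DK by (rule bspec)
  finally have "\<forall>i\<in>J. n i = 0" by (rule indep)
  with n(1) show False by blast
qed

section \<open>The p-adic exponential\<close>

context padic_complex_field
begin

definition nrm :: "'a \<Rightarrow> real" where
  "nrm x = dist x 0"

lemma p_gt_1: "real p > 1"
  using prime_gt_1_nat[OF prime_p] by simp

lemma nrm_0 [simp]: "nrm 0 = 0"
  by (simp add: nrm_def)

lemma dist_nrm: "dist x y = nrm (x - y)"
  by (simp add: nrm_def dist_v)

lemma nrm_v: "x \<noteq> 0 \<Longrightarrow> nrm x = real p powr (- real_of_ereal (v x))"
  by (simp add: nrm_def dist_v)

lemma nrm_ge_0 [simp]: "nrm x \<ge> 0"
  by (simp add: nrm_def)

lemma nrm_eq_0_iff [simp]: "nrm x = 0 \<longleftrightarrow> x = 0"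
  by (simp add: nrm_def)

lemma nrm_gt_0: "x \<noteq> 0 \<Longrightarrow> nrm x > 0"
  by (simp add: nrm_def)

lemma v_finite:
  assumes "x \<noteq> 0"
  obtains r where "v x = ereal r"
  using assms v_eq_infinity_iff[of x] v_not_minus_infinity[of x] by (cases "v x") auto

lemma nrm_mult: "nrm (x * y) = nrm x * nrm y"
proof (cases "x = 0 \<or> y = 0")
  case False
  then obtain a b where "v x = ereal a" "v y = ereal b" by (metis v_finite)
  then show ?thesis using False p_gt_1 by (simp add: nrm_v v_mult powr_add[symmetric])
qed auto

lemma nrm_add: "nrm (x + y) \<le> max (nrm x) (nrm y)"
proof (cases "x = 0 \<or> y = 0 \<or> x + y = 0")
  case False
  then obtain a b c where v: "v x = ereal a" "v y = ereal b" "v (x + y) = ereal c" by (metis v_finite)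
  then have "min a b \<le> c" using v_add[of x y] by (simp add: min_def split: if_splits)
  then show ?thesis using False v p_gt_1 by (auto simp: nrm_v le_max_iff_disj min_le_iff_disj)
qed (auto simp: max_def)

lemma nrm_1 [simp]: "nrm 1 = 1"
  using nrm_mult[of 1 1] nrm_gt_0[of 1] by simp

lemma nrm_minus [simp]: "nrm (- x) = nrm x"
proof -
  have "nrm (- 1) * nrm (- 1) = 1" using nrm_mult[of "- 1" "- 1"] by simp
  then have "nrm (- 1) = 1" using nrm_ge_0[of "- 1"] by (metis abs_of_nonneg abs_one real_sqrt_abs2 real_sqrt_one)
  then show ?thesis using nrm_mult[of "- 1" x] by simp
qed

lemma nrm_diff: "nrm (x - y) \<le> max (nrm x) (nrm y)"
  using nrm_add[of x "- y"] by simp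

lemma nrm_add_le: "nrm x \<le> B \<Longrightarrow> nrm y \<le> B \<Longrightarrow> nrm (x + y) \<le> B"
  and nrm_diff_le: "nrm x \<le> B \<Longrightarrow> nrm y \<le> B \<Longrightarrow> nrm (x - y) \<le> B"
  using nrm_add[of x y] nrm_diff[of x y] by auto

lemma nrm_power: "nrm (x ^ n) = nrm x ^ n"
  by (induction n) (simp_all add: nrm_mult)

lemma nrm_inverse: "nrm (inverse x) = inverse (nrm x)"
proof (cases "x = 0")
  case False
  then have "nrm (inverse x) * nrm x = 1" by (simp flip: nrm_mult)
  then show ?thesis by (metis inverse_unique mult.commute)
qed simp

lemma nrm_divide: "nrm (x / y) = nrm x / nrm y"
  by (simp add: divide_inverse nrm_mult nrm_inverse)

lemma nrm_sum_le: "B \<ge> 0 \<Longrightarrow> (\<And>i. i \<in> I \<Longrightarrow> nrm (f i) \<le> B) \<Longrightarrow> nrm (\<Sum>i\<in>I. f i) \<le> B"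
proof (induction I rule: infinite_finite_induct)
  case (insert i I)
  then show ?case using nrm_add[of "f i" "sum f I"] by fastforce
qed auto

lemma nrm_of_nat_le: "nrm (of_nat n) \<le> 1"
proof (induction n)
  case (Suc n)
  then show ?case using nrm_add[of 1 "of_nat n"] by simp
qed simp

lemma nrm_p: "nrm (of_nat p) = 1 / real p"
proof -
  have "(of_nat p :: 'a) \<noteq> 0" using p_gt_1 by auto
  then show ?thesis using p_gt_1 by (simp add: nrm_v v_p powr_minus_divide)
qed

lemma nrm_of_int_le: "nrm (of_int n) \<le> 1"
  by (cases n rule: int_cases2) (auto simp: nrm_of_nat_le)

lemma nrm_of_nat_coprime:
  assumes "\<not> p dvd n"
  shows "nrm (of_nat n) = 1"
proof (rule ccontr)
  assume "nrm (of_nat n) \<noteq> 1"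
  then have l: "nrm (of_nat n) < 1" using nrm_of_nat_le[of n] by simp
  have "coprime (int n) (int p)"
    using prime_imp_coprime[OF prime_p assms] by (simp add: coprime_commute)
  then obtain a b where "a * int n + b * int p = 1" by (metis coprime_iff_gcd_eq_1 bezout_int)
  then have "of_int a * of_nat n + of_int b * of_nat p = (1 :: 'a)"
    by (metis of_int_1 of_int_add of_int_mult of_int_of_nat_eq)
  moreover have "nrm (of_int a * of_nat n) < 1"
  proof -
    have "nrm (of_int a) * nrm (of_nat n) \<le> 1 * nrm (of_nat n)"
      using nrm_of_int_le[of a] by (rule mult_right_mono) simp
    then show ?thesis using l by (simp add: nrm_mult)
  qed
  moreover have "nrm (of_int b * of_nat p) < 1"
  proof -
    have "nrm (of_int b) * (1 / real p) \<le> 1 * (1 / real p)"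
      using nrm_of_int_le[of b] by (intro mult_right_mono) auto
    then show ?thesis using p_gt_1 by (simp add: nrm_mult nrm_p order_le_less_trans)
  qed
  ultimately show False
    using nrm_add[of "of_int a * of_nat n" "of_int b * of_nat p"] by simp
qed

definition rad :: real where
  "rad = real p powr (- (1 / (real p - 1)))"

lemma rad: "rad > 0" "rad < 1" "rad ^ (p - 1) = 1 / real p"
proof -
  show "rad > 0" using p_gt_1 by (simp add: rad_def)
  show "rad < 1" using p_gt_1 by (simp add: rad_def powr_less_one)
  have "rad ^ (p - 1) = real p powr (- (1 / (real p - 1)) * real (p - 1))"
    using p_gt_1 by (simp add: rad_def powr_powr flip: powr_realpow)
  also have "- (1 / (real p - 1)) * real (p - 1) = -1"
    using p_gt_1 by (simp add: of_nat_diff)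
  finally show "rad ^ (p - 1) = 1 / real p" using p_gt_1 by (simp add: powr_minus_divide)
qed

lemma padic_disc_iff: "x \<in> padic_disc p v \<longleftrightarrow> nrm x < rad"
proof (cases "x = 0")
  case True
  then show ?thesis using rad(1) v_eq_infinity_iff[of 0] by (simp add: padic_disc_def)
next
  case False
  then obtain r where "v x = ereal r" by (metis v_finite)
  then show ?thesis using False p_gt_1 by (simp add: padic_disc_def rad_def nrm_v)
qed

lemma nrm_fact_mult:
  "r < p \<Longrightarrow> nrm (fact (p * q + r)) = (1 / real p) ^ q * nrm (fact q)"
proof (induction q arbitrary: r)
  case 0
  then show ?case
  proof (induction r)
    case (Suc r)
    then have "\<not> p dvd Suc r" by (auto dest: dvd_imp_le)
    then have "nrm (of_nat (Suc r)) = 1" by (rule nrm_of_nat_coprime)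
    with Suc show ?case by (simp only: fact_Suc nrm_mult add_Suc_right) simp
  qed simp
next
  case (Suc q)
  note IH = Suc.IH
  show ?case using Suc.prems
  proof (induction r)
    case 0
    have "p * Suc q = Suc (p * q + (p - 1))" using p_gt_1 by simp
    then have "fact (p * Suc q) = of_nat (p * Suc q) * (fact (p * q + (p - 1)) :: 'a)"
      by (metis fact_Suc)
    then show ?case
      using IH[of "p - 1"] p_gt_1 by (simp only: add_0_right nrm_mult of_nat_mult nrm_p fact_Suc) simp
  next
    case (Suc r)
    have "\<not> p dvd Suc r" using Suc.prems by (auto dest: dvd_imp_le)
    then have "\<not> p dvd p * Suc q + Suc r" by (metis dvd_add_right_iff dvd_triv_left)
    then have "nrm (of_nat (Suc (p * Suc q + r))) = 1" using nrm_of_nat_coprime by (metis add_Suc_right)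
    with Suc show ?case by (simp only: fact_Suc nrm_mult add_Suc_right)
  qed
qed

lemma nrm_fact_ge: "nrm (fact n) \<ge> rad ^ n"
proof (induction n rule: less_induct)
  case (less n)
  show ?case
  proof (cases "n = 0")
    case False
    define q r where "q = n div p" and "r = n mod p"
    have n: "n = p * q + r" "r < p" using p_gt_1 by (auto simp: q_def r_def)
    have "q < n" using False p_gt_1 by (simp add: q_def)
    have "rad ^ n \<le> rad ^ (q * (p - 1) + q)"
    proof (rule power_decreasing)
      have "q * (p - 1) + q = p * q" using p_gt_1 by (simp add: algebra_simps)
      then show "q * (p - 1) + q \<le> n" using n by simp
    qed (use rad(1,2) in auto)
    also have "\<dots> = (1 / real p) ^ q * rad ^ q"
    proof -
      have "rad ^ (q * (p - 1)) = (rad ^ (p - 1)) ^ q" by (metis mult.commute power_mult)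
      then show ?thesis by (simp only: power_add rad(3))
    qed
    also have "\<dots> \<le> (1 / real p) ^ q * nrm (fact q)"
      using less.IH[OF \<open>q < n\<close>] p_gt_1 by (intro mult_left_mono) auto
    also have "\<dots> = nrm (fact n)" using nrm_fact_mult[OF n(2)] n(1) by simp
    finally show ?thesis .
  qed simp
qed

lemma nrm_exp_term: "nrm (x ^ j / fact j) \<le> (nrm x / rad) ^ j"
proof -
  have "nrm (x ^ j / fact j) = nrm x ^ j / nrm (fact j)" by (simp add: nrm_divide nrm_power)
  also have "\<dots> \<le> nrm x ^ j / rad ^ j"
    using nrm_fact_ge[of j] rad(1) by (intro divide_left_mono mult_pos_pos) (auto intro: nrm_gt_0)
  finally show ?thesis by (simp add: power_divide)
qed

lemma nrm_LIMSEQ_le: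
  assumes "X \<longlonglongrightarrow> a" "\<And>n. n \<ge> N \<Longrightarrow> nrm (X n - b) \<le> B"
  shows "nrm (a - b) \<le> B"
proof -
  have "(\<lambda>n. dist (X n) b) \<longlonglongrightarrow> dist a b" by (intro tendsto_dist assms(1) tendsto_const)
  then have "dist a b \<le> B"
    by (rule LIMSEQ_le_const2) (use assms(2) in \<open>auto simp: dist_nrm\<close>)
  then show ?thesis by (simp add: dist_nrm)
qed

lemma nrm_small_eq:
  assumes "\<And>e. e > 0 \<Longrightarrow> nrm (a - b) \<le> e"
  shows "a = b"
  using assms[of "nrm (a - b) / 2"] nrm_gt_0[of "a - b"] by (cases "a = b") auto

definition exp_sum :: "nat \<Rightarrow> 'a \<Rightarrow> 'a" where
  "exp_sum N x = (\<Sum>j<N. x ^ j / fact j)"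

lemma exp_sum_tail:
  assumes "nrm x < rad" "N \<le> M"
  shows "nrm (exp_sum M x - exp_sum N x) \<le> (nrm x / rad) ^ N"
proof -
  have "exp_sum M x - exp_sum N x = (\<Sum>j\<in>{N..<M}. x ^ j / fact j)"
    using assms(2) unfolding exp_sum_def by (simp add: lessThan_atLeast0 sum_diff_nat_ivl)
  also have "nrm \<dots> \<le> (nrm x / rad) ^ N"
  proof (rule nrm_sum_le)
    fix j assume "j \<in> {N..<M}"
    then have "(nrm x / rad) ^ j \<le> (nrm x / rad) ^ N"
      using assms(1) rad(1) by (intro power_decreasing) (auto simp: divide_le_eq)
    then show "nrm (x ^ j / fact j) \<le> (nrm x / rad) ^ N" using nrm_exp_term[of x j] by simp
  qed (use rad(1) in simp)
  finally show ?thesis .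
qed

lemma exp_sum_LIMSEQ:
  assumes x: "nrm x < rad"
  shows "(\<lambda>N. exp_sum N x) \<longlonglongrightarrow> padic_exp x"
proof -
  have q: "0 \<le> nrm x / rad" "nrm x / rad < 1" using x rad(1) by auto
  have "Cauchy (\<lambda>N. exp_sum N x)"
  proof (rule metric_CauchyI)
    fix e :: real assume e: "e > 0"
    obtain N where N: "(nrm x / rad) ^ N < e" using real_arch_pow_inv[OF e q(2)] by blast
    have "dist (exp_sum m x) (exp_sum n x) < e" if mn: "m \<ge> N" "n \<ge> N" for m n
    proof -
      have "exp_sum m x - exp_sum n x = (exp_sum m x - exp_sum N x) - (exp_sum n x - exp_sum N x)" by simp
      then have "nrm (exp_sum m x - exp_sum n x) \<le> max (nrm (exp_sum m x - exp_sum N x)) (nrm (exp_sum n x - exp_sum N x))"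
        by (metis nrm_diff)
      then show ?thesis
        using exp_sum_tail[OF x mn(1)] exp_sum_tail[OF x mn(2)] N by (simp add: dist_nrm)
    qed
    then show "\<exists>M. \<forall>m\<ge>M. \<forall>n\<ge>M. dist (exp_sum m x) (exp_sum n x) < e" by blast
  qed
  then have "convergent (\<lambda>N. exp_sum N x)" by (rule Cauchy_convergent)
  then obtain L where L: "(\<lambda>N. exp_sum N x) \<longlonglongrightarrow> L" by (auto simp: convergent_def)
  then have "(\<lambda>j. x ^ j / fact j) sums L" by (simp add: sums_def exp_sum_def)
  then have "padic_exp x = L" by (simp add: padic_exp_def sums_iff)
  with L show ?thesis by simp
qed

lemma exp_tail:
  assumes "nrm x < rad"
  shows "nrm (padic_exp x - exp_sum N x) \<le> (nrm x / rad) ^ N"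
  using exp_sum_LIMSEQ[OF assms] exp_sum_tail[OF assms] by (rule nrm_LIMSEQ_le[where N = N])

lemma nrm_exp: "nrm x < rad \<Longrightarrow> nrm (padic_exp x) \<le> 1"
  using exp_tail[of x 0] by (simp add: exp_sum_def)

lemma exp_sum_nrm_le: "nrm x < rad \<Longrightarrow> nrm (exp_sum N x) \<le> 1"
  using exp_sum_tail[of x 0 N] by (simp add: exp_sum_def)

lemma padic_exp_0 [simp]: "padic_exp (0 :: 'a) = 1"
proof (rule nrm_small_eq)
  fix e :: real assume "e > 0"
  then show "nrm (padic_exp (0 :: 'a) - 1) \<le> e"
    using exp_tail[of 0 1] rad(1) by (simp add: exp_sum_def)
qed

lemma padic_exp_add:
  assumes x: "nrm x < rad" and y: "nrm y < rad"
  shows "padic_exp (x + y) = padic_exp x * padic_exp y"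
proof (rule nrm_small_eq)
  fix e :: real assume e: "e > 0"
  define q where "q = max (nrm x) (nrm y) / rad"
  have q: "0 \<le> q" "q < 1" "nrm x / rad \<le> q" "nrm y / rad \<le> q" "nrm (x + y) / rad \<le> q"
    using x y rad(1) nrm_add[of x y] by (auto simp: q_def divide_right_mono le_max_iff_disj)
  have xy: "nrm (x + y) < rad" using nrm_add[of x y] x y by linarith
  obtain N where N: "q ^ N < e" using real_arch_pow_inv[OF e q(2)] by blast
  have tail: "nrm (padic_exp z - exp_sum N z) \<le> q ^ N" if "nrm z < rad" "nrm z / rad \<le> q" for z
    using exp_tail[OF that(1), of N] power_mono[OF that(2), of N] rad(1) by simp
  define S where "S = {..<N} \<times> {..<N}"
  define f where "f = (\<lambda>(i, j). x ^ i / fact i * (y ^ j / fact j))"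
  have fS: "finite S" by (simp add: S_def)
  have "exp_sum N x * exp_sum N y = (\<Sum>ij\<in>S. f ij)"
    unfolding exp_sum_def sum_product S_def f_def by (rule sum.cartesian_product)
  moreover have "exp_sum N (x + y) = (\<Sum>ij\<in>{(i, j). i + j < N}. f ij)"
  proof -
    have "(x + y) ^ n / fact n = (\<Sum>i\<le>n. x ^ i / fact i * (y ^ (n - i) / fact (n - i)))" for n
      unfolding binomial_ring sum_divide_distrib
      by (intro sum.cong refl) (simp add: binomial_fact field_simps)
    then have "exp_sum N (x + y) = (\<Sum>n<N. \<Sum>i\<le>n. f (i, n - i))" by (simp add: exp_sum_def f_def)
    also have "\<dots> = (\<Sum>ij\<in>{(i, j). i + j < N}. f ij)" using sum.triangle_reindex[of "\<lambda>i j. f (i, j)" N] by simp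
    finally show ?thesis .
  qed
  moreover have "{(i, j). i + j < N} \<subseteq> S" by (auto simp: S_def)
  ultimately have "exp_sum N x * exp_sum N y - exp_sum N (x + y) = (\<Sum>ij\<in>S - {(i, j). i + j < N}. f ij)"
    using fS by (simp add: sum_diff)
  also have "nrm \<dots> \<le> q ^ N"
  proof (rule nrm_sum_le)
    fix ij assume "ij \<in> S - {(i, j). i + j < N}"
    then obtain i j where ij: "ij = (i, j)" "N \<le> i + j" by (cases ij) auto
    have "nrm (f ij) = nrm (x ^ i / fact i) * nrm (y ^ j / fact j)" by (simp only: ij f_def prod.case nrm_mult)
    also have "\<dots> \<le> q ^ i * q ^ j"
      using nrm_exp_term[of x i] nrm_exp_term[of y j] power_mono[OF q(3), of i] power_mono[OF q(4), of j] rad(1) q(1)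
      by (intro mult_mono) auto
    also have "\<dots> \<le> q ^ N" using q ij(2) by (simp add: power_decreasing flip: power_add)
    finally show "nrm (f ij) \<le> q ^ N" .
  qed (use q in simp)
  finally have 1: "nrm (exp_sum N x * exp_sum N y - exp_sum N (x + y)) \<le> q ^ N" .
  have 2: "nrm ((padic_exp x - exp_sum N x) * padic_exp y) \<le> q ^ N"
    using tail[OF x q(3)] nrm_exp[OF y] mult_mono[of _ "q ^ N" _ 1] by (simp add: nrm_mult q(1))
  have 3: "nrm (exp_sum N x * (padic_exp y - exp_sum N y)) \<le> q ^ N"
    using tail[OF y q(4)] exp_sum_nrm_le[OF x, of N] mult_mono[of _ 1 _ "q ^ N"] by (simp add: nrm_mult q(1))
  have "padic_exp (x + y) - padic_exp x * padic_exp y =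
     ((padic_exp (x + y) - exp_sum N (x + y)) - (exp_sum N x * exp_sum N y - exp_sum N (x + y)))
     - ((padic_exp x - exp_sum N x) * padic_exp y + exp_sum N x * (padic_exp y - exp_sum N y))"
    by (simp add: algebra_simps)
  also have "nrm \<dots> \<le> q ^ N"
    by (intro nrm_diff_le nrm_add_le 1 2 3 tail[OF xy q(5)])
  finally show "nrm (padic_exp (x + y) - padic_exp x * padic_exp y) \<le> e" using N by simp
qed

lemma padic_exp_minus: "nrm x < rad \<Longrightarrow> padic_exp x * padic_exp (- x) = 1"
  using padic_exp_add[of x "- x"] by simp

lemma padic_exp_nonzero: "nrm x < rad \<Longrightarrow> padic_exp x \<noteq> 0"
  using padic_exp_minus[of x] by auto

lemma exp_quadratic:
  assumes h: "nrm h < rad" "nrm h \<le> 1 / real p ^ 2"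
  shows "nrm (padic_exp h - 1 - h) \<le> real p ^ 2 * nrm h ^ 2"
proof -
  have "nrm (exp_sum N h - (1 + h)) \<le> real p ^ 2 * nrm h ^ 2" if N: "N \<ge> 2" for N
  proof -
    have "exp_sum N h - (1 + h) = exp_sum N h - exp_sum 2 h" by (simp add: exp_sum_def numeral_2_eq_2)
    also have "\<dots> = (\<Sum>j\<in>{2..<N}. h ^ j / fact j)"
      using N unfolding exp_sum_def by (simp add: lessThan_atLeast0 sum_diff_nat_ivl)
    also have "nrm \<dots> \<le> real p ^ 2 * nrm h ^ 2"
    proof (rule nrm_sum_le)
      fix j assume "j \<in> {2..<N}"
      then obtain i where j: "j = i + 2" by (metis add.commute atLeastLessThan_iff le_Suc_ex)
      have r: "1 / real p \<le> rad"
      proof -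
        have "rad ^ (p - 1) \<le> rad ^ 1" using rad(1,2) p_gt_1 by (intro power_decreasing) auto
        then show ?thesis unfolding rad(3) by simp
      qed
      have "nrm (h ^ j / fact j) \<le> (nrm h / rad) ^ j" by (rule nrm_exp_term)
      also have "\<dots> \<le> (nrm h * real p) ^ j"
      proof (rule power_mono)
        have "1 / rad \<le> real p" using r rad(1) p_gt_1 by (simp add: field_simps)
        then have "nrm h * (1 / rad) \<le> nrm h * real p" by (rule mult_left_mono) simp
        then show "nrm h / rad \<le> nrm h * real p" by simp
      qed (use rad(1) in simp)
      also have "\<dots> = real p ^ 2 * nrm h ^ 2 * (nrm h * real p) ^ i"
        unfolding j power_add power_mult_distrib by (simp only: mult_ac)
      also have "\<dots> \<le> real p ^ 2 * nrm h ^ 2 * 1"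
      proof (intro mult_left_mono power_le_one)
        have "nrm h * real p \<le> 1 / real p ^ 2 * real p" using h(2) by (rule mult_right_mono) simp
        also have "\<dots> = 1 / real p" using p_gt_1 by (simp add: power2_eq_square)
        also have "\<dots> \<le> 1" using p_gt_1 by simp
        finally show "nrm h * real p \<le> 1" .
      qed auto
      finally show "nrm (h ^ j / fact j) \<le> real p ^ 2 * nrm h ^ 2" by simp
    qed simp
    finally show ?thesis .
  qed
  then have "nrm (padic_exp h - (1 + h)) \<le> real p ^ 2 * nrm h ^ 2"
    by (rule nrm_LIMSEQ_le[OF exp_sum_LIMSEQ[OF h(1)], where N = 2 and b = "1 + h"])
  then show ?thesis by (simp add: algebra_simps)
qed

end

section \<open>Isolated solutions of exponential systems\<close>

global_interpretation fun_space: vector_space "\<lambda>(a::'a::field) (f::'b \<Rightarrow> 'a) x. a * f x"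
  by unfold_locales (auto simp: algebra_simps)

lemma sum_fun_apply: "(\<Sum>i\<in>I. f i) x = (\<Sum>i\<in>I. f i x)"
  by (induction I rule: infinite_finite_induct) auto

lemma fun_space_dual:
  fixes V :: "(nat \<Rightarrow> 'a::field) set"
  assumes supp: "\<And>x j. x \<in> V \<Longrightarrow> j \<ge> n \<Longrightarrow> x j = 0"
    and sep: "\<And>u. (\<And>x. x \<in> V \<Longrightarrow> (\<Sum>j<n. u j * x j) = 0) \<Longrightarrow> \<forall>j<n. u j = 0"
    and i: "i < n"
  shows "\<exists>F c. finite F \<and> F \<subseteq> V \<and> (\<forall>j<n. (\<Sum>x\<in>F. c x * x j) = (if j = i then 1 else 0))"
proof -
  have "vector_space ((*) :: 'a \<Rightarrow> 'a \<Rightarrow> 'a)"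
    by unfold_locales (simp_all add: distrib_left distrib_right mult.assoc)
  then interpret vp: vector_space_pair "\<lambda>a f x. a * f x :: 'a" "(*) :: 'a \<Rightarrow> 'a \<Rightarrow> 'a"
    by (rule vector_space_pair.intro[OF fun_space.vector_space_axioms])
  define e :: "nat \<Rightarrow> nat \<Rightarrow> 'a" where "e i = (\<lambda>j. if j = i then 1 else 0)" for i
  have "e i \<in> fun_space.span V"
  proof (rule ccontr)
    assume ni: "e i \<notin> fun_space.span V"
    obtain B where B: "B \<subseteq> V" "fun_space.independent B" "V \<subseteq> fun_space.span B"
      by (rule fun_space.maximal_independent_subset[of V])
    have "e i \<notin> fun_space.span B" using fun_space.span_mono[OF B(1)] ni by (rule contra_subsetD)
    then have ind: "fun_space.independent (insert (e i) B)"
      using B(2) by (rule fun_space.independent_insertI)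
    define f :: "(nat \<Rightarrow> 'a) \<Rightarrow> 'a" where "f x = (if x = e i then 1 else 0)" for x
    obtain g where lin: "Vector_Spaces.linear (\<lambda>a f x. a * f x) (*) g" and gf: "\<forall>x\<in>insert (e i) B. g x = f x"
      using vp.linear_independent_extend[OF ind, of f] by blast
    interpret g: Vector_Spaces.linear "\<lambda>a f x. a * f x :: 'a" "(*) :: 'a \<Rightarrow> 'a \<Rightarrow> 'a" g by (rule lin)
    have gB: "g x = 0" if "x \<in> B" for x
    proof -
      have "x \<noteq> e i"
      proof
        assume "x = e i"
        then show False using fun_space.span_base[OF that] \<open>e i \<notin> fun_space.span B\<close> by simp
      qed
      then show ?thesis using bspec[OF gf insertI2[OF that]] by (simp add: f_def)
    qed
    have gV: "g x = 0" if "x \<in> V" for x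
      using gB subsetD[OF B(3) that] by (rule g.eq_0_on_span)
    have "(\<Sum>j<n. g (e j) * x j) = 0" if x: "x \<in> V" for x
    proof -
      have xeq: "x = (\<Sum>j<n. (\<lambda>k. x j * e j k))"
      proof
        fix k
        have "(\<Sum>j<n. x j * e j k) = (\<Sum>j<n. if j = k then x j else 0)"
          by (rule sum.cong) (simp_all add: e_def)
        also have "\<dots> = x k" using supp[OF x, of k] by (cases "k < n") simp_all
        finally show "x k = (\<Sum>j<n. (\<lambda>k. x j * e j k)) k" unfolding sum_fun_apply ..
      qed
      have "g x = g (\<Sum>j<n. (\<lambda>k. x j * e j k))" by (rule arg_cong[OF xeq])
      also have "\<dots> = (\<Sum>j<n. g (\<lambda>k. x j * e j k))" by (rule g.sum)
      also have "\<dots> = (\<Sum>j<n. x j * g (e j))" by (simp add: g.scale)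
      finally show ?thesis using gV[OF x] by (simp add: mult.commute)
    qed
    then have "\<forall>j<n. g (e j) = 0" by (rule sep)
    then have "g (e i) = 0" using i by simp
    moreover have "g (e i) = 1" using bspec[OF gf insertI1] by (simp add: f_def)
    ultimately show False by simp
  qed
  then obtain F c where F: "finite F" "F \<subseteq> V" "e i = (\<Sum>a\<in>F. (\<lambda>x. c a * a x))"
    unfolding fun_space.span_explicit by blast
  have "(\<Sum>x\<in>F. c x * x j) = (if j = i then 1 else 0)" for j
    using fun_cong[OF F(3), of j] by (simp add: sum_fun_apply e_def)
  then show ?thesis using F(1,2) by blast
qed

datatype 'c pexp = PConst 'c | PX nat | PY nat | PAdd "'c pexp" "'c pexp" | PMult "'c pexp" "'c pexp"

primrec peval :: "('c \<Rightarrow> 'b::comm_ring_1) \<Rightarrow> (nat \<Rightarrow> 'b) \<Rightarrow> (nat \<Rightarrow> 'b) \<Rightarrow> 'c pexp \<Rightarrow> 'b" where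
  "peval \<kappa> x y (PConst c) = \<kappa> c"
| "peval \<kappa> x y (PX i) = x i"
| "peval \<kappa> x y (PY i) = y i"
| "peval \<kappa> x y (PAdd E F) = peval \<kappa> x y E + peval \<kappa> x y F"
| "peval \<kappa> x y (PMult E F) = peval \<kappa> x y E * peval \<kappa> x y F"

instance pexp :: (countable) countable by countable_datatype

text \<open>\<open>Solve n Es qs m i\<close> stands for the \<open>i\<close>-th coordinate of the unique solution of the system
  \<open>Es\<close> in \<open>n\<close> unknowns near the point with code \<open>qs\<close>.\<close>

datatype cterm = CZero | COne | CAdd cterm cterm | CMult cterm cterm | CNeg cterm | CInv cterm
  | Solve nat "cterm pexp list" "nat list" nat nat

instance cterm :: countable by countable_datatype

primrec ceval :: "(nat \<Rightarrow> 'a pexp list \<Rightarrow> nat list \<Rightarrow> nat \<Rightarrow> nat \<Rightarrow> 'a::field) \<Rightarrow> cterm \<Rightarrow> 'a" where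
  "ceval sol CZero = 0"
| "ceval sol COne = 1"
| "ceval sol (CAdd a b) = ceval sol a + ceval sol b"
| "ceval sol (CMult a b) = ceval sol a * ceval sol b"
| "ceval sol (CNeg a) = - ceval sol a"
| "ceval sol (CInv a) = inverse (ceval sol a)"
| "ceval sol (Solve n Es qs m i) = sol n (map (map_pexp (ceval sol)) Es) qs m i"

lemma countable_closure:
  fixes sol :: "nat \<Rightarrow> 'a pexp list \<Rightarrow> nat list \<Rightarrow> nat \<Rightarrow> nat \<Rightarrow> 'a::field"
  shows "\<exists>C. is_subfield C \<and> countable C \<and>
    (\<forall>n Es qs m i. (\<forall>E\<in>set Es. set_pexp E \<subseteq> C) \<longrightarrow> sol n Es qs m i \<in> C)"
proof -
  define C where "C = range (ceval sol)"
  have i: "ceval sol a = x \<Longrightarrow> x \<in> C" for a x by (auto simp: C_def)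
  have "is_subfield C"
    unfolding is_subfield_def
  proof (intro conjI ballI)
    show "0 \<in> C" "1 \<in> C" using i[of CZero] i[of COne] by simp_all
    fix x assume "x \<in> C"
    then obtain a where a: "x = ceval sol a" by (auto simp: C_def)
    show "- x \<in> C" "inverse x \<in> C" using i[of "CNeg a"] i[of "CInv a"] a by simp_all
    fix y assume "y \<in> C"
    then obtain b where b: "y = ceval sol b" by (auto simp: C_def)
    show "x + y \<in> C" "x * y \<in> C" using i[of "CAdd a b"] i[of "CMult a b"] a b by simp_all
  qed
  moreover have "countable C" by (simp add: C_def)
  moreover have "sol n Es qs m j \<in> C" if Es: "\<forall>E\<in>set Es. set_pexp E \<subseteq> C" for n Es qs m j
  proof -
    define code where "code = inv_into UNIV (ceval sol)"
    have "map_pexp (ceval sol) (map_pexp code E) = E" if "E \<in> set Es" for E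
    proof -
      have "ceval sol (code c) = c" if "c \<in> set_pexp E" for c
        using Es \<open>E \<in> set Es\<close> that unfolding code_def C_def by (intro f_inv_into_f) blast
      then show ?thesis by (simp add: pexp.map_comp pexp.map_ident_strong)
    qed
    then have "map (map_pexp (ceval sol)) (map (map_pexp code) Es) = Es"
      by (simp add: map_idI)
    then show ?thesis using i[of "Solve n (map (map_pexp code) Es) qs m j"] by simp
  qed
  ultimately show ?thesis by blast
qed

definition tangent :: "(nat \<Rightarrow> 'a::field) \<Rightarrow> (nat \<Rightarrow> 'a) \<Rightarrow> 'a pexp \<Rightarrow> (nat \<Rightarrow> 'a) \<Rightarrow> 'a" where
  "tangent x y E u =
     dual_ep (peval (\<lambda>c. Dual c 0) (\<lambda>i. Dual (x i) (u i)) (\<lambda>i. Dual (y i) (y i * u i)) E)"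

lemma dual_re_peval:
  "dual_re (peval (\<lambda>c. Dual c 0) (\<lambda>i. Dual (x i) (u i)) (\<lambda>i. Dual (y i) (y i * u i)) E)
    = peval (\<lambda>c. c) x y E"
  by (induction E) simp_all

lemma tangent_simps [simp]:
  "tangent x y (PConst c) u = 0" "tangent x y (PX i) u = u i" "tangent x y (PY i) u = y i * u i"
  "tangent x y (PAdd E F) u = tangent x y E u + tangent x y F u"
  "tangent x y (PMult E F) u =
     peval (\<lambda>c. c) x y E * tangent x y F u + tangent x y E u * peval (\<lambda>c. c) x y F"
  by (simp_all add: tangent_def dual_re_peval)

lemma tangent_linear:
  assumes "\<And>i. i \<ge> n \<Longrightarrow> u i = 0"
  shows "tangent x y E u = (\<Sum>j<n. u j * tangent x y E (\<lambda>i. if i = j then 1 else 0))"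
proof (induction E)
  case (PX i)
  then show ?case using assms[of i] by (cases "i < n") (auto simp: if_distrib[of "\<lambda>y. _ * y"] cong: if_cong)
next
  case (PY i)
  have "(\<Sum>j<n. u j * (y i * (if i = j then 1 else 0))) = (\<Sum>j<n. if i = j then u j * y i else 0)"
    by (intro sum.cong) auto
  then show ?case using assms[of i] by (cases "i < n") (auto simp: mult.commute)
qed (simp_all add: algebra_simps sum.distrib sum_distrib_left)

lemma tangent_derivation:
  fixes x y :: "nat \<Rightarrow> 'a::field_char_0"
  assumes C: "is_subfield C"
    and u: "\<And>E. set_pexp E \<subseteq> C \<Longrightarrow> peval (\<lambda>c. c) x y E = 0 \<Longrightarrow> tangent x y E u = 0"
  shows "\<exists>d\<in>Der C. \<forall>i. d (x i) = u i \<and> d (y i) = y i * u i"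
proof -
  define ev where "ev = peval (\<lambda>c. Dual c 0) (\<lambda>i. Dual (x i) (u i)) (\<lambda>i. Dual (y i) (y i * u i))"
  define G where "G = ev ` {E. set_pexp E \<subseteq> C}"
  have inG: "ev E = a \<Longrightarrow> set_pexp E \<subseteq> C \<Longrightarrow> a \<in> G" for E a by (auto simp: G_def)
  have "functional_subring G"
    unfolding functional_subring_def
  proof (intro conjI ballI impI)
    show "0 \<in> G" "1 \<in> G"
      using inG[of "PConst 0" 0] inG[of "PConst 1" 1] is_subfieldD(1,2)[OF C]
      by (simp_all add: ev_def zero_dual_def one_dual_def)
    fix a assume "a \<in> G"
    then obtain E where E: "a = ev E" "set_pexp E \<subseteq> C" by (auto simp: G_def)
    show "- a \<in> G"
    proof (rule inG)
      show "ev (PMult (PConst (- 1)) E) = - a"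
        unfolding E(1) ev_def by (simp add: dual_eq_iff)
      show "set_pexp (PMult (PConst (- 1)) E) \<subseteq> C"
        using E(2) is_subfieldD(5)[OF C is_subfieldD(2)[OF C]] by simp
    qed
    show "a = 0" if "dual_re a = 0"
      using u[of E] E that by (simp add: ev_def dual_eq_iff dual_re_peval tangent_def)
    fix b assume "b \<in> G"
    then obtain F where F: "b = ev F" "set_pexp F \<subseteq> C" by (auto simp: G_def)
    show "a + b \<in> G" "a * b \<in> G"
      using inG[of "PAdd E F"] inG[of "PMult E F"] E F by (simp_all add: ev_def)
  qed
  then obtain d where d: "derivation d" "\<forall>a\<in>G. d (dual_re a) = dual_ep a"
    using derivation_extension by blast
  have "d c = 0" if "c \<in> C" for c
    using d(2) inG[of "PConst c" "Dual c 0"] that by (force simp: ev_def)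
  moreover have "d (x i) = u i" for i
    using d(2) inG[of "PX i" "Dual (x i) (u i)"] by (force simp: ev_def)
  moreover have "d (y i) = y i * u i" for i
    using d(2) inG[of "PY i" "Dual (y i) (y i * u i)"] by (force simp: ev_def)
  ultimately show ?thesis using d(1) by (auto simp: Der_def)
qed

text \<open>The linear system that is dual to the tangent space is solvable exactly because no
  derivation moves the point.\<close>

lemma tangent_left_inverse:
  fixes x y :: "nat \<Rightarrow> 'a::field_char_0"
  assumes C: "is_subfield C"
    and rigid: "\<And>d. d \<in> Der C \<Longrightarrow> (\<And>i. i < n \<Longrightarrow> d (y i) = y i * d (x i)) \<Longrightarrow> \<forall>i<n. d (x i) = 0"
    and i: "i < n"
  shows "\<exists>F c. finite F \<and> F \<subseteq> {E. set_pexp E \<subseteq> C \<and> peval (\<lambda>c. c) x y E = 0} \<and>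
    (\<forall>u. (\<forall>j\<ge>n. u j = 0) \<longrightarrow> u i = (\<Sum>E\<in>F. c E * tangent x y E u))"
proof -
  define I where "I = {E. set_pexp E \<subseteq> C \<and> peval (\<lambda>c. c) x y E = 0}"
  define J where "J E = (\<lambda>j. if j < n then tangent x y E (\<lambda>i. if i = j then 1 else 0) else 0)" for E
  have tan: "tangent x y E u = (\<Sum>j<n. u j * J E j)" if "\<forall>j\<ge>n. u j = 0" for E u
    using tangent_linear[of n u x y E] that by (simp add: J_def)
  have "\<exists>F c. finite F \<and> F \<subseteq> J ` I \<and> (\<forall>j<n. (\<Sum>a\<in>F. c a * a j) = (if j = i then 1 else 0))"
  proof (rule fun_space_dual)
    show "a j = 0" if "a \<in> J ` I" "j \<ge> n" for a j using that by (auto simp: J_def)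
    show "i < n" by fact
    fix u assume u: "\<And>a. a \<in> J ` I \<Longrightarrow> (\<Sum>j<n. u j * a j) = 0"
    define u' where "u' j = (if j < n then u j else 0)" for j
    have "tangent x y E u' = 0" if "E \<in> I" for E
      using tan[of u' E] u[of "J E"] that by (simp add: u'_def)
    then obtain d where d: "d \<in> Der C" "\<And>i. d (x i) = u' i \<and> d (y i) = y i * u' i"
      using tangent_derivation[OF C, of x y u'] by (auto simp: I_def)
    then have "\<forall>i<n. d (x i) = 0" by (intro rigid) auto
    then show "\<forall>j<n. u j = 0" using d(2) by (auto simp: u'_def)
  qed
  then obtain F c where F: "finite F" "F \<subseteq> J ` I"
    "\<And>j. j < n \<Longrightarrow> (\<Sum>a\<in>F. c a * a j) = (if j = i then 1 else 0)" by blast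
  obtain F' where F': "F' \<subseteq> I" "inj_on J F'" "F = J ` F'"
    using F(2) unfolding subset_image_inj by blast
  then have "finite F'" using F(1) finite_imageD by blast
  have "u i = (\<Sum>E\<in>F'. c (J E) * tangent x y E u)" if u: "\<forall>j\<ge>n. u j = 0" for u
  proof -
    have "(\<Sum>E\<in>F'. c (J E) * tangent x y E u) = (\<Sum>a\<in>F. c a * (\<Sum>j<n. u j * a j))"
      by (simp add: F'(3) sum.reindex[OF F'(2)] tan[OF u])
    also have "\<dots> = (\<Sum>a\<in>F. \<Sum>j<n. u j * (c a * a j))"
      by (simp add: sum_distrib_left mult.left_commute)
    also have "\<dots> = (\<Sum>j<n. u j * (\<Sum>a\<in>F. c a * a j))"
      by (subst sum.swap) (simp add: sum_distrib_left)
    also have "\<dots> = (\<Sum>j<n. u j * (if j = i then 1 else 0))"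
      using F(3) by (intro sum.cong) auto
    also have "\<dots> = u i" using i by (simp add: if_distrib[of "\<lambda>y. _ * y"] cong: if_cong)
    finally show ?thesis ..
  qed
  then show ?thesis
    using F'(1) \<open>finite F'\<close> unfolding I_def by (intro exI[of _ F'] exI[of _ "\<lambda>E. c (J E)"]) auto
qed

lemma split_over_closed_subfield:
  fixes P :: "'a::field_char_0 poly"
  assumes L: "is_subfield L" and root: "\<And>q. q \<in> polys_over L \<Longrightarrow> degree q > 0 \<Longrightarrow> \<exists>x\<in>L. poly q x = 0"
    and "P \<in> polys_over L" "P \<noteq> 0"
  shows "\<exists>r. \<forall>x. poly P x = lead_coeff P * (\<Prod>i<degree P. x - r i)"
  using assms(3,4)
proof (induction "degree P" arbitrary: P)
  case 0
  then obtain c where "P = [:c:]" by (metis degree_eq_zeroE)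
  then show ?case by simp
next
  case (Suc N)
  then obtain a where a: "a \<in> L" "poly P a = 0" using root[of P] by auto
  have lin: "[:- a, 1:] \<in> polys_over L"
    using a is_subfieldD[OF L] by (auto simp: polys_over_def coeff_pCons split: nat.split)
  obtain Q s where Q: "Q \<in> polys_over L" "P = Q * [:- a, 1:] + s" "s = 0 \<or> degree s < degree [:- a, 1:]"
    using polys_over_division[OF L lin _ Suc.prems(1)] by fastforce
  obtain c where c: "s = [:c:]" using Q(3) degree_eq_zeroE[of s] by fastforce
  have "c = 0" using a(2) by (simp add: Q(2) c)
  then have P: "P = Q * [:- a, 1:]" using Q(2) c by simp
  have Q0: "Q \<noteq> 0" using P Suc.prems(2) by auto
  have dP: "degree P = Suc (degree Q)"
    unfolding P using Q0 by (simp add: degree_mult_eq del: mult_pCons_right)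
  have lP: "lead_coeff P = lead_coeff Q"
    unfolding P by (subst lead_coeff_mult) simp
  have "N = degree Q" using Suc.hyps(2) dP by simp
  then obtain r where r: "\<And>x. poly Q x = lead_coeff Q * (\<Prod>i<degree Q. x - r i)"
    using Suc.hyps(1)[OF _ Q(1) Q0] by blast
  define r' where "r' i = (if i = degree Q then a else r i)" for i
  have "poly P x = lead_coeff P * (\<Prod>i<degree P. x - r' i)" for x
  proof -
    have "(\<Prod>i<degree Q. x - r' i) = (\<Prod>i<degree Q. x - r i)"
      by (rule prod.cong) (simp_all add: r'_def)
    then have "(\<Prod>i<degree P. x - r' i) = (\<Prod>i<degree Q. x - r i) * (x - a)"
      unfolding dP by (simp add: r'_def)
    moreover have "poly P x = poly Q x * (x - a)" by (simp add: P algebra_simps)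
    ultimately show ?thesis unfolding lP r by simp
  qed
  then show ?case by blast
qed

lemma countable_rational_roots:
  "countable {x::'a::field_char_0. \<exists>P. P \<noteq> 0 \<and> (\<forall>i. coeff P i \<in> \<rat>) \<and> poly P x = 0}"
proof -
  define f where "f l = Poly (map of_rat l :: 'a list)" for l
  have "{x::'a. \<exists>P. P \<noteq> 0 \<and> (\<forall>i. coeff P i \<in> \<rat>) \<and> poly P x = 0} \<subseteq>
      (\<Union>l\<in>{l. f l \<noteq> 0}. {x. poly (f l) x = 0})"
  proof safe
    fix x :: 'a and P assume P: "P \<noteq> 0" "\<forall>i. coeff P i \<in> \<rat>" "poly P x = 0"
    define inv_rat where "inv_rat c = (SOME q. of_rat q = (c :: 'a))" for c
    have ir: "of_rat (inv_rat c) = c" if "c \<in> \<rat>" for c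
      using that unfolding inv_rat_def Rats_def by (auto intro: someI_ex)
    have "map of_rat (map inv_rat (coeffs P)) = coeffs P"
      unfolding map_map by (rule map_idI) (use P(2) ir in \<open>auto simp: coeffs_def split: if_splits\<close>)
    then have "f (map inv_rat (coeffs P)) = P" by (simp add: f_def)
    then show "x \<in> (\<Union>l\<in>{l. f l \<noteq> 0}. {x. poly (f l) x = 0})"
      using P by (intro UN_I[of "map inv_rat (coeffs P)"]) simp_all
  qed
  moreover have "countable (\<Union>l\<in>{l. f l \<noteq> 0}. {x. poly (f l) x = 0})"
    by (rule countable_UN) (auto intro: countable_finite poly_roots_finite)
  ultimately show ?thesis by (rule countable_subset)
qed

context padic_complex_field
begin

lemma nrm_prod: "nrm (\<Prod>i\<in>I. f i) = (\<Prod>i\<in>I. nrm (f i))"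
  by (induction I rule: infinite_finite_induct) (simp_all add: nrm_mult)

lemma rational_root_near:
  fixes y :: 'a and L :: "'a set"
  assumes y: "algebraic_over (closure \<rat>) y" and e: "e > 0"
    and L: "is_subfield L" "\<rat> \<subseteq> L"
    and root: "\<And>q. q \<in> polys_over L \<Longrightarrow> degree q > 0 \<Longrightarrow> \<exists>x\<in>L. poly q x = 0"
  shows "\<exists>x P. P \<noteq> 0 \<and> (\<forall>i. coeff P i \<in> \<rat>) \<and> poly P x = 0 \<and> nrm (y - x) < e"
proof -
  obtain q where q: "q \<noteq> 0" "\<And>k. coeff q k \<in> closure \<rat>" "poly q y = 0"
    using y unfolding algebraic_over_def by blast
  define d where "d = degree q"
  define l where "l = nrm (lead_coeff q)"
  define B where "B = (\<Sum>i\<le>d. nrm y ^ i) + 1"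
  have l: "l > 0" using q(1) by (simp add: l_def nrm_gt_0)
  have B: "B > 0" by (simp add: B_def sum_nonneg add_nonneg_pos)
  define \<eta> where "\<eta> = min (l / 2) (l * e ^ d / (2 * B))"
  have \<eta>: "\<eta> > 0" "\<eta> < l" "\<eta> * B < l * e ^ d"
  proof -
    show "\<eta> > 0" "\<eta> < l" using l e B by (auto simp: \<eta>_def min_less_iff_disj)
    have "\<eta> * B \<le> l * e ^ d / (2 * B) * B" using B by (intro mult_right_mono) (auto simp: \<eta>_def)
    also have "\<dots> < l * e ^ d" using B l e by simp
    finally show "\<eta> * B < l * e ^ d" .
  qed
  have "\<exists>a\<in>\<rat>. nrm (a - coeff q i) < \<eta>" for i
    using q(2)[of i] \<eta>(1) unfolding closure_approachable dist_nrm by blast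
  then obtain a where a: "\<And>i. a i \<in> \<rat>" "\<And>i. nrm (a i - coeff q i) < \<eta>" by metis
  define P where "P = (\<Sum>i\<le>d. monom (a i) i)"
  have cP: "coeff P i = (if i \<le> d then a i else 0)" for i by (simp add: P_def coeff_sum)
  have "lead_coeff q = a d - (a d - coeff q d)" by (simp add: d_def)
  then have "l \<le> max (nrm (a d)) (nrm (a d - coeff q d))" unfolding l_def by (metis nrm_diff)
  then have ad: "nrm (a d) \<ge> l" using a(2)[of d] \<eta>(2) by linarith
  then have ad0: "a d \<noteq> 0" using l by auto
  have dP: "degree P = d"
    by (rule antisym[OF degree_le le_degree]) (use cP ad0 in auto)
  have P0: "P \<noteq> 0" using cP[of d] ad0 by auto
  have "poly P y = poly P y - poly q y" using q(3) by simp
  also have "\<dots> = (\<Sum>i\<le>d. (a i - coeff q i) * y ^ i)"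
    unfolding poly_altdef dP d_def[symmetric] by (simp add: cP left_diff_distrib sum_subtractf)
  also have "nrm \<dots> \<le> \<eta> * B"
  proof (rule nrm_sum_le)
    fix i assume i: "i \<in> {..d}"
    have "nrm y ^ i \<le> (\<Sum>i\<le>d. nrm y ^ i)"
      by (rule member_le_sum[OF i]) simp_all
    then have "nrm y ^ i \<le> B" by (simp add: B_def)
    then show "nrm ((a i - coeff q i) * y ^ i) \<le> \<eta> * B"
      unfolding nrm_mult nrm_power using a(2)[of i] \<eta>(1) by (intro mult_mono) simp_all
  qed (use \<eta>(1) B in simp)
  finally have small: "nrm (poly P y) < l * e ^ d" using \<eta>(3) by linarith
  have "P \<in> polys_over L" using a(1) L(2) is_subfieldD(1)[OF L(1)] by (auto simp: polys_over_def cP)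
  then obtain r where r: "\<And>x. poly P x = lead_coeff P * (\<Prod>i<degree P. x - r i)"
    using split_over_closed_subfield[OF L(1) root _ P0] by blast
  have "\<exists>i<d. nrm (y - r i) < e"
  proof (rule ccontr)
    assume "\<not> (\<exists>i<d. nrm (y - r i) < e)"
    then have "(\<Prod>i<d. e) \<le> (\<Prod>i<d. nrm (y - r i))"
      using e by (intro prod_mono) auto
    then have "l * e ^ d \<le> nrm (a d) * (\<Prod>i<d. nrm (y - r i))"
      using ad l e by (intro mult_mono) simp_all
    also have "\<dots> = nrm (poly P y)" by (simp add: r nrm_mult nrm_prod dP cP)
    finally show False using small by simp
  qed
  then obtain i where i: "i < d" "nrm (y - r i) < e" by blast
  have "poly P (r i) = 0" unfolding r using i(1) dP by auto
  moreover have "\<forall>j. coeff P j \<in> \<rat>" using a(1) by (simp add: cP)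
  ultimately show ?thesis using P0 i(2) by blast
qed

lemma separable: "\<exists>q :: nat \<Rightarrow> 'a. \<forall>x. \<forall>e>0. \<exists>i. nrm (x - q i) < e"
proof -
  obtain L :: "'a set" where L: "is_algebraic_closure (closure \<rat>) L" "closure L = UNIV"
    using dense_algebraic_closure by blast
  define A where "A = {x::'a. \<exists>P. P \<noteq> 0 \<and> (\<forall>i. coeff P i \<in> \<rat>) \<and> poly P x = 0}"
  have cA: "countable A" unfolding A_def by (rule countable_rational_roots)
  have "\<exists>a\<in>A. nrm (x - a) < e" if e: "e > 0" for x :: 'a and e :: real
  proof -
    have "x \<in> closure L" using L(2) by simp
    then obtain y where y: "y \<in> L" "nrm (y - x) < e"
      using e unfolding closure_approachable dist_nrm by blast
    have L': "is_subfield L" "closure \<rat> \<subseteq> L" "algebraic_over (closure \<rat>) y"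
      "\<And>q. q \<in> polys_over L \<Longrightarrow> degree q > 0 \<Longrightarrow> \<exists>x\<in>L. poly q x = 0"
      using L(1) y(1) unfolding is_algebraic_closure_def polys_over_def by blast+
    have "\<rat> \<subseteq> L" using L'(2) closure_subset by blast
    from rational_root_near[OF L'(3) e L'(1) this L'(4)]
    obtain a P where a: "P \<noteq> 0 \<and> (\<forall>i. coeff P i \<in> \<rat>) \<and> poly P a = 0" "nrm (y - a) < e" by blast
    have "x - a = (y - a) - (y - x)" by simp
    then have "nrm (x - a) \<le> max (nrm (y - a)) (nrm (y - x))" by (metis nrm_diff)
    then have "nrm (x - a) < e" using a(2) y(2) by linarith
    moreover have "a \<in> A" unfolding A_def using a(1) by blast
    ultimately show ?thesis by blast
  qed
  moreover have "A \<noteq> {}" using calculation[of 1 0] by auto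
  ultimately show ?thesis
    using range_from_nat_into[OF _ cA] by (intro exI[of _ "from_nat_into A"]) (metis rangeE)
qed

definition step :: real where
  "step = min (1 / real p ^ 2) (rad / 2)"

lemma step: "step > 0" "step \<le> 1" "H \<le> step \<Longrightarrow> H < rad \<and> H \<le> 1 / real p ^ 2"
proof -
  show "step > 0" using rad(1) p_gt_1 by (simp add: step_def)
  show "step \<le> 1" using rad(1,2) by (simp add: step_def)
  show "H \<le> step \<Longrightarrow> H < rad \<and> H \<le> 1 / real p ^ 2" using rad(1) by (auto simp: step_def)
qed

definition expands :: "(nat \<Rightarrow> 'a) \<Rightarrow> 'a pexp \<Rightarrow> real \<Rightarrow> bool" where
  "expands z E K \<longleftrightarrow> K \<ge> 1 \<and> (\<forall>h H. 0 \<le> H \<and> H \<le> step \<and> (\<forall>i. nrm (h i) \<le> H) \<longrightarrow>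
    nrm (peval (\<lambda>c. c) z (\<lambda>i. padic_exp (z i)) E) \<le> K \<and>
    nrm (tangent z (\<lambda>i. padic_exp (z i)) E h) \<le> K * H \<and>
    nrm (peval (\<lambda>c. c) (\<lambda>i. z i + h i) (\<lambda>i. padic_exp (z i + h i)) E
      - peval (\<lambda>c. c) z (\<lambda>i. padic_exp (z i)) E - tangent z (\<lambda>i. padic_exp (z i)) E h) \<le> K * H ^ 2)"

lemma pexp_expansion:
  assumes z: "\<And>i. nrm (z i) < rad"
  shows "\<exists>K. expands z E K"
proof (induction E)
  case (PConst c)
  show ?case unfolding expands_def by (intro exI[of _ "max 1 (nrm c)"]) (auto simp: max_def)
next
  case (PX i)
  show ?case
    unfolding expands_def
  proof (intro exI[of _ "max 1 (nrm (z i))"] conjI allI impI)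
    fix h :: "nat \<Rightarrow> 'a" and H :: real
    assume a: "0 \<le> H \<and> H \<le> step \<and> (\<forall>i. nrm (h i) \<le> H)"
    then have "nrm (h i) \<le> 1 * H" by simp
    also have "\<dots> \<le> max 1 (nrm (z i)) * H" using a by (intro mult_right_mono) simp_all
    finally show "nrm (tangent z (\<lambda>i. padic_exp (z i)) (PX i) h) \<le> max 1 (nrm (z i)) * H" by simp
  qed (auto simp: le_max_iff_disj)
next
  case (PY i)
  have p2: "real p ^ 2 \<ge> 1" using p_gt_1 by (intro one_le_power) simp
  show ?case
    unfolding expands_def
  proof (intro exI[of _ "real p ^ 2"] conjI allI impI)
    fix h :: "nat \<Rightarrow> 'a" and H :: real
    assume a: "0 \<le> H \<and> H \<le> step \<and> (\<forall>i. nrm (h i) \<le> H)"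
    have e: "nrm (padic_exp (z i)) \<le> 1" by (rule nrm_exp[OF z])
    then show "nrm (peval (\<lambda>c. c) z (\<lambda>i. padic_exp (z i)) (PY i)) \<le> real p ^ 2" using p2 by simp
    have "nrm (padic_exp (z i) * h i) \<le> 1 * H" unfolding nrm_mult using e a by (intro mult_mono) simp_all
    also have "\<dots> \<le> real p ^ 2 * H" using p2 a by (intro mult_right_mono) simp_all
    finally show "nrm (tangent z (\<lambda>i. padic_exp (z i)) (PY i) h) \<le> real p ^ 2 * H" by simp
    have h: "nrm (h i) < rad" "nrm (h i) \<le> 1 / real p ^ 2" using step(3)[of "nrm (h i)"] a order_trans by blast+
    have "nrm (padic_exp (z i) * (padic_exp (h i) - 1 - h i)) \<le> 1 * (real p ^ 2 * nrm (h i) ^ 2)"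
      unfolding nrm_mult by (rule mult_mono[OF e exp_quadratic[OF h]]) simp_all
    also have "\<dots> \<le> real p ^ 2 * H ^ 2" using a by (simp add: mult_left_mono power_mono)
    finally show "nrm (peval (\<lambda>c. c) (\<lambda>i. z i + h i) (\<lambda>i. padic_exp (z i + h i)) (PY i)
      - peval (\<lambda>c. c) z (\<lambda>i. padic_exp (z i)) (PY i) - tangent z (\<lambda>i. padic_exp (z i)) (PY i) h) \<le> real p ^ 2 * H ^ 2"
      by (simp add: padic_exp_add[OF z h(1)] right_diff_distrib)
  qed (rule p2)
next
  case (PAdd E F)
  then obtain K K' where E: "expands z E K" and F: "expands z F K'" by blast
  have K: "K \<ge> 1" "K' \<ge> 1" using E F by (simp_all add: expands_def)
  note E = E[unfolded expands_def, THEN conjunct2] and F = F[unfolded expands_def, THEN conjunct2]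
  show ?case
    unfolding expands_def
  proof (intro exI[of _ "max K K'"] conjI allI impI)
    show "max K K' \<ge> 1" using K by simp
    fix h :: "nat \<Rightarrow> 'a" and H :: real
    assume a: "0 \<le> H \<and> H \<le> step \<and> (\<forall>i. nrm (h i) \<le> H)"
    have m: "K * H \<le> max K K' * H" "K' * H \<le> max K K' * H" "K * H ^ 2 \<le> max K K' * H ^ 2" "K' * H ^ 2 \<le> max K K' * H ^ 2"
      using a by (intro mult_right_mono; simp)+
    note E' = E[rule_format, OF a] and F' = F[rule_format, OF a]
    show "nrm (peval (\<lambda>c. c) z (\<lambda>i. padic_exp (z i)) (PAdd E F)) \<le> max K K'"
      unfolding peval.simps using E' F' by (intro nrm_add_le) (simp_all add: le_max_iff_disj)
    show "nrm (tangent z (\<lambda>i. padic_exp (z i)) (PAdd E F) h) \<le> max K K' * H"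
      unfolding tangent_simps using E' F' m by (intro nrm_add_le) linarith+
    have "nrm ((peval (\<lambda>c. c) (\<lambda>i. z i + h i) (\<lambda>i. padic_exp (z i + h i)) E
      - peval (\<lambda>c. c) z (\<lambda>i. padic_exp (z i)) E - tangent z (\<lambda>i. padic_exp (z i)) E h) +
      (peval (\<lambda>c. c) (\<lambda>i. z i + h i) (\<lambda>i. padic_exp (z i + h i)) F
      - peval (\<lambda>c. c) z (\<lambda>i. padic_exp (z i)) F - tangent z (\<lambda>i. padic_exp (z i)) F h)) \<le> max K K' * H ^ 2"
      using E' F' m by (intro nrm_add_le) linarith+
    then show "nrm (peval (\<lambda>c. c) (\<lambda>i. z i + h i) (\<lambda>i. padic_exp (z i + h i)) (PAdd E F)
      - peval (\<lambda>c. c) z (\<lambda>i. padic_exp (z i)) (PAdd E F) - tangent z (\<lambda>i. padic_exp (z i)) (PAdd E F) h) \<le> max K K' * H ^ 2"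
      unfolding peval.simps tangent_simps by (simp only: diff_conv_add_uminus minus_add_distrib add_ac)
  qed
next
  case (PMult E F)
  then obtain K K' where E: "expands z E K" and F: "expands z F K'" by blast
  have K: "K \<ge> 1" "K' \<ge> 1" using E F by (simp_all add: expands_def)
  note E = E[unfolded expands_def, THEN conjunct2] and F = F[unfolded expands_def, THEN conjunct2]
  show ?case
    unfolding expands_def
  proof (intro exI[of _ "K * K'"] conjI allI impI)
    show "K * K' \<ge> 1" using mult_mono[of 1 K 1 K'] K by simp
    fix h :: "nat \<Rightarrow> 'a" and H :: real
    assume h: "0 \<le> H \<and> H \<le> step \<and> (\<forall>i. nrm (h i) \<le> H)"
    define a ta ra where "a = peval (\<lambda>c. c) z (\<lambda>i. padic_exp (z i)) E"
      and "ta = tangent z (\<lambda>i. padic_exp (z i)) E h"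
      and "ra = peval (\<lambda>c. c) (\<lambda>i. z i + h i) (\<lambda>i. padic_exp (z i + h i)) E - a - ta"
    define b tb rb where "b = peval (\<lambda>c. c) z (\<lambda>i. padic_exp (z i)) F"
      and "tb = tangent z (\<lambda>i. padic_exp (z i)) F h"
      and "rb = peval (\<lambda>c. c) (\<lambda>i. z i + h i) (\<lambda>i. padic_exp (z i + h i)) F - b - tb"
    have A: "nrm a \<le> K" "nrm ta \<le> K * H" "nrm ra \<le> K * H ^ 2"
      using E[rule_format, OF h] by (simp_all add: a_def ta_def ra_def)
    have B: "nrm b \<le> K'" "nrm tb \<le> K' * H" "nrm rb \<le> K' * H ^ 2"
      using F[rule_format, OF h] by (simp_all add: b_def tb_def rb_def)
    have H: "0 \<le> H" "H ^ 2 \<le> H" using h step(2) by (auto simp: power2_eq_square mult_left_le)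
    have A': "nrm (ta + ra) \<le> K * H" and B': "nrm (tb + rb) \<le> K' * H"
      using A B H K mult_left_mono[OF H(2), of K] mult_left_mono[OF H(2), of K'] by (intro nrm_add_le; linarith)+
    show "nrm (peval (\<lambda>c. c) z (\<lambda>i. padic_exp (z i)) (PMult E F)) \<le> K * K'"
      unfolding peval.simps nrm_mult a_def[symmetric] b_def[symmetric] using A B K by (intro mult_mono) simp_all
    have "nrm (a * tb) \<le> K * (K' * H)" "nrm (ta * b) \<le> (K * H) * K'"
      unfolding nrm_mult using A B K H by (intro mult_mono; simp)+
    then have "nrm (a * tb + ta * b) \<le> K * K' * H" by (intro nrm_add_le) (simp_all add: mult_ac)
    then show "nrm (tangent z (\<lambda>i. padic_exp (z i)) (PMult E F) h) \<le> K * K' * H"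
      by (simp add: a_def ta_def b_def tb_def)
    have "nrm (a * rb) \<le> K * (K' * H ^ 2)" "nrm (ra * b) \<le> (K * H ^ 2) * K'"
      "nrm ((ta + ra) * (tb + rb)) \<le> (K * H) * (K' * H)"
      unfolding nrm_mult using A B A' B' K H by (intro mult_mono; simp)+
    then have "nrm (a * rb + ra * b + (ta + ra) * (tb + rb)) \<le> K * K' * H ^ 2"
      by (intro nrm_add_le) (simp_all add: mult_ac power2_eq_square)
    moreover have "a * rb + ra * b + (ta + ra) * (tb + rb) = (a + ta + ra) * (b + tb + rb) - a * b - (a * tb + ta * b)"
      by (simp add: algebra_simps)
    ultimately show "nrm (peval (\<lambda>c. c) (\<lambda>i. z i + h i) (\<lambda>i. padic_exp (z i + h i)) (PMult E F)
      - peval (\<lambda>c. c) z (\<lambda>i. padic_exp (z i)) (PMult E F) - tangent z (\<lambda>i. padic_exp (z i)) (PMult E F) h) \<le> K * K' * H ^ 2"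
      by (simp add: a_def ta_def b_def tb_def ra_def rb_def)
  qed
qed

end

context padic_complex_field
begin

lemma isolated_solution:
  assumes C: "is_subfield C" and z: "\<And>i. nrm (z i) < rad" and z0: "\<And>i. i \<ge> n \<Longrightarrow> z i = 0"
    and rigid: "\<And>d. d \<in> Der C \<Longrightarrow>
      (\<And>i. i < n \<Longrightarrow> d (padic_exp (z i)) = padic_exp (z i) * d (z i)) \<Longrightarrow> \<forall>i<n. d (z i) = 0"
  shows "\<exists>Es r. r > 0 \<and>
    (\<forall>E\<in>set Es. set_pexp E \<subseteq> C \<and> peval (\<lambda>c. c) z (\<lambda>i. padic_exp (z i)) E = 0) \<and>
    (\<forall>w. (\<forall>i\<ge>n. w i = 0) \<and> (\<forall>i<n. nrm (w i - z i) < r) \<and>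
      (\<forall>E\<in>set Es. peval (\<lambda>c. c) w (\<lambda>i. padic_exp (w i)) E = 0) \<longrightarrow> w = z)"
proof -
  define y where "y = (\<lambda>i. padic_exp (z i))"
  define Z where "Z = {E. set_pexp E \<subseteq> C \<and> peval (\<lambda>c. c) z y E = 0}"
  have left_inv: "\<exists>F c. finite F \<and> F \<subseteq> Z \<and> (\<forall>u. (\<forall>j\<ge>n. u j = 0) \<longrightarrow> u i = (\<Sum>E\<in>F. c E * tangent z y E u))"
    if "i < n" for i
    unfolding Z_def by (rule tangent_left_inverse[OF C _ that]) (use rigid in \<open>simp add: y_def\<close>)
  define Q where "Q i F c \<longleftrightarrow> (i < n \<longrightarrow> finite F \<and> F \<subseteq> Z \<and>
      (\<forall>u. (\<forall>j\<ge>n. u j = 0) \<longrightarrow> u i = (\<Sum>E\<in>F. c E * tangent z y E u)))" for i F and c :: "'a pexp \<Rightarrow> 'a"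
  have "\<forall>i. \<exists>F c. Q i F c"
    using left_inv by (simp add: Q_def)
  from choice[OF this] obtain F where "\<forall>i. \<exists>c. Q i (F i) c" by (elim exE)
  from choice[OF this] obtain c where c: "\<forall>i. Q i (F i) (c i)" by (elim exE)
  have Fc: "finite (F i)" "F i \<subseteq> Z"
    "\<forall>j\<ge>n. u j = 0 \<Longrightarrow> u i = (\<Sum>E\<in>F i. c i E * tangent z y E u)" if "i < n" for i u
    using c[rule_format, of i] that by (simp_all add: Q_def)
  from choice[of "expands z"] pexp_expansion[of z, OF z] obtain K0 where K0': "\<forall>E. expands z E (K0 E)"
    by blast
  have K0: "K0 E \<ge> 1" for E using K0'[rule_format, of E] by (simp add: expands_def)
  have exp: "nrm (peval (\<lambda>c. c) (\<lambda>i. z i + h i) (\<lambda>i. padic_exp (z i + h i)) E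
      - peval (\<lambda>c. c) z y E - tangent z y E h) \<le> K0 E * H ^ 2"
    if "0 \<le> H" "H \<le> step" "\<And>i. nrm (h i) \<le> H" for H h E
    using K0'[rule_format, of E, unfolded expands_def, THEN conjunct2, rule_format, of H h] that
    by (simp add: y_def)
  define Fs where "Fs = (\<Union>i<n. F i)"
  have fFs: "finite Fs" "Fs \<subseteq> Z" using Fc(1,2) unfolding Fs_def by auto
  obtain Es where Es: "set Es = Fs" using fFs(1) finite_list by blast
  define K where "K = (\<Sum>E\<in>Fs. K0 E) + 1"
  define B where "B = (\<Sum>i<n. \<Sum>E\<in>F i. nrm (c i E)) + 1"
  have K0_nonneg: "K0 E \<ge> 0" for E using K0[of E] by simp
  have K: "K \<ge> 1" "K0 E \<le> K" if "E \<in> Fs" for E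
  proof -
    show "K \<ge> 1" by (simp add: K_def sum_nonneg K0_nonneg)
    have "K0 E \<le> (\<Sum>E\<in>Fs. K0 E)" by (rule member_le_sum[OF that]) (use fFs K0_nonneg in auto)
    then show "K0 E \<le> K" by (simp add: K_def)
  qed
  have K1: "K \<ge> 1" by (simp add: K_def sum_nonneg K0_nonneg)
  have B: "B \<ge> 1" by (simp add: B_def sum_nonneg)
  have cB: "nrm (c i E) \<le> B" if "i < n" "E \<in> F i" for i E
  proof -
    have "nrm (c i E) \<le> (\<Sum>E\<in>F i. nrm (c i E))" by (rule member_le_sum[OF that(2)]) (use Fc(1)[OF that(1)] in auto)
    also have "\<dots> \<le> (\<Sum>i<n. \<Sum>E\<in>F i. nrm (c i E))"
      by (rule member_le_sum[of i "{..<n}" "\<lambda>i. \<Sum>E\<in>F i. nrm (c i E)"]) (use that in \<open>auto intro: sum_nonneg\<close>)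
    finally show ?thesis by (simp add: B_def)
  qed
  define r where "r = min step (1 / (B * K))"
  have BK: "B * K > 0" using B K1 by simp
  have r: "r > 0" using step(1) BK by (simp add: r_def)
  have unique: "w = z" if w: "\<forall>i\<ge>n. w i = 0" "\<forall>i<n. nrm (w i - z i) < r"
    "\<forall>E\<in>set Es. peval (\<lambda>c. c) w (\<lambda>i. padic_exp (w i)) E = 0" for w
  proof -
    define h where "h i = w i - z i" for i
    define H where "H = Max (insert 0 ((\<lambda>i. nrm (h i)) ` {..<n}))"
    have h0: "\<forall>i\<ge>n. h i = 0" using w(1) z0 by (simp add: h_def)
    have H0: "H \<ge> 0" unfolding H_def by (rule Max_ge) simp_all
    have hH: "nrm (h i) \<le> H" for i
    proof (cases "i < n")
      case True
      then show ?thesis unfolding H_def by (intro Max_ge) simp_all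
    next
      case False
      then show ?thesis using h0 H0 by simp
    qed
    have "H \<in> insert 0 ((\<lambda>i. nrm (h i)) ` {..<n})" unfolding H_def by (rule Max_in) simp_all
    then have Hr: "H < r" using r w(2) by (auto simp: h_def)
    then have Hs: "H \<le> step" by (simp add: r_def)
    have tan: "nrm (tangent z y E h) \<le> K * H ^ 2" if E: "E \<in> Fs" for E
    proof -
      have "peval (\<lambda>c. c) z y E = 0" using E fFs(2) by (auto simp: Z_def)
      moreover have "peval (\<lambda>c. c) (\<lambda>i. z i + h i) (\<lambda>i. padic_exp (z i + h i)) E = 0"
        using w(3) E by (simp add: h_def Es)
      ultimately have "nrm (tangent z y E h) \<le> K0 E * H ^ 2"
        using exp[where h = h and H = H and E = E, OF H0 Hs hH] by simp
      also have "\<dots> \<le> K * H ^ 2" using K(2)[OF E] by (rule mult_right_mono) simp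
      finally show ?thesis .
    qed
    have bound: "nrm (h i) \<le> B * (K * H ^ 2)" for i
    proof (cases "i < n")
      case True
      have "h i = (\<Sum>E\<in>F i. c i E * tangent z y E h)" by (rule Fc(3)[OF True h0])
      also have "nrm \<dots> \<le> B * (K * H ^ 2)"
      proof (rule nrm_sum_le)
        fix E assume E: "E \<in> F i"
        then have "E \<in> Fs" using True by (auto simp: Fs_def)
        then show "nrm (c i E * tangent z y E h) \<le> B * (K * H ^ 2)"
          unfolding nrm_mult using cB[OF True E] tan B by (intro mult_mono) simp_all
      qed (use B K1 in simp)
      finally show ?thesis .
    next
      case False
      then show ?thesis using h0 B K1 by simp
    qed
    have "H \<le> B * (K * H ^ 2)"
      using \<open>H \<in> insert 0 _\<close> bound B K1 by auto
    then have le: "H * 1 \<le> H * (B * K * H)" by (simp add: power2_eq_square mult_ac)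
    have "H < 1 / (B * K)" using Hr by (simp add: r_def)
    then have "H * (B * K) < 1" by (simp only: pos_less_divide_eq[OF BK])
    then have lt: "B * K * H < 1" by (simp only: mult.commute)
    have "H = 0"
    proof (rule ccontr)
      assume "H \<noteq> 0"
      then have "H > 0" using H0 by simp
      then have "H * (B * K * H) < H * 1" using lt by (simp only: mult_less_cancel_left_pos)
      then show False using le by simp
    qed
    then have "h i = 0" for i using hH[of i] nrm_ge_0[of "h i"] by (simp add: order_antisym)
    then show ?thesis by (auto simp: h_def)
  qed
  have inZ: "\<forall>E\<in>set Es. set_pexp E \<subseteq> C \<and> peval (\<lambda>c. c) z y E = 0"
    using fFs(2) by (auto simp: Es Z_def)
  show ?thesis
  proof (intro exI[of _ Es] exI[of _ r] conjI allI impI)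
    show "r > 0" by (rule r)
    show "\<forall>E\<in>set Es. set_pexp E \<subseteq> C \<and> peval (\<lambda>c. c) z (\<lambda>i. padic_exp (z i)) E = 0"
      using inZ by (simp only: y_def)
  qed (elim conjE, rule unique)
qed

end

context padic_complex_field
begin

definition exp_closed :: "'a set \<Rightarrow> bool" where
  "exp_closed C \<longleftrightarrow> (\<forall>(n::nat) z. (\<forall>i<n. nrm (z i) < rad) \<longrightarrow>
    (\<forall>d\<in>Der C. (\<forall>i<n. d (padic_exp (z i)) = padic_exp (z i) * d (z i)) \<longrightarrow> (\<forall>i<n. d (z i) = 0)) \<longrightarrow>
    (\<forall>i<n. z i \<in> C))"

lemma exponentially_closed_subfield:
  "\<exists>C. is_subfield C \<and> countable C \<and> exp_closed C"
proof -
  obtain q :: "nat \<Rightarrow> 'a" where q: "\<And>x e. e > 0 \<Longrightarrow> \<exists>i. nrm (x - q i) < e" using separable by blast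
  define P where "P n Es qs m w \<longleftrightarrow> (\<forall>i\<ge>n. w i = 0) \<and> (\<forall>i<n. nrm (w i - q (qs ! i)) < 1 / real (Suc m)) \<and>
    (\<forall>E\<in>set Es. peval (\<lambda>c. c) w (\<lambda>i. padic_exp (w i)) E = 0)" for n Es qs m and w :: "nat \<Rightarrow> 'a"
  from countable_closure[of "\<lambda>n Es qs m i. (THE w. P n Es qs m w) i"]
  obtain C where C: "is_subfield C" "countable C"
    and sol': "\<forall>n Es qs m i. (\<forall>E\<in>set Es. set_pexp E \<subseteq> C) \<longrightarrow> (THE w. P n Es qs m w) i \<in> C"
    by (elim exE conjE)
  have sol: "(THE w. P n Es qs m w) i \<in> C" if "\<forall>E\<in>set Es. set_pexp E \<subseteq> C" for n Es qs m i
    using sol' that by simp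
  have "z i \<in> C" if z: "\<forall>i<n. nrm (z i) < rad"
    and rigid: "\<forall>d\<in>Der C. (\<forall>i<n. d (padic_exp (z i)) = padic_exp (z i) * d (z i)) \<longrightarrow> (\<forall>i<n. d (z i) = 0)"
    and i: "i < n" for n i :: nat and z :: "nat \<Rightarrow> 'a"
  proof -
    define z' where "z' i = (if i < n then z i else 0)" for i
    have "\<exists>Es r. r > 0 \<and>
      (\<forall>E\<in>set Es. set_pexp E \<subseteq> C \<and> peval (\<lambda>c. c) z' (\<lambda>i. padic_exp (z' i)) E = 0) \<and>
      (\<forall>w. (\<forall>i\<ge>n. w i = 0) \<and> (\<forall>i<n. nrm (w i - z' i) < r) \<and>
        (\<forall>E\<in>set Es. peval (\<lambda>c. c) w (\<lambda>i. padic_exp (w i)) E = 0) \<longrightarrow> w = z')"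
    proof (rule isolated_solution[OF C(1)])
      show "nrm (z' i) < rad" for i using z rad(1) by (simp add: z'_def)
      show "i \<ge> n \<Longrightarrow> z' i = 0" for i by (simp add: z'_def)
      fix d assume "d \<in> Der C" "\<And>i. i < n \<Longrightarrow> d (padic_exp (z' i)) = padic_exp (z' i) * d (z' i)"
      then show "\<forall>i<n. d (z' i) = 0" using rigid by (simp add: z'_def)
    qed
    then obtain Es r where r: "r > 0"
      and Es': "\<forall>E\<in>set Es. set_pexp E \<subseteq> C \<and> peval (\<lambda>c. c) z' (\<lambda>i. padic_exp (z' i)) E = 0"
      and un': "\<forall>w. (\<forall>i\<ge>n. w i = 0) \<and> (\<forall>i<n. nrm (w i - z' i) < r) \<and>
        (\<forall>E\<in>set Es. peval (\<lambda>c. c) w (\<lambda>i. padic_exp (w i)) E = 0) \<longrightarrow> w = z'"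
      by (elim exE conjE)
    have Es: "\<forall>E\<in>set Es. set_pexp E \<subseteq> C" "\<forall>E\<in>set Es. peval (\<lambda>c. c) z' (\<lambda>i. padic_exp (z' i)) E = 0"
      using Es' by simp_all
    have un: "w = z'" if "\<forall>i\<ge>n. w i = 0" "\<forall>i<n. nrm (w i - z' i) < r"
      "\<forall>E\<in>set Es. peval (\<lambda>c. c) w (\<lambda>i. padic_exp (w i)) E = 0" for w
      using that by (intro un'[rule_format] conjI)
    obtain m where m: "1 / real (Suc m) < r" by (rule nat_approx_posE[OF r])
    have "\<forall>i. \<exists>j. nrm (z' i - q j) < 1 / real (Suc m)" by (intro allI q) simp
    then obtain j where j: "\<And>i. nrm (z' i - q (j i)) < 1 / real (Suc m)" by metis
    define qs where "qs = map j [0..<n]"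
    have "(THE w. P n Es qs m w) = z'"
    proof (rule the_equality)
      show "P n Es qs m z'" using j Es(2) by (simp add: P_def qs_def) (simp add: z'_def)
      fix w assume w: "P n Es qs m w"
      show "w = z'"
      proof (rule un)
        show "\<forall>i<n. nrm (w i - z' i) < r"
        proof (intro allI impI)
          fix i assume "i < n"
          then have "nrm (w i - q (j i)) < 1 / real (Suc m)" using w by (simp add: P_def qs_def)
          moreover have "w i - z' i = (w i - q (j i)) - (z' i - q (j i))" by simp
          then have "nrm (w i - z' i) \<le> max (nrm (w i - q (j i))) (nrm (z' i - q (j i)))" by (metis nrm_diff)
          ultimately show "nrm (w i - z' i) < r" using j[of i] m by linarith
        qed
        show "\<forall>i\<ge>n. w i = 0" "\<forall>E\<in>set Es. peval (\<lambda>c. c) w (\<lambda>i. padic_exp (w i)) E = 0"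
          using w[unfolded P_def] by (rule conjunct1, rule conjunct2[OF conjunct2])
      qed
    qed
    then show ?thesis using sol[OF Es(1), of n qs m i] i by (simp add: z'_def)
  qed
  then show ?thesis
    unfolding exp_closed_def by (intro exI[of _ C] conjI C allI impI)
qed

end

section \<open>The rank inequality\<close>

definition ev :: "'a::field set \<Rightarrow> 'a \<Rightarrow> ('a \<Rightarrow> 'a) \<Rightarrow> 'a" where
  "ev C s = (\<lambda>d. if d \<in> Der C then d s else 0)"

lemma ev_apply: "d \<in> Der C \<Longrightarrow> ev C s d = d s"
  by (simp add: ev_def)

lemma diff_independent_of_span:
  fixes S :: "'a::field_char_0 set"
  assumes S: "finite S" and B: "fun_space.independent B" "B \<subseteq> fun_space.span (ev C ` S)"
  shows "\<exists>S'\<subseteq>S. diff_independent C S' \<and> card B \<le> card S'"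
proof -
  obtain B' where B': "B' \<subseteq> ev C ` S" "fun_space.independent B'" "ev C ` S \<subseteq> fun_space.span B'"
    by (rule fun_space.maximal_independent_subset[of "ev C ` S"])
  have fB': "finite B'" using B'(1) S finite_subset by blast
  have "fun_space.span (ev C ` S) \<subseteq> fun_space.span B'"
    by (rule fun_space.span_minimal[OF B'(3) fun_space.subspace_span])
  then have "card B \<le> card B'"
    using fun_space.independent_span_bound[OF fB' B(1)] B(2) by (meson order_trans)
  obtain S' where S': "S' \<subseteq> S" "inj_on (ev C) S'" "B' = ev C ` S'"
    using B'(1) unfolding subset_image_inj by (elim exE conjE)
  have fS': "finite S'" using S'(1) S by (rule finite_subset)
  have "f b = 0" if f: "\<forall>d\<in>Der C. (\<Sum>b\<in>S'. f b * d b) = 0" and b: "b \<in> S'" for f b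
  proof -
    define u where "u \<phi> = f (the_inv_into S' (ev C) \<phi>)" for \<phi>
    have u: "u (ev C b) = f b" if "b \<in> S'" for b
      by (simp add: u_def the_inv_into_f_f[OF S'(2) that])
    have "(\<Sum>\<phi>\<in>B'. (\<lambda>d. u \<phi> * \<phi> d)) = 0"
    proof
      fix d
      have "(\<Sum>\<phi>\<in>B'. (\<lambda>d. u \<phi> * \<phi> d)) d = (\<Sum>b\<in>S'. f b * ev C b d)"
        unfolding sum_fun_apply S'(3) sum.reindex[OF S'(2)] by (rule sum.cong) (simp_all add: u)
      also have "\<dots> = 0"
      proof (cases "d \<in> Der C")
        case True
        then show ?thesis using f by (simp add: ev_apply)
      next
        case False
        then show ?thesis by (simp add: ev_def)
      qed
      finally show "(\<Sum>\<phi>\<in>B'. (\<lambda>d. u \<phi> * \<phi> d)) d = 0 d" by simp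
    qed
    then have "u (ev C b) = 0"
      by (rule fun_space.independentD[OF B'(2) fB' subset_refl]) (simp add: S'(3) b)
    then show ?thesis using u[OF b] by simp
  qed
  then have "diff_independent C S'"
    using fS' unfolding diff_independent_def by (intro conjI allI impI ballI)
  moreover have "card B' = card S'" unfolding S'(3) by (rule card_image[OF S'(2)])
  ultimately show ?thesis using S'(1) \<open>card B \<le> card B'\<close> by (intro exI[of _ S'] conjI) simp_all
qed

lemma vanish_on_span:
  assumes "\<phi> \<in> fun_space.span T" "\<And>t. t \<in> T \<Longrightarrow> t d = 0"
  shows "\<phi> d = (0 :: 'a::field)"
proof -
  have "fun_space.span T \<subseteq> {\<phi>. \<phi> d = 0}"
  proof (rule fun_space.span_minimal)
    show "T \<subseteq> {\<phi>. \<phi> d = 0}" using assms(2) by blast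
    show "fun_space.subspace {\<phi>. \<phi> d = 0}"
      by (rule fun_space.subspaceI) simp_all
  qed
  then show ?thesis using assms(1) by blast
qed

lemma independent_append_forms:
  fixes C :: "'a::field_char_0 set" and w e :: "'i \<Rightarrow> 'a"
  assumes D: "D \<in> Der C" and B0: "finite B0" "fun_space.independent B0"
    and van: "\<And>\<phi> d. \<phi> \<in> B0 \<Longrightarrow> d \<in> Der {x. D x = 0} \<Longrightarrow> \<phi> d = 0"
    and J: "finite J" and e: "\<And>i. i \<in> J \<Longrightarrow> e i \<noteq> 0"
    and De: "\<And>i. i \<in> J \<Longrightarrow> D (e i) = e i * D (w i)"
    and indep: "\<And>n :: 'i \<Rightarrow> int. D (\<Sum>i\<in>J. of_int (n i) * w i) = 0 \<Longrightarrow> \<forall>i\<in>J. n i = 0"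
    and i1: "i1 \<in> J" "D (w i1) \<noteq> 0"
    and T: "B0 \<subseteq> fun_space.span T" "\<And>i. i \<in> J \<Longrightarrow> ev C (w i) \<in> fun_space.span T"
      "\<And>i. i \<in> J \<Longrightarrow> ev C (e i) \<in> fun_space.span T"
  shows "\<exists>B. finite B \<and> fun_space.independent B \<and> B \<subseteq> fun_space.span T \<and> card B = card B0 + card J + 1"
proof -
  have dD: "derivation D" using D by (rule Der_derivation)
  define K where "K = {x. D x = 0}"
  have DK: "D \<in> Der K" using dD by (simp add: Der_def K_def)
  have KC: "d \<in> Der C" if "d \<in> Der K" for d
    using that D by (auto simp: Der_def K_def)
  define \<omega> where "\<omega> i = (\<lambda>d. (1 / e i) * ev C (e i) d) - ev C (w i)" for i
  have \<omega>: "\<omega> i d = d (e i) / e i - d (w i)" if "d \<in> Der K" for i d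
    using KC[OF that] by (simp add: \<omega>_def ev_apply)
  define \<tau> where "\<tau> = ev C (w i1)"
  have \<tau>: "\<tau> D \<noteq> 0" using i1 D by (simp add: \<tau>_def ev_apply)
  have \<omega>D: "\<omega> i D = 0" if "i \<in> J" for i
    using \<omega>[OF DK, of i] De[OF that] e[OF that] by simp
  have free: "f i = 0" if "\<And>d. d \<in> Der K \<Longrightarrow> (\<Sum>i\<in>J. f i * \<omega> i d) = 0" "i \<in> J" for f i
  proof (rule exponential_forms_independent[OF dD J e De indep _ that(2)])
    fix d assume d: "d \<in> Der {x. D x = 0}"
    then have "d \<in> Der K" by (simp add: K_def)
    then show "(\<Sum>i\<in>J. f i * (d (e i) / e i - d (w i))) = 0"
      using that(1)[of d] by (simp add: \<omega>)
  qed
  have inj: "inj_on \<omega> J"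
  proof (rule inj_onI, rule ccontr)
    fix i j assume ij: "i \<in> J" "j \<in> J" "\<omega> i = \<omega> j" "i \<noteq> j"
    define f :: "'i \<Rightarrow> 'a" where "f l = (if l = i then 1 else 0) - (if l = j then 1 else 0)" for l
    have "(\<Sum>l\<in>J. f l * \<omega> l d) = 0" for d
    proof -
      have "(\<Sum>l\<in>J. f l * \<omega> l d) = (\<Sum>l\<in>J. (if l = i then \<omega> l d else 0) - (if l = j then \<omega> l d else 0))"
        by (rule sum.cong) (simp_all add: f_def)
      also have "\<dots> = \<omega> i d - \<omega> j d" using J ij(1,2) by (simp add: sum_subtractf)
      finally show ?thesis using ij(3) by simp
    qed
    then have "f i = 0" using ij(1) by (rule free)
    then show False using ij(4) by (simp add: f_def)
  qed
  have nonvan: "\<exists>d\<in>Der K. \<omega> i d \<noteq> 0" if i: "i \<in> J" for i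
  proof (rule ccontr)
    assume a: "\<not> (\<exists>d\<in>Der K. \<omega> i d \<noteq> 0)"
    have "(\<Sum>l\<in>J. (if l = i then 1 else 0) * \<omega> l d) = 0" if d: "d \<in> Der K" for d
      by (rule sum.neutral) (use a d in auto)
    then have "(if i = i then 1 else 0 :: 'a) = 0" using i by (rule free)
    then show False by simp
  qed
  have vanK: "\<phi> d = 0" if "\<phi> \<in> B0" "d \<in> Der K" for \<phi> d
    using van that by (simp add: K_def)
  have disj: "B0 \<inter> \<omega> ` J = {}" using nonvan vanK by blast
  have "\<tau> \<notin> B0 \<union> \<omega> ` J"
  proof
    assume "\<tau> \<in> B0 \<union> \<omega> ` J"
    then have "\<tau> D = 0" using vanK[OF _ DK] \<omega>D by blast
    then show False using \<tau> by simp
  qed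
  define B where "B = insert \<tau> (B0 \<union> \<omega> ` J)"
  have fin: "finite (\<omega> ` J)" using J by simp
  have fB: "finite B" using B0(1) fin by (simp add: B_def)
  have sumB: "(\<Sum>\<phi>\<in>B. (\<lambda>d. u \<phi> * \<phi> d)) d = u \<tau> * \<tau> d + ((\<Sum>\<phi>\<in>B0. u \<phi> * \<phi> d) + (\<Sum>i\<in>J. u (\<omega> i) * \<omega> i d))"
    for u :: "(('a \<Rightarrow> 'a) \<Rightarrow> 'a) \<Rightarrow> 'a" and d
    unfolding sum_fun_apply B_def
    using \<open>\<tau> \<notin> _\<close> B0(1) fin disj by (simp add: sum.union_disjoint sum.reindex[OF inj])
  have "fun_space.independent B"
  proof
    assume "fun_space.dependent B"
    then obtain u \<psi> where \<psi>: "\<psi> \<in> B" "u \<psi> \<noteq> 0" and u: "(\<Sum>\<phi>\<in>B. (\<lambda>d. u \<phi> * \<phi> d)) = 0"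
      unfolding fun_space.dependent_finite[OF fB] by blast
    have eq: "u \<tau> * \<tau> d + ((\<Sum>\<phi>\<in>B0. u \<phi> * \<phi> d) + (\<Sum>i\<in>J. u (\<omega> i) * \<omega> i d)) = 0" for d
      using sumB[of u d] u by simp
    have "(\<Sum>\<phi>\<in>B0. u \<phi> * \<phi> D) = 0" "(\<Sum>i\<in>J. u (\<omega> i) * \<omega> i D) = 0"
      by (rule sum.neutral; simp add: vanK[OF _ DK] \<omega>D)+
    then have u\<tau>: "u \<tau> = 0" using eq[of D] \<tau> by simp
    have u\<omega>: "u (\<omega> i) = 0" if "i \<in> J" for i
    proof (rule free[OF _ that])
      fix d assume d: "d \<in> Der K"
      have "(\<Sum>\<phi>\<in>B0. u \<phi> * \<phi> d) = 0" by (rule sum.neutral) (simp add: vanK[OF _ d])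
      then show "(\<Sum>i\<in>J. u (\<omega> i) * \<omega> i d) = 0" using eq[of d] u\<tau> by simp
    qed
    have "(\<Sum>\<phi>\<in>B0. (\<lambda>d. u \<phi> * \<phi> d)) = 0"
    proof
      fix d
      have "(\<Sum>i\<in>J. u (\<omega> i) * \<omega> i d) = 0" by (rule sum.neutral) (simp add: u\<omega>)
      then show "(\<Sum>\<phi>\<in>B0. (\<lambda>d. u \<phi> * \<phi> d)) d = 0 d"
        unfolding sum_fun_apply using eq[of d] u\<tau> by simp
    qed
    then have uB0: "u \<phi> = 0" if "\<phi> \<in> B0" for \<phi>
      using that by (rule fun_space.independentD[OF B0(2,1) subset_refl])
    have "u \<psi> = 0" using \<psi>(1) u\<tau> u\<omega> uB0 unfolding B_def by blast
    then show False using \<psi>(2) by simp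
  qed
  moreover have "B \<subseteq> fun_space.span T"
  proof -
    have "\<omega> i \<in> fun_space.span T" if "i \<in> J" for i
      unfolding \<omega>_def using T(2,3)[OF that] by (intro fun_space.span_diff fun_space.span_scale)
    moreover have "\<tau> \<in> fun_space.span T" unfolding \<tau>_def by (rule T(2)[OF i1(1)])
    ultimately show ?thesis using T(1) unfolding B_def by blast
  qed
  moreover have "card B = card B0 + card J + 1"
    unfolding B_def using \<open>\<tau> \<notin> _\<close> B0(1) fin disj card_image[OF inj] by (simp add: card_Un_disjoint)
  ultimately show ?thesis using fB by (intro exI[of _ B] conjI)
qed

context padic_complex_field
begin

lemma exponential_rank:
  fixes z :: "nat \<Rightarrow> 'a"
  assumes C: "is_subfield C"
    and closed: "exp_closed C"
    and "finite I" "I \<noteq> {}" "\<And>i. i \<in> I \<Longrightarrow> nrm (z i) < rad"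
    and "\<And>k :: nat \<Rightarrow> int. (\<Sum>i\<in>I. of_int (k i) * z i) \<in> C \<Longrightarrow> \<forall>i\<in>I. k i = 0"
  shows "\<exists>B. finite B \<and> fun_space.independent B \<and>
    B \<subseteq> fun_space.span (ev C ` (z ` I \<union> (\<lambda>i. padic_exp (z i)) ` I)) \<and> card I < card B"
  using assms(3-)
proof (induction "card I" arbitrary: I z rule: less_induct)
  case less
  note fI = less.prems(1) and zr = less.prems(3) and li = less.prems(4)
  define T where "T = ev C ` (z ` I \<union> (\<lambda>i. padic_exp (z i)) ` I)"
  have "\<exists>D\<in>Der C. (\<forall>i\<in>I. D (padic_exp (z i)) = padic_exp (z i) * D (z i)) \<and> (\<exists>i\<in>I. D (z i) \<noteq> 0)"
  proof (rule ccontr)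
    assume a: "\<not> ?thesis"
    obtain i where i: "i \<in> I" using less.prems(2) by blast
    define n where "n = Suc (Max I)"
    have In: "j < n" if "j \<in> I" for j using Max_ge[OF fI that] by (simp add: n_def)
    define z' where "z' j = (if j \<in> I then z j else 0)" for j
    have "\<forall>j<n. nrm (z' j) < rad" using zr rad(1) by (simp add: z'_def)
    moreover have "\<forall>d\<in>Der C. (\<forall>i<n. d (padic_exp (z' i)) = padic_exp (z' i) * d (z' i)) \<longrightarrow> (\<forall>i<n. d (z' i) = 0)"
    proof (intro ballI impI allI)
      fix d j assume d: "d \<in> Der C" "\<forall>i<n. d (padic_exp (z' i)) = padic_exp (z' i) * d (z' i)"
      have "d (padic_exp (z l)) = padic_exp (z l) * d (z l)" if "l \<in> I" for l
        using d(2)[rule_format, OF In[OF that]] that by (simp add: z'_def)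
      then have "\<forall>l\<in>I. d (z l) = 0" using a d(1) by blast
      then show "d (z' j) = 0" using derivation_0[OF Der_derivation[OF d(1)]] by (simp add: z'_def)
    qed
    ultimately have "\<forall>j<n. z' j \<in> C"
      using closed[unfolded exp_closed_def, THEN spec[of _ n], THEN spec[of _ z']] by (elim impE)
    then have "z i \<in> C" using In[OF i] i by (auto simp: z'_def)
    then have "(\<Sum>j\<in>I. of_int (if j = i then 1 else 0) * z j) \<in> C"
      using fI i by (simp add: if_distrib[of "\<lambda>x. of_int x * _"] cong: if_cong)
    then have "\<forall>j\<in>I. (if j = i then 1 else 0 :: int) = 0" by (rule li)
    then show False using i by auto
  qed
  then obtain D i2 where D: "D \<in> Der C" "\<And>i. i \<in> I \<Longrightarrow> D (padic_exp (z i)) = padic_exp (z i) * D (z i)"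
    and i2: "i2 \<in> I" "D (z i2) \<noteq> 0" by blast
  have dD: "derivation D" using D(1) by (rule Der_derivation)
  define W where "W = {w. nrm w < rad \<and> D (padic_exp w) = padic_exp w * D w \<and>
    ev C w \<in> fun_space.span T \<and> ev C (padic_exp w) \<in> fun_space.span T}"
  have W0: "0 \<in> W"
  proof -
    have "ev C 0 = 0" "ev C 1 = 0"
      by (rule ext; simp add: ev_def derivation_0 derivation_1 Der_derivation)+
    then show ?thesis using rad(1) by (simp add: W_def derivation_0[OF dD] derivation_1[OF dD] fun_space.span_zero)
  qed
  have Wadd: "x + y \<in> W" if x: "x \<in> W" and y: "y \<in> W" for x y
  proof -
    have xy: "nrm x < rad" "nrm y < rad" using x y by (simp_all add: W_def)
    have e: "padic_exp (x + y) = padic_exp x * padic_exp y" by (rule padic_exp_add[OF xy])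
    have 1: "ev C (x + y) = ev C x + ev C y"
      by (rule ext) (simp add: ev_def derivation_add Der_derivation)
    have 2: "ev C (padic_exp (x + y)) = (\<lambda>d. padic_exp x * ev C (padic_exp y) d) + (\<lambda>d. padic_exp y * ev C (padic_exp x) d)"
      unfolding e by (rule ext) (simp add: ev_def derivation_mult Der_derivation)
    have "nrm (x + y) < rad" using nrm_add[of x y] xy by linarith
    moreover have "D (padic_exp (x + y)) = padic_exp (x + y) * D (x + y)"
      using x y unfolding e by (simp add: W_def derivation_mult[OF dD] derivation_add[OF dD] distrib_left mult_ac)
    moreover have "ev C (x + y) \<in> fun_space.span T"
      unfolding 1 using x y by (intro fun_space.span_add) (simp_all add: W_def)
    moreover have "ev C (padic_exp (x + y)) \<in> fun_space.span T"
      unfolding 2 using x y by (intro fun_space.span_add fun_space.span_scale) (simp_all add: W_def)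
    ultimately show ?thesis by (simp add: W_def)
  qed
  have Wneg: "- x \<in> W" if x: "x \<in> W" for x
  proof -
    have xr: "nrm x < rad" using x by (simp add: W_def)
    define y where "y = padic_exp x"
    have y: "y \<noteq> 0" using padic_exp_nonzero[OF xr] by (simp add: y_def)
    have e: "padic_exp (- x) = inverse y" using padic_exp_minus[OF xr] by (simp add: y_def inverse_unique)
    have inv: "d (inverse y) = - (1 / y\<^sup>2) * d y" if "derivation d" for d
      using derivation_inverse[OF that y] by simp
    have 1: "ev C (- x) = - ev C x"
      by (rule ext) (simp add: ev_def derivation_minus Der_derivation)
    have 2: "ev C (padic_exp (- x)) = (\<lambda>d. - (1 / y\<^sup>2) * ev C y d)"
      unfolding e by (rule ext) (simp add: ev_def inv Der_derivation)
    have "D (padic_exp (- x)) = padic_exp (- x) * D (- x)"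
    proof -
      have "D y = y * D x" using x by (simp add: W_def y_def)
      then show ?thesis unfolding e inv[OF dD] using y by (simp add: derivation_minus[OF dD] power2_eq_square divide_inverse)
    qed
    moreover have "ev C (- x) \<in> fun_space.span T"
      unfolding 1 using x by (intro fun_space.span_neg) (simp add: W_def)
    moreover have "ev C (padic_exp (- x)) \<in> fun_space.span T"
      unfolding 2 using x by (intro fun_space.span_scale) (simp add: W_def y_def)
    ultimately show ?thesis using xr by (simp add: W_def)
  qed
  have Wint: "of_int k * x \<in> W" if x: "x \<in> W" for k x
  proof -
    have nat: "of_nat m * x \<in> W" for m
      by (induction m) (simp_all add: W0 Wadd x distrib_right)
    show ?thesis
    proof (cases k rule: int_cases2)
      case (nonneg m)
      then show ?thesis using nat by simp
    next
      case (nonpos m)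
      then show ?thesis using Wneg[OF nat[of m]] by simp
    qed
  qed
  have Wsum: "(\<Sum>i\<in>A. f i) \<in> W" if "\<And>i. i \<in> A \<Longrightarrow> f i \<in> W" for A :: "nat set" and f
    using that by (induction A rule: infinite_finite_induct) (simp_all add: W0 Wadd)
  define Fam where "Fam w \<longleftrightarrow> (\<forall>i\<in>I. w i \<in> W) \<and>
    (\<forall>k :: nat \<Rightarrow> int. (\<Sum>i\<in>I. of_int (k i) * w i) \<in> C \<longrightarrow> (\<forall>i\<in>I. k i = 0)) \<and> (\<exists>i\<in>I. D (w i) \<noteq> 0)" for w
  have "Fam z"
    unfolding Fam_def
  proof (intro conjI ballI allI impI)
    fix i assume i: "i \<in> I"
    have "ev C (z i) \<in> T" "ev C (padic_exp (z i)) \<in> T" using i by (simp_all add: T_def)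
    then show "z i \<in> W"
      unfolding W_def using zr[OF i] D(2)[OF i] by (simp add: fun_space.span_base)
  next
    fix k :: "nat \<Rightarrow> int" and i assume "(\<Sum>i\<in>I. of_int (k i) * z i) \<in> C" "i \<in> I"
    then show "k i = 0" using li[of k] by simp
  qed (use i2 in blast)
  define mm where "mm w = card {i\<in>I. D (w i) \<noteq> 0}" for w
  from ex_has_least_nat[of Fam z mm, OF \<open>Fam z\<close>]
  obtain w where w: "Fam w" and min: "\<forall>w'. Fam w' \<longrightarrow> mm w \<le> mm w'" by (elim exE conjE)
  define I1 where "I1 = {i\<in>I. D (w i) \<noteq> 0}"
  define I0 where "I0 = I - I1"
  have wW: "w i \<in> W" if "i \<in> I" for i using w that by (simp add: Fam_def)
  have wli: "\<forall>i\<in>I. k i = 0" if "(\<Sum>i\<in>I. of_int (k i) * w i) \<in> C" for k :: "nat \<Rightarrow> int"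
    using w that unfolding Fam_def by (elim conjE allE impE)
  obtain i1 where i1: "i1 \<in> I" "D (w i1) \<noteq> 0" using w unfolding Fam_def by blast
  have fI1: "finite I1" "finite I0" "I1 \<subseteq> I" "I0 \<subseteq> I" "I0 \<inter> I1 = {}" "I = I0 \<union> I1" "i1 \<in> I1"
    using fI i1 by (auto simp: I1_def I0_def)
  have D0: "D (w i) = 0" if "i \<in> I0" for i using that by (simp add: I0_def I1_def)
  have li1: "\<forall>i\<in>I1. k i = 0" if k: "D (\<Sum>i\<in>I1. of_int (k i) * w i) = 0" for k :: "nat \<Rightarrow> int"
  proof (rule ccontr)
    assume "\<not> (\<forall>i\<in>I1. k i = 0)"
    then obtain j where j: "j \<in> I1" "k j \<noteq> 0" by blast
    then have jI: "j \<in> I" using fI1(3) by blast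
    define s where "s = (\<Sum>i\<in>I1. of_int (k i) * w i)"
    define w' where "w' = w(j := s)"
    have sW: "s \<in> W" unfolding s_def using wW fI1(3) by (intro Wsum Wint) blast
    have "Fam w'"
      unfolding Fam_def
    proof (intro conjI ballI allI impI)
      show "w' i \<in> W" if "i \<in> I" for i using that sW wW by (simp add: w'_def)
      show "\<exists>i\<in>I. D (w' i) \<noteq> 0"
      proof (rule ccontr)
        assume a: "\<not> (\<exists>i\<in>I. D (w' i) \<noteq> 0)"
        have "I1 \<subseteq> {j}"
        proof
          fix i assume "i \<in> I1"
          then have "D (w i) \<noteq> 0" "i \<in> I" by (simp_all add: I1_def)
          moreover have "D (w' i) = 0" using a \<open>i \<in> I\<close> by blast
          ultimately show "i \<in> {j}" by (cases "i = j") (simp_all add: w'_def)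
        qed
        then have "I1 = {j}" using j(1) by blast
        then have "of_int (k j) * D (w j) = 0"
          using k by (simp add: derivation_mult[OF dD] derivation_of_int[OF dD])
        then show False using j by (simp add: I1_def)
      qed
    next
      fix l :: "nat \<Rightarrow> int" and i assume l: "(\<Sum>i\<in>I. of_int (l i) * w' i) \<in> C" and i: "i \<in> I"
      define m where "m i = (if i = j then 0 else l i) + (if i \<in> I1 then l j * k i else 0)" for i
      have "(\<Sum>i\<in>I. of_int (l i) * w' i) = of_int (l j) * s + (\<Sum>i\<in>I - {j}. of_int (l i) * w i)"
        using fI jI by (subst sum.remove[of _ j]) (auto simp: w'_def intro!: sum.cong)
      also have "(\<Sum>i\<in>I - {j}. of_int (l i) * w i) = (\<Sum>i\<in>I. of_int (if i = j then 0 else l i) * w i)"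
        by (rule sum.mono_neutral_cong_left) (use fI in auto)
      also have "of_int (l j) * s = (\<Sum>i\<in>I. of_int (if i \<in> I1 then l j * k i else 0) * w i)"
        unfolding s_def sum_distrib_left by (rule sum.mono_neutral_cong_left) (use fI fI1(3) in auto)
      also have "\<dots> + (\<Sum>i\<in>I. of_int (if i = j then 0 else l i) * w i) = (\<Sum>i\<in>I. of_int (m i) * w i)"
        by (simp only: m_def of_int_add distrib_right sum.distrib add.commute)
      finally have m0: "\<forall>i\<in>I. m i = 0" using l by (intro wli) simp
      have "l j * k j = 0" using m0[rule_format, OF jI] j(1) by (simp add: m_def)
      then have lj: "l j = 0" using j(2) by simp
      then show "l i = 0" using m0[rule_format, OF i] by (cases "i = j") (simp_all add: m_def lj split: if_splits)
    qed
    then have "mm w \<le> mm w'" using min by simp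
    moreover have "mm w' < mm w"
      unfolding mm_def
    proof (rule psubset_card_mono)
      have "{i\<in>I. D (w' i) \<noteq> 0} \<subseteq> {i\<in>I. D (w i) \<noteq> 0}" "j \<notin> {i\<in>I. D (w' i) \<noteq> 0}"
        using k by (auto simp: w'_def s_def split: if_splits)
      moreover have "j \<in> {i\<in>I. D (w i) \<noteq> 0}" using j(1) by (simp add: I1_def)
      ultimately show "{i\<in>I. D (w' i) \<noteq> 0} \<subset> {i\<in>I. D (w i) \<noteq> 0}" by blast
    qed (use fI in simp)
    ultimately show False by simp
  qed
  have W': "nrm x < rad" "D (padic_exp x) = padic_exp x * D x" "ev C x \<in> fun_space.span T"
    "ev C (padic_exp x) \<in> fun_space.span T" if "x \<in> W" for x
    using that by (simp_all add: W_def)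
  have "\<exists>B0. finite B0 \<and> fun_space.independent B0 \<and>
    B0 \<subseteq> fun_space.span (ev C ` (w ` I0 \<union> (\<lambda>i. padic_exp (w i)) ` I0)) \<and> card I0 \<le> card B0"
  proof (cases "I0 = {}")
    case True
    then show ?thesis by (intro exI[of _ "{}"]) (simp add: fun_space.independent_empty)
  next
    case False
    have "card I0 < card I"
      using fI1(1,2,5,6,7) by (auto simp: card_Un_disjoint card_gt_0_iff)
    then have "\<exists>B. finite B \<and> fun_space.independent B \<and>
      B \<subseteq> fun_space.span (ev C ` (w ` I0 \<union> (\<lambda>i. padic_exp (w i)) ` I0)) \<and> card I0 < card B"
    proof (rule less.hyps[OF _ fI1(2) False])
      show "nrm (w i) < rad" if "i \<in> I0" for i using that fI1(4) wW W'(1) by blast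
      fix k :: "nat \<Rightarrow> int" assume k: "(\<Sum>i\<in>I0. of_int (k i) * w i) \<in> C"
      have "(\<Sum>i\<in>I. of_int (if i \<in> I0 then k i else 0) * w i) = (\<Sum>i\<in>I0. of_int (k i) * w i)"
        by (rule sum.mono_neutral_cong_right) (use fI fI1(4) in auto)
      then have *: "\<forall>i\<in>I. (if i \<in> I0 then k i else 0) = 0" using k by (intro wli) simp
      show "\<forall>i\<in>I0. k i = 0"
      proof
        fix i assume "i \<in> I0"
        then show "k i = 0" using *[rule_format, of i] fI1(4) by auto
      qed
    qed
    then show ?thesis by (rule ex_forward) (elim conjE, intro conjI; (assumption | rule less_imp_le))
  qed
  then obtain B0 where B0: "finite B0" "fun_space.independent B0"
    "B0 \<subseteq> fun_space.span (ev C ` (w ` I0 \<union> (\<lambda>i. padic_exp (w i)) ` I0))" "card I0 \<le> card B0"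
    by (elim exE conjE)
  have "\<exists>B. finite B \<and> fun_space.independent B \<and> B \<subseteq> fun_space.span T \<and> card B = card B0 + card I1 + 1"
  proof (rule independent_append_forms[OF D(1) B0(1,2) _ fI1(1), where w = w and e = "\<lambda>i. padic_exp (w i)" and ?i1.0 = i1])
    fix \<phi> d assume \<phi>: "\<phi> \<in> B0" and d: "d \<in> Der {x. D x = 0}"
    have dC: "d \<in> Der C" using d D(1) by (auto simp: Der_def)
    have z: "D (w i) = 0" "D (padic_exp (w i)) = 0" if "i \<in> I0" for i
      using D0[OF that] W'(2)[OF wW[of i]] that fI1(4) by auto
    show "\<phi> d = 0"
    proof (rule vanish_on_span[where \<phi> = \<phi> and d = d])
      show "\<phi> \<in> fun_space.span (ev C ` (w ` I0 \<union> (\<lambda>i. padic_exp (w i)) ` I0))" using B0(3) \<phi> by blast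
      fix t assume "t \<in> ev C ` (w ` I0 \<union> (\<lambda>i. padic_exp (w i)) ` I0)"
      then obtain s where s: "t = ev C s" "D s = 0" using z by auto
      then show "t d = 0" using d dC by (simp add: ev_apply) (simp add: Der_def)
    qed
  next
    show "B0 \<subseteq> fun_space.span T"
    proof -
      have "ev C ` (w ` I0 \<union> (\<lambda>i. padic_exp (w i)) ` I0) \<subseteq> fun_space.span T"
        using wW fI1(4) W'(3,4) by blast
      from fun_space.span_minimal[OF this fun_space.subspace_span] B0(3) show ?thesis by (rule order_trans[rotated])
    qed
    show "i1 \<in> I1" "D (w i1) \<noteq> 0" by fact+
    show "\<forall>i\<in>I1. k i = 0" if "D (\<Sum>i\<in>I1. of_int (k i) * w i) = 0" for k :: "nat \<Rightarrow> int"
      using that by (rule li1)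
    fix i assume "i \<in> I1"
    then have i: "w i \<in> W" using wW fI1(3) by blast
    show "padic_exp (w i) \<noteq> 0" by (rule padic_exp_nonzero[OF W'(1)[OF i]])
    show "D (padic_exp (w i)) = padic_exp (w i) * D (w i)" by (rule W'(2)[OF i])
    show "ev C (w i) \<in> fun_space.span T" "ev C (padic_exp (w i)) \<in> fun_space.span T"
      by (rule W'(3)[OF i], rule W'(4)[OF i])
  qed
  then obtain B where B: "finite B" "fun_space.independent B" "B \<subseteq> fun_space.span T" "card B = card B0 + card I1 + 1"
    by (elim exE conjE)
  have "card I = card I0 + card I1" using fI1(1,2,5,6) by (simp add: card_Un_disjoint)
  then have "card I < card B" using B(4) B0(4) by simp
  then show ?case using B(1-3) unfolding T_def by (intro exI[of _ B] conjI)
qed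

lemma trdeg_exponential:
  fixes z :: "nat \<Rightarrow> 'a"
  assumes C: "is_subfield C"
    and closed: "exp_closed C"
    and n: "n \<ge> 1" and z: "\<forall>i\<in>{1..n}. z i \<in> padic_disc p v" and li: "rat_lin_indep_mod C n z"
  shows "trdeg C (adjoin C (z ` {1..n} \<union> (\<lambda>i. padic_exp (z i)) ` {1..n})) > enat n"
proof -
  define S where "S = z ` {1..n} \<union> (\<lambda>i. padic_exp (z i)) ` {1..n}"
  have "\<exists>B. finite B \<and> fun_space.independent B \<and> B \<subseteq> fun_space.span (ev C ` S) \<and> card {1..n} < card B"
    unfolding S_def
  proof (rule exponential_rank[OF C closed])
    show "{1..n} \<noteq> {}" using n by simp
    show "nrm (z i) < rad" if "i \<in> {1..n}" for i using z that by (simp add: padic_disc_iff)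
    fix k :: "nat \<Rightarrow> int" assume k: "(\<Sum>i = 1..n. of_int (k i) * z i) \<in> C"
    have "\<forall>i\<in>{1..n}. (of_int (k i) :: rat) = 0"
      using li[unfolded rat_lin_indep_mod_def, THEN spec, of "\<lambda>i. of_int (k i)"] k by simp
    then show "\<forall>i\<in>{1..n}. k i = 0" by simp
  qed simp
  then obtain B where B: "fun_space.independent B" "B \<subseteq> fun_space.span (ev C ` S)" "n < card B"
    by (elim exE conjE) simp
  have "finite S" by (simp add: S_def)
  from diff_independent_of_span[OF this B(1,2)]
  obtain S' where S': "S' \<subseteq> S" "diff_independent C S'" "card B \<le> card S'" by (elim exE conjE)
  have "S \<subseteq> adjoin C S" by (rule adjoin_superset)
  then have "S' \<in> {B. finite B \<and> B \<subseteq> adjoin C S \<and> algebraically_independent C B}"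
    using S'(1,2) diff_independent_imp_algebraically_independent[OF S'(2)]
    by (auto simp: diff_independent_def)
  then have "enat (card S') \<le> trdeg C (adjoin C S)"
    unfolding trdeg_def by (rule SUP_upper)
  moreover have "enat n < enat (card S')" using B(3) S'(3) by simp
  ultimately show ?thesis unfolding S_def by (rule order.strict_trans2[rotated])
qed

end

theorem corollary3p13:
  fixes p :: nat and v :: "'a::{field_char_0, complete_space} \<Rightarrow> ereal"
  assumes "padic_complex_field p v"
  shows "\<exists>C :: 'a set. is_subfield C \<and> countable C \<and>
    (\<forall>n\<ge>1. \<forall>z :: nat \<Rightarrow> 'a.
       (\<forall>i\<in>{1..n}. z i \<in> padic_disc p v) \<and> rat_lin_indep_mod C n z \<longrightarrow>
       trdeg C (adjoin C (z ` {1..n} \<union> (\<lambda>i. padic_exp (z i)) ` {1..n})) > enat n)"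
proof -
  interpret padic_complex_field p v by (rule assms)
  from exponentially_closed_subfield obtain C where C: "is_subfield C" "countable C"
    and closed: "exp_closed C"
    by (elim exE conjE)
  show ?thesis
    by (intro exI[of _ C] conjI C allI impI, elim conjE) (rule trdeg_exponential[OF C(1) closed])
qed

end
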